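(* Let $\mathcal S$ be a guarded standard equation system satisfied by some nondeterministic expression $E$. Then there is a guarded, saturated standard equation system $\mathcal T$ satisfied by $E$.
   Context: Fix a set $\mathsf{Act}$ of actions containing $\tau$ and a set $\mathsf{Var}$ of variables. Nondeterministic expressions: $E ::= 0 \mid X \mid \alpha.P \mid \mathrm{rec}\,X.E \mid E + E$; probabilistic expressions: $P ::= \partial(E) \mid P \oplus_p P$ ($0<p<1$); $\bigoplus_{k}p_kE_k$ is an iterated $\oplus$ of $\partial(E_k)$ giving $E_k$ probability $p_k$. Subdistributions, Dirac $\delta$, operational semantics: least relations with $\partial(E)\mapsto\delta_E$; $P\oplus_pQ\mapsto p\mu+(1-p)\nu$ if $P\mapsto\mu,Q\mapsto\nu$; $\alpha.P\xrightarrow{\alpha}\mu$ if $P\mapsto\mu$; $\mathrm{rec}\,X.E\xrightarrow{\alpha}\mu$ if $E[\mathrm{rec}\,X.E/X]\xrightarrow{\alpha}\mu$; $E+F\xrightarrow{\alpha}\mu$ and $F+E\xrightarrow{\alpha}\mu$ if $E\xrightarrow{\alpha}\mu$. Probabilistic unguardedness $E\rhd V$ is the least relation with: $X\rhd\{X\}$; $\tau.P\rhd V$ if $P\rhd V$; $\mathrm{rec}\,Y.E\rhd V\setminus\{Y\}$ if $E\rhd V$ and $V\ne\{Y\}$; $E+F\rhd V$ if $E\rhd V$; $E+F\rhd W$ if $F\rhd W$; $\partial(E)\rhd V$ if $E\rhd V$; $P\oplus_pQ\rhd V\cup W$ if $P\rhd V$, $Q\rhd W$. Provable equality $=$: least equivalence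 and congruence on expressions, allowing renaming of bound variables, containing all instances of: $E+F=F+E$; $E+(F+G)=(E+F)+G$; $E+E=E$; $E+0=E$; $P\oplus_pQ=Q\oplus_{1-p}P$; $P\oplus_p(Q\oplus_{q/(1-p)}R)=(P\oplus_{p/(p+q)}Q)\oplus_{p+q}R$; $P\oplus_pP=P$; $\alpha.(\partial(\tau.\partial(E))\oplus_pP)=\alpha.(\partial(E)\oplus_pP)$; $\tau.\bigoplus_ip_i(E_i+F)+F=\tau.\bigoplus_ip_i(E_i+F)$; $\tau.\bigoplus_ip_i(E_i+\alpha.P_i)+\alpha.\bigoplus_ip_iP_i=\tau.\bigoplus_ip_i(E_i+\alpha.P_i)$; $\alpha.\bigoplus_ip_i(E_i+\tau.P_i)+\alpha.\bigoplus_ip_iP_i=\alpha.\bigoplus_ip_i(E_i+\tau.P_i)$; $\alpha.P+\alpha.Q=\alpha.P+\alpha.(P\oplus_pQ)+\alpha.Q$; $\mathrm{rec}\,X.E=E[\mathrm{rec}\,X.E/X]$; $\mathrm{rec}\,X.(\tau.(\partial(X+E)\oplus_pP)+F)=\mathrm{rec}\,X.(\tau.(\partial(X+E)\oplus_pP)+\tau.P+F)$; $\mathrm{rec}\,X.(X+E)=\mathrm{rec}\,X.E$; $\mathrm{rec}\,X.(\tau.\partial(X)+E)=\mathrm{rec}\,X.\tau.\partial(E)$; $\mathrm{rec}\,X.(\tau.\bigoplus_ip_i(X+E_i)+F)=\mathrm{rec}\,X.(\tau.\partial(X)+\sum_iE_i+F)$; and closed under the rule: if $F=E[F/X]$ and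 not $E\rhd\{X\}$ then $F=\mathrm{rec}\,X.E$. An equation system $\mathcal S:\vec X=\vec S$ consists of distinct formal variables $X_1,\dots,X_n$ and expressions $S_1,\dots,S_n$; $\mathrm{Var}(\mathcal S)$ is the set of non-formal variables occurring in the $S_i$. It is standard if each $S_i$ has the form $\sum_j\alpha_{i,j}.\bigoplus_{k=1}^np_{i,j,k}X_k+\sum_jV_{i,j}$ with $V_{i,j}\in\mathrm{Var}(\mathcal S)$. $\mathcal S$ is satisfied by $E$ if there are $E_1,\dots,E_n$ with $E$ syntactically equal to $E_1$ and $E_i=S_i[\vec E/\vec X]$ provable for all $i$. For standard $\mathcal S$: $X_i\xrightarrow{\alpha}_{\mathcal S}\mu$ iff $S_i\xrightarrow{\alpha}\mu$; combined transitions are the least relation with $\delta_{X_i}\xrightarrow{\alpha}_{\mathcal S}\mu$ for such transitions, closed under $\sum p_i\nu_i\xrightarrow{\alpha}_{\mathcal S}\sum p_i\mu_i$ ($p_i\ge0,\sum p_i\le1$); a derivation is $(\mu_i^{\to},\mu_i^{\times})_i$ with $\mu_i^{\to}\xrightarrow{\tau}_{\mathcal S}\mu_{i+1}^{\to}+\mu_{i+1}^{\times}$; $\mu\Rightarrow_{\mathcal S}\nu$ iff some derivation has $\mu=\mu_0^\to+\mu_0^\times$, $\nu=\sum_i\mu_i^\times$; $\xRightarrow{\alpha}_{\mathcal S}$ is $\Rightarrow_{\mathcal S}\xrightarrow{\alpha}_{\mathcal S}\Rightarrow_{\mathcal S}$. A standard $\mathcal S$ is guarded if there is no $i$ with $\delta_{X_i}\xRightarrow{\tau}_{\mathcal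 S}\delta_{X_i}$. It is saturated if (i) whenever $\delta_{X_i}\xRightarrow{\alpha}_{\mathcal S}\mu$ then $\delta_{X_i}\xrightarrow{\alpha}_{\mathcal S}\mu$ (combined transition), and (ii) whenever $\delta_{X_i}\Rightarrow_{\mathcal S}\mu$ and $V\in\mathrm{Var}(\mathcal S)$ occurs in $S_j$ for all $j$ with $\mu(X_j)>0$, then $V$ occurs in $S_i$. *)

theory Defs
  imports "HOL-Analysis.Infinite_Sum" "HOL-Library.Infinite_Typeclass"
begin

datatype 'a act = Tau | Vis 'a

text \<open>Nondeterministic expressions (expE) and probabilistic expressions (expP).
  ENil = 0, EVar X, EPre alpha P = alpha.P, ERec X E = rec X.E, ESum E F = E + F,
  PDirac E = partial(E), PCh P p Q = P (+)_p Q.  The side condition 0 < p < 1 is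
  imposed by the predicate wfE / wfP.\<close>
datatype ('a, 'v) expE =
    ENil
  | EVar 'v
  | EPre "'a act" "('a, 'v) expP"
  | ERec 'v "('a, 'v) expE"
  | ESum "('a, 'v) expE" "('a, 'v) expE"
and ('a, 'v) expP =
    PDirac "('a, 'v) expE"
  | PCh "('a, 'v) expP" real "('a, 'v) expP"

fun wfE :: "('a, 'v) expE \<Rightarrow> bool" and wfP :: "('a, 'v) expP \<Rightarrow> bool" where
  "wfE ENil = True"
| "wfE (EVar x) = True"
| "wfE (EPre a P) = wfP P"
| "wfE (ERec x E) = wfE E"
| "wfE (ESum E F) = (wfE E \<and> wfE F)"
| "wfP (PDirac E) = wfE E"
| "wfP (PCh P p Q) = (0 < p \<and> p < 1 \<and> wfP P \<and> wfP Q)"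

fun fvE :: "('a, 'v) expE \<Rightarrow> 'v set" and fvP :: "('a, 'v) expP \<Rightarrow> 'v set" where
  "fvE ENil = {}"
| "fvE (EVar x) = {x}"
| "fvE (EPre a P) = fvP P"
| "fvE (ERec x E) = fvE E - {x}"
| "fvE (ESum E F) = fvE E \<union> fvE F"
| "fvP (PDirac E) = fvE E"
| "fvP (PCh P p Q) = fvP P \<union> fvP Q"

fun varsE :: "('a, 'v) expE \<Rightarrow> 'v set" and varsP :: "('a, 'v) expP \<Rightarrow> 'v set" where
  "varsE ENil = {}"
| "varsE (EVar x) = {x}"
| "varsE (EPre a P) = varsP P"
| "varsE (ERec x E) = insert x (varsE E)"
| "varsE (ESum E F) = varsE E \<union> varsE F"
| "varsP (PDirac E) = varsE E"
| "varsP (PCh P p Q) = varsP P \<union> varsP Q"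

lemma finite_fv: fixes E :: "('a, 'v) expE" and P :: "('a, 'v) expP" shows "finite (fvE E)" "finite (fvP P)"
  by (induct E and P rule: expE.induct expP.induct) auto

lemma finite_vars: fixes E :: "('a, 'v) expE" and P :: "('a, 'v) expP" shows "finite (varsE E)" "finite (varsP P)"
  by (induct E and P rule: expE.induct expP.induct) auto

definition sw :: "'v \<Rightarrow> 'v \<Rightarrow> 'v \<Rightarrow> 'v" where
  "sw a b x = (if x = a then b else if x = b then a else x)"

fun swapE :: "'v \<Rightarrow> 'v \<Rightarrow> ('a, 'v) expE \<Rightarrow> ('a, 'v) expE"
and swapP :: "'v \<Rightarrow> 'v \<Rightarrow> ('a, 'v) expP \<Rightarrow> ('a, 'v) expP" where
  "swapE a b ENil = ENil"
| "swapE a b (EVar x) = EVar (sw a b x)"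
| "swapE a b (EPre c P) = EPre c (swapP a b P)"
| "swapE a b (ERec x E) = ERec (sw a b x) (swapE a b E)"
| "swapE a b (ESum E F) = ESum (swapE a b E) (swapE a b F)"
| "swapP a b (PDirac E) = PDirac (swapE a b E)"
| "swapP a b (PCh P p Q) = PCh (swapP a b P) p (swapP a b Q)"

lemma size_swap: fixes E :: "('a, 'v) expE" and P :: "('a, 'v) expP" shows "size (swapE a b E) = size E" "size (swapP a b P) = size P"
  by (induct E and P rule: expE.induct expP.induct) auto

definition fresh :: "'v set \<Rightarrow> 'v" where
  "fresh S = (SOME z. z \<notin> S)"

text \<open>Capture-avoiding simultaneous substitution: every variable y is replaced by
  sigma y (sigma y = EVar y means no replacement); bound variables are renamed
  to a fresh name when capture would occur.\<close>
function substE :: "('v \<Rightarrow> ('a, 'v) expE) \<Rightarrow> ('a, 'v) expE \<Rightarrow> ('a, 'v) expE"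
and substP :: "('v \<Rightarrow> ('a, 'v) expE) \<Rightarrow> ('a, 'v) expP \<Rightarrow> ('a, 'v) expP" where
  "substE \<sigma> ENil = ENil"
| "substE \<sigma> (EVar x) = \<sigma> x"
| "substE \<sigma> (EPre a P) = EPre a (substP \<sigma> P)"
| "substE \<sigma> (ESum E F) = ESum (substE \<sigma> E) (substE \<sigma> F)"
| "substE \<sigma> (ERec x E) =
     (let bad = (\<Union>y \<in> fvE E - {x}. fvE (\<sigma> y)) in
      if x \<notin> bad then ERec x (substE (\<sigma>(x := EVar x)) E)
      else (let z = fresh (bad \<union> varsE E \<union> {x}) in
            ERec z (substE (\<sigma>(z := EVar z)) (swapE x z E))))"
| "substP \<sigma> (PDirac E) = PDirac (substE \<sigma> E)"
| "substP \<sigma> (PCh P p Q) = PCh (substP \<sigma> P) p (substP \<sigma> Q)"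
  by pat_completeness auto
termination
  by (relation "measure (case_sum (\<lambda>(\<sigma>, E). size E) (\<lambda>(\<sigma>, P). size P))")
     (auto simp: size_swap)

definition subst1 :: "('a, 'v) expE \<Rightarrow> ('a, 'v) expE \<Rightarrow> 'v \<Rightarrow> ('a, 'v) expE" where
  "subst1 E F X = substE (EVar(X := F)) E"

text \<open>Iterated probabilistic choice: bigoplusP [(p1,P1),...,(pk,Pk)] gives Pi weight pi
  (for a nonempty list of positive weights summing to 1).\<close>
fun bigoplusP :: "(real \<times> ('a, 'v) expP) list \<Rightarrow> ('a, 'v) expP" where
  "bigoplusP [] = PDirac ENil"
| "bigoplusP [(p, P)] = P"
| "bigoplusP ((p, P) # q # xs) =
     PCh P p (bigoplusP (map (\<lambda>(r, Q). (r / (1 - p), Q)) (q # xs)))"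

definition bigoplus :: "(real \<times> ('a, 'v) expE) list \<Rightarrow> ('a, 'v) expP" where
  "bigoplus ps = bigoplusP (map (\<lambda>(p, E). (p, PDirac E)) ps)"

definition weights :: "real list \<Rightarrow> bool" where
  "weights ps \<longleftrightarrow> ps \<noteq> [] \<and> (\<forall>p \<in> set ps. 0 < p) \<and> sum_list ps = 1"

fun sumlist :: "('a, 'v) expE list \<Rightarrow> ('a, 'v) expE" where
  "sumlist [] = ENil"
| "sumlist [E] = E"
| "sumlist (E # F # Es) = ESum E (sumlist (F # Es))"

inductive ungE :: "('a, 'v) expE \<Rightarrow> 'v set \<Rightarrow> bool"
and ungP :: "('a, 'v) expP \<Rightarrow> 'v set \<Rightarrow> bool" where
  "ungE (EVar X) {X}"
| "ungP P V \<Longrightarrow> ungE (EPre Tau P) V"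
| "ungE E V \<Longrightarrow> V \<noteq> {Y} \<Longrightarrow> ungE (ERec Y E) (V - {Y})"
| "ungE E V \<Longrightarrow> ungE (ESum E F) V"
| "ungE F W \<Longrightarrow> ungE (ESum E F) W"
| "ungE E V \<Longrightarrow> ungP (PDirac E) V"
| "ungP P V \<Longrightarrow> ungP Q W \<Longrightarrow> ungP (PCh P p Q) (V \<union> W)"

inductive eqE :: "('a, 'v) expE \<Rightarrow> ('a, 'v) expE \<Rightarrow> bool"
and eqP :: "('a, 'v) expP \<Rightarrow> ('a, 'v) expP \<Rightarrow> bool" where
  reflE: "eqE E E"
| symE: "eqE E F \<Longrightarrow> eqE F E"
| transE: "eqE E F \<Longrightarrow> eqE F G \<Longrightarrow> eqE E G"
| reflP: "eqP P P"
| symP: "eqP P Q \<Longrightarrow> eqP Q P"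
| transP: "eqP P Q \<Longrightarrow> eqP Q R \<Longrightarrow> eqP P R"
| congPre: "eqP P Q \<Longrightarrow> eqE (EPre a P) (EPre a Q)"
| congRec: "eqE E F \<Longrightarrow> eqE (ERec X E) (ERec X F)"
| congSum: "eqE E E' \<Longrightarrow> eqE F F' \<Longrightarrow> eqE (ESum E F) (ESum E' F')"
| congDirac: "eqE E F \<Longrightarrow> eqP (PDirac E) (PDirac F)"
| congCh: "0 < p \<Longrightarrow> p < 1 \<Longrightarrow> eqP P P' \<Longrightarrow> eqP Q Q' \<Longrightarrow> eqP (PCh P p Q) (PCh P' p Q')"
| alpha: "Y \<notin> fvE (ERec X E) \<Longrightarrow> eqE (ERec X E) (ERec Y (subst1 E (EVar Y) X))"
| ax_comm: "eqE (ESum E F) (ESum F E)"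
| ax_assoc: "eqE (ESum E (ESum F G)) (ESum (ESum E F) G)"
| ax_idem: "eqE (ESum E E) E"
| ax_nil: "eqE (ESum E ENil) E"
| ax_pcomm: "0 < p \<Longrightarrow> p < 1 \<Longrightarrow> eqP (PCh P p Q) (PCh Q (1 - p) P)"
| ax_passoc: "0 < p \<Longrightarrow> 0 < q \<Longrightarrow> p + q < 1 \<Longrightarrow>
    eqP (PCh P p (PCh Q (q / (1 - p)) R)) (PCh (PCh P (p / (p + q)) Q) (p + q) R)"
| ax_pidem: "0 < p \<Longrightarrow> p < 1 \<Longrightarrow> eqP (PCh P p P) P"
| ax_tau1: "0 < p \<Longrightarrow> p < 1 \<Longrightarrow>
    eqE (EPre a (PCh (PDirac (EPre Tau (PDirac E))) p P)) (EPre a (PCh (PDirac E) p P))"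
| ax_tau2: "weights (map fst ps) \<Longrightarrow>
    eqE (ESum (EPre Tau (bigoplus (map (\<lambda>(p, E). (p, ESum E F)) ps))) F)
        (EPre Tau (bigoplus (map (\<lambda>(p, E). (p, ESum E F)) ps)))"
| ax_tau3: "weights (map fst ps) \<Longrightarrow>
    eqE (ESum (EPre Tau (bigoplus (map (\<lambda>(p, E, P). (p, ESum E (EPre a P))) ps)))
              (EPre a (bigoplusP (map (\<lambda>(p, E, P). (p, P)) ps))))
        (EPre Tau (bigoplus (map (\<lambda>(p, E, P). (p, ESum E (EPre a P))) ps)))"
| ax_tau4: "weights (map fst ps) \<Longrightarrow>
    eqE (ESum (EPre a (bigoplus (map (\<lambda>(p, E, P). (p, ESum E (EPre Tau P))) ps)))
              (EPre a (bigoplusP (map (\<lambda>(p, E, P). (p, P)) ps))))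
        (EPre a (bigoplus (map (\<lambda>(p, E, P). (p, ESum E (EPre Tau P))) ps)))"
| ax_cc: "0 < p \<Longrightarrow> p < 1 \<Longrightarrow>
    eqE (ESum (EPre a P) (EPre a Q))
        (ESum (ESum (EPre a P) (EPre a (PCh P p Q))) (EPre a Q))"
| ax_unfold: "eqE (ERec X E) (subst1 E (ERec X E) X)"
| ax_rec1: "0 < p \<Longrightarrow> p < 1 \<Longrightarrow>
    eqE (ERec X (ESum (EPre Tau (PCh (PDirac (ESum (EVar X) E)) p P)) F))
        (ERec X (ESum (ESum (EPre Tau (PCh (PDirac (ESum (EVar X) E)) p P)) (EPre Tau P)) F))"
| ax_rec2: "eqE (ERec X (ESum (EVar X) E)) (ERec X E)"
| ax_rec3: "eqE (ERec X (ESum (EPre Tau (PDirac (EVar X))) E)) (ERec X (EPre Tau (PDirac E)))"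
| ax_rec4: "weights (map fst ps) \<Longrightarrow>
    eqE (ERec X (ESum (EPre Tau (bigoplus (map (\<lambda>(p, E). (p, ESum (EVar X) E)) ps))) F))
        (ERec X (ESum (ESum (EPre Tau (PDirac (EVar X))) (sumlist (map snd ps))) F))"
| ufi: "eqE F (subst1 E F X) \<Longrightarrow> \<not> ungE E {X} \<Longrightarrow> eqE F (ERec X E)"

definition dirac :: "'e \<Rightarrow> 'e \<Rightarrow> real" where
  "dirac x = (\<lambda>y. if y = x then 1 else 0)"

definition subdist :: "('e \<Rightarrow> real) \<Rightarrow> bool" where
  "subdist \<mu> \<longleftrightarrow> (\<forall>x. 0 \<le> \<mu> x) \<and> \<mu> summable_on UNIV \<and> infsum \<mu> UNIV \<le> 1"

inductive pstep :: "('a, 'v) expP \<Rightarrow> (('a, 'v) expE \<Rightarrow> real) \<Rightarrow> bool" where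
  "pstep (PDirac E) (dirac E)"
| "pstep P \<mu> \<Longrightarrow> pstep Q \<nu> \<Longrightarrow> pstep (PCh P p Q) (\<lambda>x. p * \<mu> x + (1 - p) * \<nu> x)"

inductive step :: "('a, 'v) expE \<Rightarrow> 'a act \<Rightarrow> (('a, 'v) expE \<Rightarrow> real) \<Rightarrow> bool" where
  "pstep P \<mu> \<Longrightarrow> step (EPre a P) a \<mu>"
| "step (subst1 E (ERec X E) X) a \<mu> \<Longrightarrow> step (ERec X E) a \<mu>"
| "step E a \<mu> \<Longrightarrow> step (ESum E F) a \<mu>"
| "step E a \<mu> \<Longrightarrow> step (ESum F E) a \<mu>"

text \<open>An equation system is a pair (Xs, Ss): formal variables X_1..X_n and right-hand sides
  S_1..S_n (0-based list indices).\<close>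
type_synonym ('a, 'v) eqsys = "'v list \<times> ('a, 'v) expE list"

definition eqsys :: "('a, 'v) eqsys \<Rightarrow> bool" where
  "eqsys S \<longleftrightarrow> distinct (fst S) \<and> length (fst S) = length (snd S)"

definition nvars :: "('a, 'v) eqsys \<Rightarrow> 'v set" where
  "nvars S = {V. V \<notin> set (fst S) \<and> (\<exists>E \<in> set (snd S). V \<in> fvE E)}"

inductive fdist :: "'v set \<Rightarrow> ('a, 'v) expP \<Rightarrow> bool" for Fm where
  "X \<in> Fm \<Longrightarrow> fdist Fm (PDirac (EVar X))"
| "fdist Fm P \<Longrightarrow> fdist Fm Q \<Longrightarrow> 0 < p \<Longrightarrow> p < 1 \<Longrightarrow> fdist Fm (PCh P p Q)"

inductive stdsum :: "'v set \<Rightarrow> ('a, 'v) expE \<Rightarrow> bool" for Fm where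
  "stdsum Fm ENil"
| "fdist Fm P \<Longrightarrow> stdsum Fm (EPre a P)"
| "V \<notin> Fm \<Longrightarrow> stdsum Fm (EVar V)"
| "stdsum Fm E \<Longrightarrow> stdsum Fm F \<Longrightarrow> stdsum Fm (ESum E F)"

definition standard :: "('a, 'v) eqsys \<Rightarrow> bool" where
  "standard S \<longleftrightarrow> eqsys S \<and> (\<forall>E \<in> set (snd S). stdsum (set (fst S)) E)"

definition simsub :: "'v list \<Rightarrow> ('a, 'v) expE list \<Rightarrow> 'v \<Rightarrow> ('a, 'v) expE" where
  "simsub Xs Es = (\<lambda>y. case map_of (zip Xs Es) y of None \<Rightarrow> EVar y | Some F \<Rightarrow> F)"

definition satisfies :: "('a, 'v) eqsys \<Rightarrow> ('a, 'v) expE \<Rightarrow> bool" where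
  "satisfies S E \<longleftrightarrow>
     (\<exists>Es. length Es = length (fst S) \<and> Es \<noteq> [] \<and> E = Es ! 0 \<and>
        (\<forall>F \<in> set Es. wfE F) \<and>
        (\<forall>i < length (fst S). eqE (Es ! i) (substE (simsub (fst S) Es) (snd S ! i))))"

inductive ctrans :: "('a, 'v) eqsys \<Rightarrow> (('a, 'v) expE \<Rightarrow> real) \<Rightarrow> 'a act
                     \<Rightarrow> (('a, 'v) expE \<Rightarrow> real) \<Rightarrow> bool" for S where
  base: "i < length (fst S) \<Longrightarrow> step (snd S ! i) a \<mu> \<Longrightarrow> ctrans S (dirac (EVar (fst S ! i))) a \<mu>"
| comb: "finite (I :: nat set) \<Longrightarrow> (\<forall>i \<in> I. ctrans S (\<nu> i) a (\<mu> i)) \<Longrightarrow> (\<forall>i \<in> I. 0 \<le> p i) \<Longrightarrow>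
         sum p I \<le> 1 \<Longrightarrow>
         ctrans S (\<lambda>x. \<Sum>i \<in> I. p i * \<nu> i x) a (\<lambda>x. \<Sum>i \<in> I. p i * \<mu> i x)"

definition derivation :: "('a, 'v) eqsys \<Rightarrow> (nat \<Rightarrow> ('a, 'v) expE \<Rightarrow> real)
                          \<Rightarrow> (nat \<Rightarrow> ('a, 'v) expE \<Rightarrow> real) \<Rightarrow> bool" where
  "derivation S mto mx \<longleftrightarrow>
     (\<forall>i. subdist (mto i) \<and> subdist (mx i)) \<and>
     (\<forall>i. ctrans S (mto i) Tau (\<lambda>x. mto (Suc i) x + mx (Suc i) x))"

definition wtrans :: "('a, 'v) eqsys \<Rightarrow> (('a, 'v) expE \<Rightarrow> real) \<Rightarrow> (('a, 'v) expE \<Rightarrow> real) \<Rightarrow> bool" where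
  "wtrans S \<mu> \<nu> \<longleftrightarrow>
     (\<exists>mto mx. derivation S mto mx \<and> \<mu> = (\<lambda>x. mto 0 x + mx 0 x) \<and>
        (\<forall>x. (\<lambda>i. mx i x) sums \<nu> x))"

definition wtransa :: "('a, 'v) eqsys \<Rightarrow> (('a, 'v) expE \<Rightarrow> real) \<Rightarrow> 'a act
                       \<Rightarrow> (('a, 'v) expE \<Rightarrow> real) \<Rightarrow> bool" where
  "wtransa S \<mu> a \<nu> \<longleftrightarrow> (\<exists>\<mu>1 \<mu>2. wtrans S \<mu> \<mu>1 \<and> ctrans S \<mu>1 a \<mu>2 \<and> wtrans S \<mu>2 \<nu>)"

definition guarded :: "('a, 'v) eqsys \<Rightarrow> bool" where
  "guarded S \<longleftrightarrow>
     \<not> (\<exists>i < length (fst S). wtransa S (dirac (EVar (fst S ! i))) Tau (dirac (EVar (fst S ! i))))"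

definition saturated :: "('a, 'v) eqsys \<Rightarrow> bool" where
  "saturated S \<longleftrightarrow>
     (\<forall>i < length (fst S). \<forall>a \<mu>.
        wtransa S (dirac (EVar (fst S ! i))) a \<mu> \<longrightarrow> ctrans S (dirac (EVar (fst S ! i))) a \<mu>) \<and>
     (\<forall>i < length (fst S). \<forall>\<mu> V.
        wtrans S (dirac (EVar (fst S ! i))) \<mu> \<and> V \<in> nvars S \<and>
        (\<forall>j < length (fst S). \<mu> (EVar (fst S ! j)) > 0 \<longrightarrow> V \<in> fvE (snd S ! j))
        \<longrightarrow> V \<in> fvE (snd S ! i))"

end

theory Submission
  imports Defs
begin

text \<open>
  A derivation of a guarded system is replaced by its expected numbers of transitions, a nonnegative
  flow on the finite graph of transitions.  Guardedness means exactly that there is no nonzero circulation.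
  Hence the flows realising weak transitions from a given state form a polytope, so they are convex
  combinations of finitely many of them, and \<open>\<T>\<close> adds to each \<open>S\<^sub>i\<close> these finitely many
  weak transitions and the variables reachable by \<open>\<tau>\<close>-flows.  Transitions of \<open>\<T>\<close> are
  flows of \<open>\<S>\<close>, which makes \<open>\<T>\<close> guarded and saturated.

  The old solution still solves \<open>\<T>\<close>, since a weak transition of \<open>X\<^sub>i\<close> to \<open>\<mu>\<close> gives
  \<open>E\<^sub>i = E\<^sub>i + \<alpha>.\<mu>\<close>: the distributions \<open>\<mu>\<close> with this property are closed under convex combination, under
  composition with \<open>\<tau>\<close>-transitions (the \<open>\<tau>\<close>-laws) and under removal of loops (unique solutions and
  the first recursion law), and every flow is obtained from single transitions by these operations
  through Gaussian elimination of states.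
\<close>

section \<open>Finitely generated sets of solutions and flows\<close>

text \<open>A derivation is an infinite object that fixes an order of steps. A flow forgets this
  order, so weak transitions become the nonnegative solutions of finitely many linear equations.
  Flows are turned back into a derivation at one point only, where a circulation contradicts
  guardedness. Freedom from circulations is used in three ways. It bounds the flows from a given
  measure, so the counts of a derivation converge and no mass is lost by divergence. It makes the
  solution sets pointed. It makes every pivot \<open>1 - \<rho> Y Y\<close> of the elimination
  nonzero, and the eliminated system inherits it. The equational obstacle is that the recursion law
  removes only a loop from a state directly to itself, whereas the paths of a flow may return
  through other states. Eliminating a state turns such returns into direct loops. One round of
  additions suffices for saturation: each transition of \<open>T\<close> is a weak flow transition
  of \<open>S\<close>, so weak transitions of \<open>T\<close> expand into weak ones of
  \<open>S\<close>, for which the added summands were chosen.\<close>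

lemma dirac_simps [simp]: "dirac x x = 1" "x \<noteq> y \<Longrightarrow> dirac x y = 0" "0 \<le> dirac x y"
  by (auto simp: dirac_def)

text \<open>The ratio test of the simplex method: the step length is the least quotient
  \<open>f i / - d i\<close> over the decreasing coordinates, and a coordinate attaining it becomes
  zero.\<close>

lemma step_to_boundary:
  fixes f d :: "'i \<Rightarrow> real"
  assumes fin: "finite {i. f i \<noteq> 0}" and nonneg: "\<And>i. 0 \<le> f i"
    and supp: "\<And>i. f i = 0 \<Longrightarrow> d i = 0" and neg: "d j < 0"
  shows "\<exists>s>0. (\<forall>i. 0 \<le> f i + s * d i) \<and> (\<exists>i. f i \<noteq> 0 \<and> f i + s * d i = 0)"
proof -
  define N where "N = {i. d i < 0}"
  have "N \<subseteq> {i. f i \<noteq> 0}" using supp by (force simp: N_def)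
  then have N: "finite N" "N \<noteq> {}" using fin neg by (auto simp: N_def intro: finite_subset)
  have fpos: "0 < f i" if "i \<in> N" for i using that supp[of i] nonneg[of i] by (force simp: N_def)
  define s where "s = Min ((\<lambda>i. f i / - d i) ` N)"
  have "s \<in> (\<lambda>i. f i / - d i) ` N" unfolding s_def using N by (intro Min_in) auto
  then obtain k where k: "k \<in> N" "s = f k / - d k" by blast
  have "0 \<le> f i + s * d i" for i
  proof (cases "i \<in> N")
    case True
    then have "s \<le> f i / - d i" unfolding s_def using N by (intro Min_le) auto
    then have "s * - d i \<le> f i" using True by (subst (asm) pos_le_divide_eq) (auto simp: N_def)
    then show ?thesis by simp
  next
    case False
    have "0 < s" using k fpos by (auto simp: N_def divide_pos_neg)
    then show ?thesis using False nonneg[of i] by (simp add: N_def)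
  qed
  moreover have "f k + s * d k = 0" "f k \<noteq> 0" "0 < s"
    using k fpos[of k] by (auto simp: N_def divide_pos_neg)
  ultimately show ?thesis by blast
qed

text \<open>Points of \<open>Sol\<close> that are determined by their support play the role of vertices.\<close>
lemma finitely_generated:
  fixes Sol :: "('i \<Rightarrow> real) set"
  assumes fin: "finite I"
    and nonneg: "\<And>f i. f \<in> Sol \<Longrightarrow> 0 \<le> f i"
    and supp: "\<And>f i. f \<in> Sol \<Longrightarrow> i \<notin> I \<Longrightarrow> f i = 0"
    and aff: "\<And>f u s. f \<in> Sol \<Longrightarrow> u \<in> Sol \<Longrightarrow> (\<And>i. 0 \<le> f i + s * (f i - u i)) \<Longrightarrow>
      (\<lambda>i. f i + s * (f i - u i)) \<in> Sol"
    and pointed: "\<And>f u. f \<in> Sol \<Longrightarrow> u \<in> Sol \<Longrightarrow> (\<And>i. u i \<le> f i) \<Longrightarrow> u = f"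
  shows "\<exists>F. finite F \<and> F \<subseteq> Sol \<and> (\<forall>f\<in>Sol. \<exists>c. (\<forall>v\<in>F. 0 \<le> c v) \<and> sum c F = 1 \<and>
    f = (\<lambda>i. \<Sum>v\<in>F. c v * v i))"
proof -
  define sp where "sp f = {i. f i \<noteq> (0::real)}" for f :: "'i \<Rightarrow> real"
  have spI: "sp f \<subseteq> I" if "f \<in> Sol" for f using supp[OF that] by (auto simp: sp_def)
  define F where "F = {v \<in> Sol. \<forall>u\<in>Sol. sp u \<subseteq> sp v \<longrightarrow> u = v}"
  have "inj_on sp F" by (auto simp: inj_on_def F_def)
  moreover have "sp ` F \<subseteq> Pow I" using spI by (auto simp: F_def)
  ultimately have F: "finite F" using fin by (meson finite_Pow_iff inj_on_finite)
  have "\<exists>c. (\<forall>v\<in>F. 0 \<le> c v) \<and> sum c F = 1 \<and> f = (\<lambda>i. \<Sum>v\<in>F. c v * v i)" if "f \<in> Sol" for f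
    using that
  proof (induction "card (sp f)" arbitrary: f rule: less_induct)
    case less
    have fsp: "finite (sp f)" using spI less.prems fin finite_subset by blast
    show ?case
    proof (cases "f \<in> F")
      case True
      have "(\<Sum>v\<in>F. (if v = f then 1 else 0) * v i) = (\<Sum>v\<in>F. if v = f then f i else 0)" for i
        by (intro sum.cong) auto
      then show ?thesis using True F by (intro exI[of _ "\<lambda>v. if v = f then 1 else 0"]) auto
    next
      case False
      then obtain u where u: "u \<in> Sol" "sp u \<subseteq> sp f" "u \<noteq> f" using less.prems by (auto simp: F_def)
      define d where "d i = f i - u i" for i
      have d0: "d i = 0" if "f i = 0" for i using u that by (auto simp: sp_def d_def)
      \<comment> \<open>Pointedness makes \<open>f\<close> and \<open>u\<close> incomparable, so the
        line through them leaves the nonnegative orthant in both directions. At each of the two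
        exits a coordinate of the support of \<open>f\<close> is lost, and the induction hypothesis
        applies.\<close>
      have "\<not> (\<forall>i. 0 \<le> d i)" "\<not> (\<forall>i. d i \<le> 0)"
        using pointed[OF less.prems u(1)] pointed[OF u(1) less.prems] u(3) by (auto simp: d_def)
      then obtain j1 j2 where j1: "d j1 < 0" and j2: "0 < d j2" by (meson not_le)
      obtain s1 k1 where s1: "s1 > 0" "\<And>i. 0 \<le> f i + s1 * d i" "f k1 \<noteq> 0" "f k1 + s1 * d k1 = 0"
        using step_to_boundary[of f d j1] fsp nonneg[OF less.prems] d0 j1 by (auto simp: sp_def)
      obtain s2 k2 where s2: "s2 > 0" "\<And>i. 0 \<le> f i + s2 * - d i" "f k2 \<noteq> 0" "f k2 + s2 * - d k2 = 0"
        using step_to_boundary[of f "\<lambda>i. - d i" j2] fsp nonneg[OF less.prems] d0 j2 by (auto simp: sp_def)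
      define f1 where "f1 = (\<lambda>i. f i + s1 * (f i - u i))"
      define f2 where "f2 = (\<lambda>i. f i + - s2 * (f i - u i))"
      have f12: "f1 \<in> Sol" "f2 \<in> Sol"
        unfolding f1_def f2_def using s1(2) s2(2) by (intro aff less.prems u(1); simp add: d_def right_diff_distrib)+
      have fd: "f1 i = f i + s1 * d i" "f2 i = f i + s2 * - d i" for i
        unfolding f1_def f2_def d_def mult_minus_left mult_minus_right by (rule refl)+
      have "sp f1 \<subseteq> sp f" "sp f2 \<subseteq> sp f" using d0 by (auto simp: sp_def fd)
      moreover have "k1 \<in> sp f - sp f1" using s1(3,4) unfolding sp_def fd by blast
      moreover have "k2 \<in> sp f - sp f2" using s2(3,4) unfolding sp_def fd by blast
      ultimately have "sp f1 \<subset> sp f" "sp f2 \<subset> sp f" by blast+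
      then have "card (sp f1) < card (sp f)" "card (sp f2) < card (sp f)"
        using fsp by (auto intro: psubset_card_mono)
      note IH = this[THEN less.hyps]
      obtain c1 where c1: "\<forall>v\<in>F. 0 \<le> c1 v" "sum c1 F = 1" "f1 = (\<lambda>i. \<Sum>v\<in>F. c1 v * v i)"
        using IH(1)[OF f12(1)] by blast
      obtain c2 where c2: "\<forall>v\<in>F. 0 \<le> c2 v" "sum c2 F = 1" "f2 = (\<lambda>i. \<Sum>v\<in>F. c2 v * v i)"
        using IH(2)[OF f12(2)] by blast
      \<comment> \<open>The point \<open>f\<close> lies between \<open>f1\<close> and
        \<open>f2\<close> at distances proportional to \<open>s1\<close> and \<open>s2\<close>,
        which gives these barycentric weights.\<close>
      define c where "c v = s2 / (s1 + s2) * c1 v + s1 / (s1 + s2) * c2 v" for v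
      have c0: "\<forall>v\<in>F. 0 \<le> c v" using c1(1) c2(1) s1(1) s2(1) by (simp add: c_def)
      have "sum c F = s2 / (s1 + s2) * sum c1 F + s1 / (s1 + s2) * sum c2 F"
        by (simp add: c_def sum.distrib sum_distrib_left)
      moreover have "s2 / (s1 + s2) + s1 / (s1 + s2) = 1" using s1(1) s2(1) by (simp add: divide_simps)
      ultimately have "sum c F = 1" unfolding c1(2) c2(2) by simp
      moreover have "f i = (\<Sum>v\<in>F. c v * v i)" for i
      proof -
        have "(\<Sum>v\<in>F. c v * v i) = s2 / (s1 + s2) * f1 i + s1 / (s1 + s2) * f2 i"
          unfolding c1(3) c2(3) c_def by (simp add: distrib_right sum.distrib sum_distrib_left mult.assoc)
        also have "\<dots> = (s2 * f1 i + s1 * f2 i) / (s1 + s2)" by (simp add: add_divide_distrib)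
        also have "s2 * f1 i + s1 * f2 i = (s1 + s2) * f i" by (simp add: f1_def f2_def algebra_simps)
        finally show ?thesis using s1(1) s2(1) by simp
      qed
      ultimately show ?thesis using c0 by blast
    qed
  qed
  then show ?thesis using F by (intro exI[of _ F]) (auto simp: F_def)
qed

section \<open>Distributions and flows on a finite graph of transitions\<close>

definition pdist :: "'k set \<Rightarrow> ('k \<Rightarrow> real) \<Rightarrow> bool" where
  "pdist K m \<longleftrightarrow> (\<forall>x. 0 \<le> m x) \<and> (\<forall>x. x \<notin> K \<longrightarrow> m x = 0) \<and> sum m K = 1"

lemma pdistD: "pdist K m \<Longrightarrow> 0 \<le> m x" "pdist K m \<Longrightarrow> x \<notin> K \<Longrightarrow> m x = 0" "pdist K m \<Longrightarrow> sum m K = 1"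
  by (auto simp: pdist_def)

lemma pdist_dirac: "finite K \<Longrightarrow> k \<in> K \<Longrightarrow> pdist K (dirac k)"
  by (auto simp: pdist_def dirac_def)

lemma pdist_le_1: "finite K \<Longrightarrow> pdist K m \<Longrightarrow> m x \<le> 1"
  by (cases "x \<in> K") (metis pdistD(1,3) member_le_sum, simp add: pdistD(2))

lemma pdist_1_dirac:
  assumes "finite K" "pdist K m" "m k = 1"
  shows "m = dirac k"
proof
  fix x
  have k: "k \<in> K" using assms pdistD(2) by fastforce
  have "sum m K = m k + sum m (K - {k})" using k assms(1) by (simp add: sum.remove)
  then have "sum m (K - {k}) = 0" using assms pdistD(3) by fastforce
  then have "\<forall>x\<in>K - {k}. m x = 0"
    using assms by (subst (asm) sum_nonneg_eq_0_iff) (auto simp: pdistD)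
  then show "m x = dirac k x" using assms pdistD(2)[of K m x] by (cases "x = k") auto
qed

definition srcm :: "('k \<times> ('k \<Rightarrow> real)) set \<Rightarrow> ('k \<times> ('k \<Rightarrow> real) \<Rightarrow> real) \<Rightarrow> 'k \<Rightarrow> real" where
  "srcm G f x = (\<Sum>t\<in>G. f t * dirac (fst t) x)"

definition tgtm :: "('k \<times> ('k \<Rightarrow> real)) set \<Rightarrow> ('k \<times> ('k \<Rightarrow> real) \<Rightarrow> real) \<Rightarrow> 'k \<Rightarrow> real" where
  "tgtm G f x = (\<Sum>t\<in>G. f t * snd t x)"

text \<open>Departures minus arrivals, where \<open>f t\<close> counts the expected uses of
  \<open>t\<close>. With this sign a flow started in \<open>\<nu>\<close> ends in
  \<open>\<nu> - net G f\<close>.\<close>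

definition net :: "('k \<times> ('k \<Rightarrow> real)) set \<Rightarrow> ('k \<times> ('k \<Rightarrow> real) \<Rightarrow> real) \<Rightarrow> 'k \<Rightarrow> real" where
  "net G f x = srcm G f x - tgtm G f x"

definition circulation_free :: "('k \<times> ('k \<Rightarrow> real)) set \<Rightarrow> bool" where
  "circulation_free G \<longleftrightarrow>
     (\<forall>f. (\<forall>t\<in>G. 0 \<le> f t) \<and> (\<forall>x. net G f x = 0) \<longrightarrow> (\<forall>t\<in>G. f t = 0))"

text \<open>The end \<open>\<mu>\<close> may be negative here, which keeps composition and linear
  combination free of side conditions; nonnegativity is demanded separately wherever a flow stands
  for a weak transition.\<close>

definition flow :: "('k \<times> ('k \<Rightarrow> real)) set \<Rightarrow> ('k \<Rightarrow> real) \<Rightarrow> ('k \<Rightarrow> real) \<Rightarrow> bool" where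
  "flow G \<nu> \<mu> \<longleftrightarrow> (\<exists>f. (\<forall>t\<in>G. 0 \<le> f t) \<and> (\<forall>x. \<mu> x = \<nu> x - net G f x))"

text \<open>One combined step: in contrast to \<open>flow\<close>, the whole mass of
  \<open>\<nu>\<close> takes exactly one transition of \<open>H\<close>.\<close>

definition move :: "('k \<times> ('k \<Rightarrow> real)) set \<Rightarrow> ('k \<Rightarrow> real) \<Rightarrow> ('k \<Rightarrow> real) \<Rightarrow> bool" where
  "move H \<nu> \<mu> \<longleftrightarrow> (\<exists>f. (\<forall>t\<in>H. 0 \<le> f t) \<and> \<nu> = srcm H f \<and> \<mu> = tgtm H f)"

text \<open>Nonnegativity is imposed on the final measure only: the intermediate ones are a source
  and a target of a move, and these are nonnegative for systems of genuine distributions.\<close>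

definition weak :: "('k \<times> ('k \<Rightarrow> real)) set \<Rightarrow> ('k \<times> ('k \<Rightarrow> real)) set \<Rightarrow> ('k \<Rightarrow> real) \<Rightarrow> ('k \<Rightarrow> real) \<Rightarrow> bool" where
  "weak G H \<nu> \<mu> \<longleftrightarrow>
     (\<exists>\<nu>' \<mu>'. flow G \<nu> \<nu>' \<and> move H \<nu>' \<mu>' \<and> flow G \<mu>' \<mu>) \<and> (\<forall>x. 0 \<le> \<mu> x)"

lemma srcm_lin: "srcm G (\<lambda>t. a * f t + b * g t) x = a * srcm G f x + b * srcm G g x"
  by (simp add: srcm_def algebra_simps sum.distrib sum_distrib_left)

lemma tgtm_lin: "tgtm G (\<lambda>t. a * f t + b * g t) x = a * tgtm G f x + b * tgtm G g x"
  by (simp add: tgtm_def algebra_simps sum.distrib sum_distrib_left)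

lemma net_lin: "net G (\<lambda>t. a * f t + b * g t) x = a * net G f x + b * net G g x"
  by (simp add: net_def srcm_lin tgtm_lin algebra_simps)

lemma srcm_sum: "srcm G (\<lambda>s. \<Sum>t\<in>A. c t * h t s) x = (\<Sum>t\<in>A. c t * srcm G (h t) x)"
  unfolding srcm_def sum_distrib_left sum_distrib_right mult.assoc by (rule sum.swap)

lemma tgtm_sum: "tgtm G (\<lambda>s. \<Sum>t\<in>A. c t * h t s) x = (\<Sum>t\<in>A. c t * tgtm G (h t) x)"
  unfolding tgtm_def sum_distrib_left sum_distrib_right mult.assoc by (rule sum.swap)

lemma net_sum: "net G (\<lambda>s. \<Sum>t\<in>A. c t * h t s) x = (\<Sum>t\<in>A. c t * net G (h t) x)"
  by (simp add: net_def srcm_sum tgtm_sum right_diff_distrib sum_subtractf)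

lemma net_cong: "(\<And>t. t \<in> G \<Longrightarrow> f t = g t) \<Longrightarrow> net G f x = net G g x"
  by (simp add: net_def srcm_def tgtm_def cong: sum.cong)

lemma srcm_cong: "(\<And>t. t \<in> G \<Longrightarrow> f t = g t) \<Longrightarrow> srcm G f x = srcm G g x"
  by (simp add: srcm_def cong: sum.cong)

lemma tgtm_cong: "(\<And>t. t \<in> G \<Longrightarrow> f t = g t) \<Longrightarrow> tgtm G f x = tgtm G g x"
  by (simp add: tgtm_def cong: sum.cong)

lemma flow_refl: "flow G \<nu> \<nu>"
  unfolding flow_def by (intro exI[of _ "\<lambda>_. 0"]) (simp add: net_def srcm_def tgtm_def)

lemma flow_trans:
  assumes "flow G \<nu> \<mu>" "flow G \<mu> \<kappa>"
  shows "flow G \<nu> \<kappa>"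
proof -
  obtain f g where "\<forall>t\<in>G. 0 \<le> f t" "\<And>x. \<mu> x = \<nu> x - net G f x" "\<forall>t\<in>G. 0 \<le> g t" "\<And>x. \<kappa> x = \<mu> x - net G g x"
    using assms by (auto simp: flow_def)
  then show ?thesis unfolding flow_def
    by (intro exI[of _ "\<lambda>t. 1 * f t + 1 * g t"]) (simp add: net_lin[where a = 1 and b = 1, simplified])
qed

lemma flow_weak_flow: "flow G \<nu> \<nu>' \<Longrightarrow> weak G H \<nu>' \<mu>' \<Longrightarrow> flow G \<mu>' \<mu> \<Longrightarrow> (\<And>x. 0 \<le> \<mu> x) \<Longrightarrow> weak G H \<nu> \<mu>"
  unfolding weak_def using flow_trans by blast

lemma move_weak: "move H \<nu> \<mu> \<Longrightarrow> (\<And>x. 0 \<le> \<mu> x) \<Longrightarrow> weak G H \<nu> \<mu>"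
  unfolding weak_def using flow_refl by blast

lemma flow_sum:
  assumes "\<And>t. t \<in> A \<Longrightarrow> 0 \<le> c t" "\<And>t. t \<in> A \<Longrightarrow> flow G (\<nu> t) (\<mu> t)"
  shows "flow G (\<lambda>x. \<Sum>t\<in>A. c t * \<nu> t x) (\<lambda>x. \<Sum>t\<in>A. c t * \<mu> t x)"
proof -
  have "\<forall>t\<in>A. \<exists>f. (\<forall>s\<in>G. 0 \<le> f s) \<and> (\<forall>x. \<mu> t x = \<nu> t x - net G f x)"
    using assms(2) by (simp add: flow_def)
  then obtain h where h: "\<And>t s. t \<in> A \<Longrightarrow> s \<in> G \<Longrightarrow> 0 \<le> h t s" "\<And>t x. t \<in> A \<Longrightarrow> \<mu> t x = \<nu> t x - net G (h t) x"
    by (metis (no_types))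
  show ?thesis unfolding flow_def
    by (intro exI[of _ "\<lambda>s. \<Sum>t\<in>A. c t * h t s"])
      (auto simp: net_sum h assms(1) sum_nonneg right_diff_distrib sum_subtractf)
qed

lemma move_sum:
  assumes "\<And>t. t \<in> A \<Longrightarrow> 0 \<le> c t" "\<And>t. t \<in> A \<Longrightarrow> move H (\<nu> t) (\<mu> t)"
  shows "move H (\<lambda>x. \<Sum>t\<in>A. c t * \<nu> t x) (\<lambda>x. \<Sum>t\<in>A. c t * \<mu> t x)"
proof -
  have "\<forall>t\<in>A. \<exists>f. (\<forall>s\<in>H. 0 \<le> f s) \<and> \<nu> t = srcm H f \<and> \<mu> t = tgtm H f"
    using assms(2) by (simp add: move_def)
  then obtain h where h: "\<And>t s. t \<in> A \<Longrightarrow> s \<in> H \<Longrightarrow> 0 \<le> h t s" "\<And>t. t \<in> A \<Longrightarrow> \<nu> t = srcm H (h t)"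
      "\<And>t. t \<in> A \<Longrightarrow> \<mu> t = tgtm H (h t)"
    by (metis (no_types))
  show ?thesis unfolding move_def
    by (intro exI[of _ "\<lambda>s. \<Sum>t\<in>A. c t * h t s"])
      (auto simp: srcm_sum tgtm_sum h assms(1) sum_nonneg fun_eq_iff)
qed

lemma weak_sum:
  assumes "\<And>t. t \<in> A \<Longrightarrow> 0 \<le> c t" "\<And>t. t \<in> A \<Longrightarrow> weak G H (\<nu> t) (\<mu> t)"
  shows "weak G H (\<lambda>x. \<Sum>t\<in>A. c t * \<nu> t x) (\<lambda>x. \<Sum>t\<in>A. c t * \<mu> t x)"
proof -
  have "\<forall>t\<in>A. \<exists>\<nu>' \<mu>'. flow G (\<nu> t) \<nu>' \<and> move H \<nu>' \<mu>' \<and> flow G \<mu>' (\<mu> t)" "\<forall>t\<in>A. \<forall>x. 0 \<le> \<mu> t x"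
    using assms(2) by (auto simp: weak_def)
  then obtain \<nu>' \<mu>' where h: "\<And>t. t \<in> A \<Longrightarrow> flow G (\<nu> t) (\<nu>' t)" "\<And>t. t \<in> A \<Longrightarrow> move H (\<nu>' t) (\<mu>' t)"
      "\<And>t. t \<in> A \<Longrightarrow> flow G (\<mu>' t) (\<mu> t)"
    by metis
  have "flow G (\<lambda>x. \<Sum>t\<in>A. c t * \<nu> t x) (\<lambda>x. \<Sum>t\<in>A. c t * \<nu>' t x)"
    by (intro flow_sum assms(1) h)
  moreover have "move H (\<lambda>x. \<Sum>t\<in>A. c t * \<nu>' t x) (\<lambda>x. \<Sum>t\<in>A. c t * \<mu>' t x)"
    by (intro move_sum assms(1) h)
  moreover have "flow G (\<lambda>x. \<Sum>t\<in>A. c t * \<mu>' t x) (\<lambda>x. \<Sum>t\<in>A. c t * \<mu> t x)"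
    by (intro flow_sum assms(1) h)
  moreover have "\<forall>x. 0 \<le> (\<Sum>t\<in>A. c t * \<mu> t x)"
    using \<open>\<forall>t\<in>A. \<forall>x. 0 \<le> \<mu> t x\<close> assms(1) by (auto intro!: sum_nonneg)
  ultimately show ?thesis unfolding weak_def by blast
qed

locale transitions =
  fixes K :: "'k set" and G :: "('k \<times> ('k \<Rightarrow> real)) set"
  assumes finK: "finite K" and finG: "finite G"
    and src: "\<And>t. t \<in> G \<Longrightarrow> fst t \<in> K" and tgt: "\<And>t. t \<in> G \<Longrightarrow> pdist K (snd t)"
begin

lemma srcm_total: "sum (srcm G f) K = sum f G"
proof -
  have "sum (srcm G f) K = (\<Sum>t\<in>G. f t * sum (dirac (fst t)) K)"
    unfolding srcm_def sum_distrib_left by (rule sum.swap)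
  also have "\<dots> = sum f G" using src pdist_dirac[OF finK] by (intro sum.cong) (auto simp: pdistD)
  finally show ?thesis .
qed

lemma tgtm_total: "sum (tgtm G f) K = sum f G"
proof -
  have "sum (tgtm G f) K = (\<Sum>t\<in>G. f t * sum (snd t) K)"
    unfolding tgtm_def sum_distrib_left by (rule sum.swap)
  also have "\<dots> = sum f G" using tgt by (intro sum.cong) (auto simp: pdistD)
  finally show ?thesis .
qed

lemma net_total: "sum (net G f) K = 0"
  by (simp add: net_def sum_subtractf srcm_total tgtm_total)

lemma srcm_outside: "x \<notin> K \<Longrightarrow> srcm G f x = 0"
  unfolding srcm_def by (intro sum.neutral) (metis dirac_simps(2) mult_zero_right src)

lemma tgtm_outside: "x \<notin> K \<Longrightarrow> tgtm G f x = 0"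
  unfolding tgtm_def by (intro sum.neutral) (metis pdistD(2) mult_zero_right tgt)

lemma net_outside: "x \<notin> K \<Longrightarrow> net G f x = 0"
  by (simp add: net_def srcm_outside tgtm_outside)

lemma srcm_nonneg: "(\<And>t. t \<in> G \<Longrightarrow> 0 \<le> f t) \<Longrightarrow> 0 \<le> srcm G f x"
  by (simp add: srcm_def sum_nonneg)

lemma tgtm_nonneg: "(\<And>t. t \<in> G \<Longrightarrow> 0 \<le> f t) \<Longrightarrow> 0 \<le> tgtm G f x"
  unfolding tgtm_def by (intro sum_nonneg mult_nonneg_nonneg pdistD(1)[OF tgt])

lemma flow_total:
  assumes "flow G \<nu> \<mu>"
  shows "sum \<mu> K = sum \<nu> K"
proof -
  obtain f where "\<And>x. \<mu> x = \<nu> x - net G f x" using assms by (auto simp: flow_def)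
  then have "sum \<mu> K = sum \<nu> K - sum (net G f) K" by (simp add: sum_subtractf)
  then show ?thesis by (simp add: net_total)
qed

lemma flow_outside: "flow G \<nu> \<mu> \<Longrightarrow> x \<notin> K \<Longrightarrow> \<mu> x = \<nu> x"
  by (auto simp: flow_def net_outside)

text \<open>The net departures sum to zero over \<open>K\<close>, so a flow that takes mass from no
  state delivers mass to none. It is then a circulation and vanishes.\<close>

lemma net_zeroI:
  assumes "circulation_free G" "\<And>t. t \<in> G \<Longrightarrow> 0 \<le> f t" "\<And>x. x \<in> K \<Longrightarrow> 0 \<le> - net G f x"
  shows "net G f x = 0" "t \<in> G \<Longrightarrow> f t = 0"
proof -
  have "(\<Sum>x\<in>K. - net G f x) = 0" by (simp add: sum_negf net_total)
  then have "\<forall>x\<in>K. - net G f x = 0" using finK assms(3) by (subst (asm) sum_nonneg_eq_0_iff) auto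
  then have *: "net G f x = 0" for x using net_outside by (cases "x \<in> K") auto
  then show "net G f x = 0" .
  show "t \<in> G \<Longrightarrow> f t = 0" using assms(1,2) * by (auto simp: circulation_free_def)
qed

text \<open>With the remaining mass at each state as a slack variable the flows out of
  \<open>\<nu>\<close> form a set to which \<open>finitely_generated\<close> applies, and a convex
  combination is bounded by the sum of the generators. The bound makes the step counts of infinite
  derivations summable.\<close>

lemma flow_bounded:
  assumes cf: "circulation_free G"
  shows "\<exists>B. \<forall>f. (\<forall>t\<in>G. 0 \<le> f t) \<and> (\<forall>x. 0 \<le> \<nu> x - net G f x) \<longrightarrow> (\<forall>t\<in>G. f t \<le> B)"
proof -
  \<comment> \<open>\<open>Inl\<close> coordinates are the flow, \<open>Inr\<close> coordinates the
    slack.\<close>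
  define I where "I = Inl ` G \<union> Inr ` K"
  define Sol where "Sol = {z. (\<forall>i. 0 \<le> z i) \<and> (\<forall>i. i \<notin> I \<longrightarrow> z i = 0) \<and>
    (\<forall>x\<in>K. z (Inr x) = \<nu> x - net G (\<lambda>t. z (Inl t)) x)}"
  have "\<exists>F. finite F \<and> F \<subseteq> Sol \<and> (\<forall>f\<in>Sol. \<exists>c. (\<forall>v\<in>F. 0 \<le> c v) \<and> sum c F = 1 \<and>
      f = (\<lambda>i. \<Sum>v\<in>F. c v * v i))"
  proof (rule finitely_generated[where I = I])
    show "finite I" using finK finG by (simp add: I_def)
    fix z u :: "('k \<times> ('k \<Rightarrow> real)) + 'k \<Rightarrow> real" and i
    show "z \<in> Sol \<Longrightarrow> 0 \<le> z i" "z \<in> Sol \<Longrightarrow> i \<notin> I \<Longrightarrow> z i = 0" by (auto simp: Sol_def)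
    assume zu: "z \<in> Sol" "u \<in> Sol"
    {
      fix s assume nn: "\<And>i. 0 \<le> z i + s * (z i - u i)"
      define y where "y i = (1 + s) * z i + (- s) * u i" for i
      have y: "(\<lambda>i. z i + s * (z i - u i)) = y" by (auto simp: y_def algebra_simps)
      have eq: "z (Inr x) = \<nu> x - net G (\<lambda>t. z (Inl t)) x" "u (Inr x) = \<nu> x - net G (\<lambda>t. u (Inl t)) x" if "x \<in> K" for x
        using zu that by (auto simp: Sol_def)
      have "y (Inr x) = \<nu> x - net G (\<lambda>t. y (Inl t)) x" if "x \<in> K" for x
        unfolding y_def net_lin eq[OF that] by (simp add: algebra_simps)
      then show "(\<lambda>i. z i + s * (z i - u i)) \<in> Sol"
        using zu nn fun_cong[OF y] unfolding y by (auto simp: Sol_def y_def)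
    next
      \<comment> \<open>The difference of two comparable solutions is a nonnegative flow that starts
        from no mass at all, so \<open>net_zeroI\<close> annihilates it.\<close>
      assume le: "\<And>i. u i \<le> z i"
      have n: "net G (\<lambda>t. 1 * z (Inl t) + (-1) * u (Inl t)) x = net G (\<lambda>t. z (Inl t)) x - net G (\<lambda>t. u (Inl t)) x" for x
        unfolding net_lin by simp
      have "0 \<le> - net G (\<lambda>t. 1 * z (Inl t) + (-1) * u (Inl t)) x" if "x \<in> K" for x
        unfolding n using zu le[of "Inr x"] that by (auto simp: Sol_def)
      note * = net_zeroI[OF cf _ this]
      have "z (Inl t) = u (Inl t)" if "t \<in> G" for t using *(2)[of t] that le by simp
      moreover have "z (Inr x) = u (Inr x)" if "x \<in> K" for x
        using *(1)[of x] le that zu unfolding n by (simp add: Sol_def)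
      ultimately have "z i = u i" for i
        using zu by (cases "i \<in> I") (auto simp: I_def Sol_def)
      then show "u = z" by auto
    }
  qed
  then obtain F where F: "finite F" "F \<subseteq> Sol" and
    gen: "\<And>z. z \<in> Sol \<Longrightarrow> \<exists>c. (\<forall>v\<in>F. 0 \<le> c v) \<and> sum c F = 1 \<and> z = (\<lambda>i. \<Sum>v\<in>F. c v * v i)" by blast
  have "f t \<le> (\<Sum>s\<in>G. \<Sum>v\<in>F. v (Inl s))"
    if f: "\<forall>t\<in>G. 0 \<le> f t" "\<forall>x. 0 \<le> \<nu> x - net G f x" and t: "t \<in> G" for f t
  proof -
    define z where "z i = (case i of Inl s \<Rightarrow> if s \<in> G then f s else 0
      | Inr x \<Rightarrow> if x \<in> K then \<nu> x - net G f x else 0)" for i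
    have "net G (\<lambda>s. z (Inl s)) x = net G f x" for x by (intro net_cong) (simp add: z_def)
    then have "z \<in> Sol" using f by (auto simp: Sol_def z_def I_def split: sum.splits)
    then obtain c where c: "\<And>v. v \<in> F \<Longrightarrow> 0 \<le> c v" "sum c F = 1" "z = (\<lambda>i. \<Sum>v\<in>F. c v * v i)"
      using gen by blast
    have "c v \<le> 1" if "v \<in> F" for v using member_le_sum[of v F c] c(1,2) that F(1) by auto
    then have "c v * v (Inl t) \<le> v (Inl t)" if "v \<in> F" for v
      using that F(2) c(1) by (auto simp: Sol_def intro!: mult_left_le_one_le)
    then have "z (Inl t) \<le> (\<Sum>v\<in>F. v (Inl t))" unfolding c(3) by (intro sum_mono)
    also have "\<dots> \<le> (\<Sum>s\<in>G. \<Sum>v\<in>F. v (Inl s))"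
    proof (rule member_le_sum[OF t _ finG])
      show "0 \<le> (\<Sum>v\<in>F. v (Inl s))" for s using F(2) by (intro sum_nonneg) (auto simp: Sol_def)
    qed
    finally show ?thesis using t by (simp add: z_def)
  qed
  then show ?thesis by blast
qed

text \<open>The unknowns are the flow before the step (tag \<open>None\<close>), the step itself
  (\<open>Some True\<close>), the flow after it (\<open>Some False\<close>), and, as slack, the
  final measure. The generators of this set are projected to their final measures.\<close>

lemma weak_finitely_generated:
  assumes cf: "circulation_free G" and H: "transitions K H" and \<nu>: "\<And>x. x \<notin> K \<Longrightarrow> \<nu> x = 0"
  shows "\<exists>F. finite F \<and> (\<forall>v\<in>F. weak G H \<nu> v) \<and>
    (\<forall>\<mu>. weak G H \<nu> \<mu> \<longrightarrow> (\<exists>c. (\<forall>v\<in>F. 0 \<le> c v) \<and> sum c F = 1 \<and> \<mu> = (\<lambda>x. \<Sum>v\<in>F. c v * v x)))"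
proof -
  interpret H: transitions K H by (rule H)
  define I where "I = Inl ` ({None} \<times> G \<union> {Some True} \<times> H \<union> {Some False} \<times> G) \<union> Inr ` K"
  define Sol where "Sol = {z. (\<forall>i. 0 \<le> z i) \<and> (\<forall>i. i \<notin> I \<longrightarrow> z i = 0) \<and>
    (\<forall>x\<in>K. srcm H (\<lambda>t. z (Inl (Some True, t))) x = \<nu> x - net G (\<lambda>t. z (Inl (None, t))) x) \<and>
    (\<forall>x\<in>K. z (Inr x) = tgtm H (\<lambda>t. z (Inl (Some True, t))) x - net G (\<lambda>t. z (Inl (Some False, t))) x)}"
  have "\<exists>F. finite F \<and> F \<subseteq> Sol \<and> (\<forall>f\<in>Sol. \<exists>c. (\<forall>v\<in>F. 0 \<le> c v) \<and> sum c F = 1 \<and>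
      f = (\<lambda>i. \<Sum>v\<in>F. c v * v i))"
  proof (rule finitely_generated[where I = I])
    show "finite I" using finK finG H.finG by (simp add: I_def)
    fix z u :: "(bool option \<times> ('k \<times> ('k \<Rightarrow> real))) + 'k \<Rightarrow> real" and i
    show "z \<in> Sol \<Longrightarrow> 0 \<le> z i" "z \<in> Sol \<Longrightarrow> i \<notin> I \<Longrightarrow> z i = 0" by (auto simp: Sol_def)
    assume zu: "z \<in> Sol" "u \<in> Sol"
    {
      fix s assume nn: "\<And>i. 0 \<le> z i + s * (z i - u i)"
      define y where "y i = (1 + s) * z i + (- s) * u i" for i
      have y: "(\<lambda>i. z i + s * (z i - u i)) = y" by (auto simp: y_def algebra_simps)
      have eq: "srcm H (\<lambda>t. z (Inl (Some True, t))) x = \<nu> x - net G (\<lambda>t. z (Inl (None, t))) x"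
        "srcm H (\<lambda>t. u (Inl (Some True, t))) x = \<nu> x - net G (\<lambda>t. u (Inl (None, t))) x"
        "z (Inr x) = tgtm H (\<lambda>t. z (Inl (Some True, t))) x - net G (\<lambda>t. z (Inl (Some False, t))) x"
        "u (Inr x) = tgtm H (\<lambda>t. u (Inl (Some True, t))) x - net G (\<lambda>t. u (Inl (Some False, t))) x"
        if "x \<in> K" for x using zu that by (auto simp: Sol_def)
      have "srcm H (\<lambda>t. y (Inl (Some True, t))) x = \<nu> x - net G (\<lambda>t. y (Inl (None, t))) x"
        "y (Inr x) = tgtm H (\<lambda>t. y (Inl (Some True, t))) x - net G (\<lambda>t. y (Inl (Some False, t))) x" if "x \<in> K" for x
        unfolding y_def net_lin srcm_lin tgtm_lin eq[OF that] by (simp_all add: algebra_simps)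
      then show "(\<lambda>i. z i + s * (z i - u i)) \<in> Sol"
        using zu nn fun_cong[OF y] unfolding y by (auto simp: Sol_def y_def)
    next
      \<comment> \<open>The difference \<open>d\<close> vanishes stage by stage: the first flow
        starts from nothing and delivers nothing, hence no mass takes the step, hence the second
        flow also starts from nothing.\<close>
      assume le: "\<And>i. u i \<le> z i"
      define d where "d i = 1 * z i + (-1) * u i" for i
      have d0: "0 \<le> d i" for i using le by (simp add: d_def)
      have d1: "srcm H (\<lambda>t. d (Inl (Some True, t))) x = - net G (\<lambda>t. d (Inl (None, t))) x" if "x \<in> K" for x
        unfolding d_def net_lin srcm_lin using zu that by (auto simp: Sol_def)
      have d2: "d (Inr x) = tgtm H (\<lambda>t. d (Inl (Some True, t))) x - net G (\<lambda>t. d (Inl (Some False, t))) x" if "x \<in> K" for x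
        unfolding d_def net_lin tgtm_lin using zu that by (auto simp: Sol_def)
      have "0 \<le> - net G (\<lambda>t. d (Inl (None, t))) x" if "x \<in> K" for x
        using d1[OF that] H.srcm_nonneg d0 by metis
      note z0 = net_zeroI[OF cf _ this]
      have "(\<Sum>t\<in>H. d (Inl (Some True, t))) = sum (srcm H (\<lambda>t. d (Inl (Some True, t)))) K" by (simp add: H.srcm_total)
      also have "\<dots> = 0" using d1 z0(1) d0 by (intro sum.neutral) auto
      finally have dH: "\<And>t. t \<in> H \<Longrightarrow> d (Inl (Some True, t)) = 0"
        using d0 H.finG by (simp add: sum_nonneg_eq_0_iff)
      have t0: "tgtm H (\<lambda>t. d (Inl (Some True, t))) x = 0" for x using dH by (auto intro!: sum.neutral simp: tgtm_def)
      have "0 \<le> - net G (\<lambda>t. d (Inl (Some False, t))) x" if "x \<in> K" for x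
        using d2[OF that] d0[of "Inr x"] t0[of x] by simp
      note z2 = net_zeroI[OF cf _ this]
      have "d i = 0" for i
      proof (cases "i \<in> I")
        case True
        then show ?thesis using z0(2) z2(2) dH d2 z2(1) t0 d0 by (auto simp: I_def)
      next
        case False
        then show ?thesis using zu by (auto simp: d_def Sol_def)
      qed
      then show "u = z" by (auto simp: d_def)
    }
  qed
  then obtain F where F: "finite F" "F \<subseteq> Sol" and
    gen: "\<And>z. z \<in> Sol \<Longrightarrow> \<exists>c. (\<forall>v\<in>F. 0 \<le> c v) \<and> sum c F = 1 \<and> z = (\<lambda>i. \<Sum>v\<in>F. c v * v i)" by blast
  define pr :: "((bool option \<times> ('k \<times> ('k \<Rightarrow> real))) + 'k \<Rightarrow> real) \<Rightarrow> 'k \<Rightarrow> real" where "pr z = (\<lambda>x. z (Inr x))" for z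
  have "weak G H \<nu> (pr z)" if z: "z \<in> Sol" for z
  proof -
    let ?g = "\<lambda>t. z (Inl (Some True, t))"
    have "srcm H ?g x = \<nu> x - net G (\<lambda>t. z (Inl (None, t))) x" for x
      using z \<nu> by (cases "x \<in> K") (auto simp: Sol_def H.srcm_outside net_outside)
    then have "flow G \<nu> (srcm H ?g)" unfolding flow_def using z by (intro exI[of _ "\<lambda>t. z (Inl (None, t))"]) (auto simp: Sol_def)
    moreover have "pr z x = tgtm H ?g x - net G (\<lambda>t. z (Inl (Some False, t))) x" for x
      using z by (cases "x \<in> K") (auto simp: pr_def Sol_def I_def H.tgtm_outside net_outside)
    then have "flow G (tgtm H ?g) (pr z)" unfolding flow_def using z by (intro exI[of _ "\<lambda>t. z (Inl (Some False, t))"]) (auto simp: Sol_def)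
    moreover have "move H (srcm H ?g) (tgtm H ?g)" using z by (auto simp: move_def Sol_def)
    ultimately show ?thesis using z by (auto simp: weak_def pr_def Sol_def)
  qed
  moreover have "\<exists>c. (\<forall>v\<in>pr ` F. 0 \<le> c v) \<and> sum c (pr ` F) = 1 \<and> \<mu> = (\<lambda>x. \<Sum>v\<in>pr ` F. c v * v x)"
    if w: "weak G H \<nu> \<mu>" for \<mu>
  proof -
    obtain f1 g f2 where f: "\<forall>t\<in>G. 0 \<le> f1 t" "\<forall>t\<in>H. 0 \<le> g t" "\<forall>t\<in>G. 0 \<le> f2 t"
        "\<And>x. srcm H g x = \<nu> x - net G f1 x" "\<And>x. \<mu> x = tgtm H g x - net G f2 x" "\<And>x. 0 \<le> \<mu> x"
      using w unfolding weak_def flow_def move_def by blast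
    have \<mu>K: "\<mu> x = 0" if "x \<notin> K" for x using f(5) that by (simp add: net_outside H.tgtm_outside)
    define z where "z i = (case i of Inl (n, t) \<Rightarrow> if n = None \<and> t \<in> G then f1 t else if n = Some True \<and> t \<in> H then g t
      else if n = Some False \<and> t \<in> G then f2 t else 0 | Inr x \<Rightarrow> \<mu> x)" for i
    have "net G (\<lambda>t. z (Inl (None, t))) x = net G f1 x" "net G (\<lambda>t. z (Inl (Some False, t))) x = net G f2 x"
      "srcm H (\<lambda>t. z (Inl (Some True, t))) x = srcm H g x" "tgtm H (\<lambda>t. z (Inl (Some True, t))) x = tgtm H g x" for x
      by (auto simp: z_def intro!: net_cong srcm_cong tgtm_cong)
    moreover have "0 \<le> z i" for i using f(1-3,6) by (auto simp: z_def split: sum.splits)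
    moreover have "z i = 0" if "i \<notin> I" for i using that \<mu>K by (cases i) (auto simp: z_def I_def)
    moreover have "z (Inr x) = \<mu> x" for x by (simp add: z_def)
    ultimately have "z \<in> Sol" using f(4,5) by (simp add: Sol_def)
    then obtain c where c: "\<And>v. v \<in> F \<Longrightarrow> 0 \<le> c v" "sum c F = 1" "z = (\<lambda>i. \<Sum>v\<in>F. c v * v i)"
      using gen by blast
    \<comment> \<open>Several generators may share a final measure; their coefficients are
      added.\<close>
    define c' where "c' v = (\<Sum>u\<in>{u\<in>F. pr u = v}. c u)" for v
    have "0 \<le> c' v" for v using c by (auto simp: c'_def intro: sum_nonneg)
    moreover have "sum c' (pr ` F) = 1" unfolding c'_def using F(1) c(2) by (simp flip: sum.image_gen)
    moreover have "\<mu> x = (\<Sum>v\<in>pr ` F. c' v * v x)" for x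
    proof -
      have "\<mu> x = (\<Sum>u\<in>F. c u * pr u x)" using fun_cong[OF c(3), of "Inr x"] by (simp add: z_def pr_def)
      also have "\<dots> = (\<Sum>v\<in>pr ` F. \<Sum>u\<in>{u\<in>F. pr u = v}. c u * pr u x)" using F(1) by (rule sum.image_gen)
      also have "\<dots> = (\<Sum>v\<in>pr ` F. c' v * v x)" 
      proof (rule sum.cong[OF refl])
        fix v
        show "(\<Sum>u\<in>{u\<in>F. pr u = v}. c u * pr u x) = c' v * v x"
          unfolding c'_def sum_distrib_right by (rule sum.cong[OF refl]) simp
      qed
      finally show ?thesis .
    qed
    ultimately show ?thesis by blast
  qed
  ultimately show ?thesis using F by (intro exI[of _ "pr ` F"]) auto
qed

text \<open>\<open>h t\<close> is the flow over \<open>G\<close> of a weak transition that replaces \<open>t\<close>; the lower bound on its sum says that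
  it contains at least one step.\<close>
lemma net_refine:
  assumes "\<And>t. t \<in> G' \<Longrightarrow> fst t \<in> K" "\<And>t. t \<in> G' \<Longrightarrow> weak G G (dirac (fst t)) (snd t)"
  obtains h where "\<And>t s. t \<in> G' \<Longrightarrow> s \<in> G \<Longrightarrow> 0 \<le> h t s" "\<And>t. t \<in> G' \<Longrightarrow> 1 \<le> sum (h t) G"
    "\<And>f x. net G' f x = net G (\<lambda>s. \<Sum>t\<in>G'. f t * h t s) x"
proof -
  have "\<exists>h. (\<forall>s\<in>G. 0 \<le> h s) \<and> 1 \<le> sum h G \<and> (\<forall>x. net G h x = dirac (fst t) x - snd t x)"
    if t: "t \<in> G'" for t
  proof -
    obtain f1 g f2 where f: "\<forall>s\<in>G. 0 \<le> f1 s" "\<forall>s\<in>G. 0 \<le> g s" "\<forall>s\<in>G. 0 \<le> f2 s"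
        "\<And>x. srcm G g x = dirac (fst t) x - net G f1 x" "\<And>x. snd t x = tgtm G g x - net G f2 x"
      using assms(2)[OF t] unfolding weak_def flow_def move_def by blast
    define h where "h s = 1 * (1 * f1 s + 1 * g s) + 1 * f2 s" for s
    have "net G h x = dirac (fst t) x - snd t x" for x
      unfolding h_def net_lin using f(4,5)[of x] net_def[of G g x] by simp
    \<comment> \<open>A flow preserves total mass, so the whole unit of mass makes the middle step.
      This is what excludes an empty expansion.\<close>
    moreover have "sum g G = 1"
      using srcm_total[of g] net_total[of f1] pdist_dirac[OF finK assms(1)[OF t]]
      by (simp add: f(4) sum_subtractf pdistD)
    then have "1 \<le> sum h G" using f by (simp add: h_def sum.distrib sum_nonneg)
    ultimately show ?thesis using f by (intro exI[of _ h]) (auto simp: h_def)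
  qed
  then obtain h where h: "\<And>t s. t \<in> G' \<Longrightarrow> s \<in> G \<Longrightarrow> 0 \<le> h t s" "\<And>t. t \<in> G' \<Longrightarrow> 1 \<le> sum (h t) G"
    "\<And>t x. t \<in> G' \<Longrightarrow> net G (h t) x = dirac (fst t) x - snd t x" by metis
  have "net G' f x = net G (\<lambda>s. \<Sum>t\<in>G'. f t * h t s) x" for f x
    by (simp add: net_sum h(3) net_def[of G'] srcm_def tgtm_def right_diff_distrib sum_subtractf cong: sum.cong)
  then show ?thesis using that h by blast
qed

context
  fixes G'
  assumes finG': "finite G'" and srcG': "\<And>t. t \<in> G' \<Longrightarrow> fst t \<in> K"
    and weakG': "\<And>t. t \<in> G' \<Longrightarrow> weak G G (dirac (fst t)) (snd t)"
begin

text \<open>Expanding every \<open>t\<close> into \<open>h t\<close> turns a circulation of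
  \<open>G'\<close> into one of \<open>G\<close>, which vanishes. As each expansion has total count
  at least 1, the original counts vanish too.\<close>

lemma circulation_free_refine:
  assumes cf: "circulation_free G"
  shows "circulation_free G'"
proof -
  obtain h where h: "\<And>t s. t \<in> G' \<Longrightarrow> s \<in> G \<Longrightarrow> 0 \<le> h t s" "\<And>t. t \<in> G' \<Longrightarrow> 1 \<le> sum (h t) G"
    "\<And>f x. net G' f x = net G (\<lambda>s. \<Sum>t\<in>G'. f t * h t s) x"
    using net_refine[OF srcG' weakG'] by blast
  have "f t = 0" if f: "\<And>t. t \<in> G' \<Longrightarrow> 0 \<le> f t" "\<And>x. net G' f x = 0" and t: "t \<in> G'" for f t
  proof -
    have "(\<Sum>t\<in>G'. f t * h t s) = 0" if "s \<in> G" for s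
    proof -
      have "\<forall>s\<in>G. 0 \<le> (\<Sum>t\<in>G'. f t * h t s)"
        by (intro ballI sum_nonneg mult_nonneg_nonneg f(1) h(1))
      moreover have "\<forall>x. net G (\<lambda>s. \<Sum>t\<in>G'. f t * h t s) x = 0" using f(2) by (simp add: h(3))
      ultimately show ?thesis
        using cf[unfolded circulation_free_def, THEN spec, of "\<lambda>s. \<Sum>t\<in>G'. f t * h t s"] that by blast
    qed
    then have "(\<Sum>s\<in>G. \<Sum>t\<in>G'. f t * h t s) = 0" by simp
    then have "(\<Sum>t\<in>G'. f t * sum (h t) G) = 0" by (subst (asm) sum.swap) (simp add: sum_distrib_left)
    moreover have "0 \<le> f t * sum (h t) G" if "t \<in> G'" for t using f(1) h(2) that by fastforce
    ultimately have "f t * sum (h t) G = 0" using t finG' by (simp add: sum_nonneg_eq_0_iff)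
    then show ?thesis using h(2)[OF t] by auto
  qed
  then show ?thesis unfolding circulation_free_def by blast
qed

lemma flow_refine:
  assumes "flow G' \<nu> \<mu>"
  shows "flow G \<nu> \<mu>"
proof -
  obtain h where h: "\<And>t s. t \<in> G' \<Longrightarrow> s \<in> G \<Longrightarrow> 0 \<le> h t s" "\<And>t. t \<in> G' \<Longrightarrow> 1 \<le> sum (h t) G"
    "\<And>f x. net G' f x = net G (\<lambda>s. \<Sum>t\<in>G'. f t * h t s) x"
    using net_refine[OF srcG' weakG'] by blast
  then show ?thesis using assms unfolding flow_def h(3)
    by (metis (no_types, lifting) mult_nonneg_nonneg sum_nonneg)
qed

lemma weak_refine:
  assumes "\<And>t. t \<in> H' \<Longrightarrow> weak G H (dirac (fst t)) (snd t)" and w: "weak G' H' \<nu> \<mu>"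
  shows "weak G H \<nu> \<mu>"
proof -
  obtain \<nu>' \<mu>' where *: "flow G' \<nu> \<nu>'" "move H' \<nu>' \<mu>'" "flow G' \<mu>' \<mu>" "\<And>x. 0 \<le> \<mu> x"
    using w by (auto simp: weak_def)
  obtain f where f: "\<And>t. t \<in> H' \<Longrightarrow> 0 \<le> f t" "\<nu>' = srcm H' f" "\<mu>' = tgtm H' f" using *(2) by (auto simp: move_def)
  have "weak G H (\<lambda>x. \<Sum>t\<in>H'. f t * dirac (fst t) x) (\<lambda>x. \<Sum>t\<in>H'. f t * snd t x)"
    using f(1) assms(1) by (intro weak_sum)
  then have "weak G H \<nu>' \<mu>'" unfolding f srcm_def tgtm_def .
  then show ?thesis using flow_weak_flow flow_refine * by blast
qed

end

end

section \<open>Elimination of states\<close>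

lemma sum_dirac:
  fixes \<mu> :: "'k \<Rightarrow> real"
  assumes "finite K" "\<And>x. x \<notin> K \<Longrightarrow> \<mu> x = 0"
  shows "(\<Sum>k\<in>K. \<mu> k * dirac k x) = \<mu> x"
proof -
  have "(\<Sum>k\<in>K. \<mu> k * dirac k x) = (\<Sum>k\<in>K. if k = x then \<mu> k else 0)"
    by (intro sum.cong) (auto simp: dirac_def)
  then show ?thesis using assms by auto
qed

text \<open>\<open>R\<close> is meant for transitions with at least one step and need not contain
  the Dirac measure at \<open>k\<close>. A flow may leave part of the mass in place, and
  \<open>q\<close> is the part that moves; for \<open>q = 0\<close> nothing is asked of
  \<open>\<sigma>\<close>.\<close>

definition stay_or :: "('k \<Rightarrow> ('k \<Rightarrow> real) \<Rightarrow> bool) \<Rightarrow> 'k \<Rightarrow> ('k \<Rightarrow> real) \<Rightarrow> bool" where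
  "stay_or R k w \<longleftrightarrow> (\<exists>q \<sigma>. 0 \<le> q \<and> q \<le> 1 \<and> (q = 0 \<or> R k \<sigma>) \<and> w = (\<lambda>x. (1 - q) * dirac k x + q * \<sigma> x))"

lemma stay_or_dirac: "stay_or R k (dirac k)"
  unfolding stay_or_def by (intro exI[of _ 0] exI[of _ undefined]) auto

lemma stay_orI: "R k \<sigma> \<Longrightarrow> 0 \<le> q \<Longrightarrow> q \<le> 1 \<Longrightarrow> stay_or R k (\<lambda>x. (1 - q) * dirac k x + q * \<sigma> x)"
  unfolding stay_or_def by blast

lemma convex_sum:
  fixes \<sigma> :: "'t \<Rightarrow> 'k \<Rightarrow> real"
  assumes conv: "\<And>\<rho> \<sigma> p. R \<rho> \<Longrightarrow> R \<sigma> \<Longrightarrow> 0 < p \<Longrightarrow> p < 1 \<Longrightarrow> R (\<lambda>x. p * \<rho> x + (1 - p) * \<sigma> x)"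
    and "finite A" "A \<noteq> {}" "\<And>t. t \<in> A \<Longrightarrow> 0 < c t" "\<And>t. t \<in> A \<Longrightarrow> R (\<sigma> t)"
  shows "R (\<lambda>x. (\<Sum>t\<in>A. c t * \<sigma> t x) / sum c A)"
  using assms(2-)
proof (induction A rule: finite_ne_induct)
  case (singleton t)
  then show ?case by (simp add: less_imp_neq[symmetric])
next
  case (insert t A)
  have pos: "0 < c t" "0 < sum c A" using insert by (auto intro: sum_pos)
  let ?p = "c t / (c t + sum c A)"
  have R1: "R (\<sigma> t)" using insert.prems by simp
  have R2: "R (\<lambda>x. (\<Sum>t\<in>A. c t * \<sigma> t x) / sum c A)" using insert.IH insert.prems by simp
  have "R (\<lambda>x. ?p * \<sigma> t x + (1 - ?p) * ((\<Sum>t\<in>A. c t * \<sigma> t x) / sum c A))"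
    by (rule conv[OF R1 R2]) (use pos in \<open>simp_all add: add_pos_pos\<close>)
  moreover have "?p * \<sigma> t x + (1 - ?p) * ((\<Sum>t\<in>A. c t * \<sigma> t x) / sum c A) =
      (c t * \<sigma> t x + (\<Sum>t\<in>A. c t * \<sigma> t x)) / (c t + sum c A)" for x
  proof -
    have "1 - ?p = sum c A / (c t + sum c A)" using pos by (simp add: field_simps)
    then show ?thesis using pos by (simp add: add_divide_distrib)
  qed
  ultimately show ?case using insert by simp
qed

text \<open>Separates the linear algebra of elimination from the equational calculus:
  \<open>R\<close> will be instantiated by the distributions whose \<open>\<tau>\<close>-summand the
  solution of a state absorbs. \<open>R_loop\<close> conditions on leaving \<open>k\<close>, hence
  the assumption \<open>\<rho> k < 1\<close>.\<close>

locale absorption =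
  fixes K :: "'k set" and R :: "'k \<Rightarrow> ('k \<Rightarrow> real) \<Rightarrow> bool"
  assumes finite_K: "finite K"
    and R_pdist: "\<And>k \<rho>. R k \<rho> \<Longrightarrow> pdist K \<rho>"
    and R_conv: "\<And>k \<rho> \<sigma> p. R k \<rho> \<Longrightarrow> R k \<sigma> \<Longrightarrow> 0 < p \<Longrightarrow> p < 1 \<Longrightarrow> R k (\<lambda>x. p * \<rho> x + (1 - p) * \<sigma> x)"
    and R_subst: "\<And>k \<rho> w. R k \<rho> \<Longrightarrow> (\<And>j. j \<in> K \<Longrightarrow> stay_or R j (w j)) \<Longrightarrow> R k (\<lambda>x. \<Sum>j\<in>K. \<rho> j * w j x)"
    and R_loop: "\<And>k \<rho>. R k \<rho> \<Longrightarrow> \<rho> k < 1 \<Longrightarrow> R k (\<lambda>x. if x = k then 0 else \<rho> x / (1 - \<rho> k))"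
begin

text \<open>The mass that moves in total is \<open>c = (1 - q) * r + q\<close>, and
  \<open>\<kappa>\<close> is its normalised distribution. The degenerate cases are separate because
  \<open>R_conv\<close> only allows weights strictly between 0 and 1.\<close>

lemma stay_or_conv:
  assumes w: "stay_or R k w" and \<tau>: "R k \<tau>" and q: "0 \<le> q" "q \<le> 1"
  shows "stay_or R k (\<lambda>x. (1 - q) * w x + q * \<tau> x)"
proof -
  obtain r \<sigma> where r: "0 \<le> r" "r \<le> 1" "r = 0 \<or> R k \<sigma>" "w = (\<lambda>x. (1 - r) * dirac k x + r * \<sigma> x)"
    using w by (auto simp: stay_or_def)
  define c where "c = (1 - q) * r + q"
  have qr: "0 \<le> (1 - q) * r" "(1 - q) * r \<le> 1 - q" using q r by (auto simp: mult_left_le)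
  show ?thesis
  proof (cases "(1 - q) * r = 0")
    case True
    then have "q = 1 \<or> r = 0" by simp
    then have "(\<lambda>x. (1 - q) * w x + q * \<tau> x) = (\<lambda>x. (1 - q) * dirac k x + q * \<tau> x)"
      using r by auto
    then show ?thesis using stay_orI[of R k \<tau> q] \<tau> q by simp
  next
    case False
    then have "0 < (1 - q) * r" "r \<noteq> 0" using qr(1) unfolding less_le by auto
    then have c: "0 < c" "c \<le> 1" "R k \<sigma>" "0 < (1 - q) * r" using qr q r(3) by (auto simp only: c_def)
    define \<kappa> where "\<kappa> = (\<lambda>x. ((1 - q) * r / c) * \<sigma> x + (1 - (1 - q) * r / c) * \<tau> x)"
    have "R k \<kappa>"
    proof (cases "q = 0")
      case True
      then show ?thesis using c by (simp add: \<kappa>_def c_def)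
    next
      case False
      then show ?thesis unfolding \<kappa>_def using c q \<tau> by (intro R_conv) (auto simp: c_def)
    qed
    moreover have "(1 - q) * w x + q * \<tau> x = (1 - c) * dirac k x + c * \<kappa> x" for x
    proof -
      have "c * \<kappa> x = (1 - q) * r * \<sigma> x + (c - (1 - q) * r) * \<tau> x"
        using c by (simp add: \<kappa>_def field_simps)
      then show ?thesis by (simp add: r c_def algebra_simps)
    qed
    ultimately show ?thesis using stay_orI[of R k \<kappa> c] c by simp
  qed
qed

text \<open>Gaussian elimination of the active states \<open>A\<close>: the loop at a state \<open>Y\<close> is removed by \<open>R_loop\<close>, and in
  every other distribution the fraction \<open>q\<close> of the mass at \<open>Y\<close> that leaves \<open>Y\<close> is replaced by the
  loop-free distribution of \<open>Y\<close>.\<close>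
lemma eliminate:
  assumes "finite A" "A \<subseteq> K"
    and "\<And>Y. Y \<in> A \<Longrightarrow> R Y (\<rho> Y)" "\<And>Y. Y \<in> A \<Longrightarrow> 0 \<le> f Y"
    and "\<And>g. (\<And>Y. Y \<in> A \<Longrightarrow> 0 \<le> g Y) \<Longrightarrow> (\<And>x. (\<Sum>Y\<in>A. g Y * (\<rho> Y x - dirac Y x)) = 0) \<Longrightarrow> (\<forall>Y\<in>A. g Y = 0)"
    and "\<And>x. x \<notin> K \<Longrightarrow> \<nu> x = 0" "\<And>x. 0 \<le> \<mu> x"
    and "\<And>x. \<mu> x = \<nu> x + (\<Sum>Y\<in>A. f Y * (\<rho> Y x - dirac Y x))"
  shows "\<exists>w. (\<forall>k\<in>K. stay_or R k (w k)) \<and> (\<forall>x. \<mu> x = (\<Sum>k\<in>K. \<nu> k * w k x))"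
  using assms
proof (induction A arbitrary: \<rho> f \<nu> rule: finite_induct)
  case empty
  have "\<mu> x = (\<Sum>k\<in>K. \<nu> k * dirac k x)" for x
    using empty.prems(5,7) by (simp add: sum_dirac[OF finite_K])
  then show ?case by (intro exI[of _ dirac]) (simp add: stay_or_dirac)
next
  case (insert Y A)
  note prems = insert.prems and YA = \<open>Y \<notin> A\<close> and fA = \<open>finite A\<close>
  have YK: "Y \<in> K" using prems(1) by auto
  have dY: "pdist K (\<rho> Y)" using prems(2) R_pdist by auto
  define l where "l = \<rho> Y Y"
  \<comment> \<open>Otherwise \<open>\<rho> Y\<close> is the Dirac measure at \<open>Y\<close>, and
    using it once is a nonzero circulation.\<close>
  have l1: "l < 1"
  proof -
    have "l \<noteq> 1"
    proof
      assume "l = 1"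
      then have d: "\<rho> Y = dirac Y" using pdist_1_dirac[OF finite_K dY] by (simp add: l_def)
      define g where "g Z = (if Z = Y then 1 else 0 :: real)" for Z
      have "(\<Sum>Z\<in>insert Y A. g Z * (\<rho> Z x - dirac Z x)) = 0" for x
        by (intro sum.neutral) (auto simp: g_def d)
      moreover have "0 \<le> g Z" for Z by (simp add: g_def)
      ultimately have "g Y = 0" using prems(4)[of g] by blast
      then show False by (simp add: g_def)
    qed
    then show ?thesis using pdist_le_1[OF finite_K dY, of Y] by (simp add: l_def)
  qed
  define \<sigma> where "\<sigma> x = (if x = Y then 0 else \<rho> Y x / (1 - l))" for x
  have R\<sigma>: "R Y \<sigma>" using R_loop[of Y "\<rho> Y"] prems(2)[of Y] l1 unfolding l_def \<sigma>_def by auto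
  have \<sigma>: "\<sigma> x - dirac Y x = (\<rho> Y x - dirac Y x) / (1 - l)" for x
    using l1 by (auto simp: \<sigma>_def l_def divide_simps)
  \<comment> \<open>The preceding identity shows that one use of \<open>\<rho> Y\<close> has the
    effect of \<open>1 - l\<close> uses of the loop-free \<open>\<sigma>\<close>; \<open>f'\<close>
    counts the latter.\<close>
  define f' where "f' = f Y * (1 - l)"
  have f'0: "0 \<le> f'" using prems(3)[of Y] l1 by (simp add: f'_def)
  \<comment> \<open>The denominator is the total mass that enters \<open>Y\<close> from elsewhere or
    starts there, by \<open>inflow\<close> below, and \<open>f'\<close> is the part that moves on.
    If both are zero, division by zero yields the harmless value 0.\<close>
  define q where "q = f' / (f' + \<mu> Y)"
  have q: "0 \<le> q" "q \<le> 1" using f'0 prems(6)[of Y] by (auto simp: q_def divide_le_eq_1)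
  define v where "v k = (if k = Y then (\<lambda>x. (1 - q) * dirac Y x + q * \<sigma> x) else dirac k)" for k
  have v: "stay_or R k (v k)" for k
    using stay_orI[of R Y \<sigma> q] R\<sigma> q stay_or_dirac by (auto simp: v_def)
  define up where "up m = (\<lambda>x. m x + q * m Y * (\<sigma> x - dirac Y x))" for m :: "'k \<Rightarrow> real"
  have up: "(\<lambda>x. \<Sum>k\<in>K. m k * v k x) = up m" if m: "\<And>x. x \<notin> K \<Longrightarrow> m x = 0" for m
  proof
    fix x
    have "(\<Sum>k\<in>K. m k * v k x) = (\<Sum>k\<in>K. (if k = x then m k else 0) + (if k = Y then m Y * (q * (\<sigma> x - dirac Y x)) else 0))"
      by (intro sum.cong refl) (auto simp: v_def dirac_def algebra_simps)
    also have "\<dots> = m x + m Y * (q * (\<sigma> x - dirac Y x))"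
      unfolding sum.distrib using finite_K YK m by simp
    finally show "(\<Sum>k\<in>K. m k * v k x) = up m x" by (simp add: up_def)
  qed
  have Rup: "R Z (up (\<rho> Z))" if "Z \<in> A" for Z
  proof -
    have "R Z (\<rho> Z)" using prems(2) that by auto
    then show ?thesis using R_subst[of Z "\<rho> Z" v] v up[of "\<rho> Z"] R_pdist[of Z "\<rho> Z"] by (simp add: pdistD)
  qed
  have sum_up: "(\<Sum>Z\<in>A. g Z * (up (\<rho> Z) x - dirac Z x)) =
      (\<Sum>Z\<in>A. g Z * (\<rho> Z x - dirac Z x)) + q * (\<Sum>Z\<in>A. g Z * \<rho> Z Y) * (\<sigma> x - dirac Y x)" for g x
    by (simp add: up_def algebra_simps sum.distrib sum_subtractf sum_distrib_left sum_distrib_right)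
  have "\<exists>w. (\<forall>k\<in>K. stay_or R k (w k)) \<and> (\<forall>x. \<mu> x = (\<Sum>k\<in>K. up \<nu> k * w k x))"
  proof (rule insert.IH[where \<rho> = "\<lambda>Z. up (\<rho> Z)" and f = f])
    show "A \<subseteq> K" using prems(1) by auto
    show "R Z (up (\<rho> Z))" if "Z \<in> A" for Z using Rup that .
    show "0 \<le> f Z" if "Z \<in> A" for Z using prems(3) that by auto
    show "\<forall>Z\<in>A. g Z = 0" if g: "\<And>Z. Z \<in> A \<Longrightarrow> 0 \<le> g Z" "\<And>x. (\<Sum>Z\<in>A. g Z * (up (\<rho> Z) x - dirac Z x)) = 0" for g
    proof -
      \<comment> \<open>\<open>e\<close> is the mass that a circulation \<open>g\<close> of the
        reduced system sends through the eliminated state. Restoring \<open>Y\<close> with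
        \<open>e / (1 - l)\<close> uses, the division accounting for its loop, gives a circulation
        of the original system.\<close>
      define e where "e = q * (\<Sum>Z\<in>A. g Z * \<rho> Z Y)"
      have "0 \<le> \<rho> Z Y" if "Z \<in> A" for Z using R_pdist prems(2) that pdistD(1) by (metis insertCI)
      then have e: "0 \<le> e" using q g(1) by (auto simp: e_def intro!: sum_nonneg mult_nonneg_nonneg)
      define g' where "g' = g(Y := e / (1 - l))"
      have "(\<Sum>Z\<in>insert Y A. g' Z * (\<rho> Z x - dirac Z x)) = 0" for x
      proof -
        have "(\<Sum>Z\<in>insert Y A. g' Z * (\<rho> Z x - dirac Z x)) =
            (\<Sum>Z\<in>A. g Z * (\<rho> Z x - dirac Z x)) + e / (1 - l) * (\<rho> Y x - dirac Y x)"
          using fA YA by (simp add: g'_def) (intro sum.cong refl, auto)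
        also have "e / (1 - l) * (\<rho> Y x - dirac Y x) = e * (\<sigma> x - dirac Y x)" unfolding \<sigma> by simp
        finally show ?thesis using g(2)[of x] unfolding sum_up e_def by simp
      qed
      then have "\<forall>Z\<in>insert Y A. g' Z = 0" using g(1) e l1 by (intro prems(4)) (auto simp: g'_def)
      then show ?thesis using YA by (auto simp: g'_def split: if_splits)
    qed
    show "up \<nu> x = 0" if "x \<notin> K" for x
      using that YK pdistD(2)[OF R_pdist[OF R\<sigma>] that] prems(5) by (auto simp: up_def dirac_def)
    show "0 \<le> \<mu> x" for x by (rule prems(6))
    show "\<mu> x = up \<nu> x + (\<Sum>Z\<in>A. f Z * (up (\<rho> Z) x - dirac Z x))" for x
    proof -
      \<comment> \<open>Conservation of mass at \<open>Y\<close>; it makes the redirected mass equal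
        to \<open>f'\<close>, exactly what the uses of \<open>\<rho> Y\<close> contributed.\<close>
      have "\<mu> Y = \<nu> Y + (\<Sum>Z\<in>A. f Z * (\<rho> Z Y - dirac Z Y)) + f Y * (\<rho> Y Y - 1)"
        using prems(7)[of Y] fA YA by simp
      also have "(\<Sum>Z\<in>A. f Z * (\<rho> Z Y - dirac Z Y)) = (\<Sum>Z\<in>A. f Z * \<rho> Z Y)"
        using YA by (intro sum.cong refl) (auto simp: dirac_def)
      finally have inflow: "\<nu> Y + (\<Sum>Z\<in>A. f Z * \<rho> Z Y) = f' + \<mu> Y"
        by (simp add: f'_def l_def algebra_simps)
      have "q * (f' + \<mu> Y) = f'" using f'0 prems(6)[of Y] by (auto simp: q_def)
      then have qf: "q * (\<nu> Y + (\<Sum>Z\<in>A. f Z * \<rho> Z Y)) = f'" by (simp only: inflow)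
      have "up \<nu> x + (\<Sum>Z\<in>A. f Z * (up (\<rho> Z) x - dirac Z x)) =
        \<nu> x + (\<Sum>Z\<in>A. f Z * (\<rho> Z x - dirac Z x)) + q * (\<nu> Y + (\<Sum>Z\<in>A. f Z * \<rho> Z Y)) * (\<sigma> x - dirac Y x)"
        unfolding sum_up by (simp add: up_def algebra_simps)
      also have "q * (\<nu> Y + (\<Sum>Z\<in>A. f Z * \<rho> Z Y)) * (\<sigma> x - dirac Y x) = f Y * (\<rho> Y x - dirac Y x)"
        unfolding qf \<sigma> using l1 by (simp add: f'_def)
      finally show ?thesis using prems(7)[of x] fA YA by simp
    qed
  qed
  then obtain w where w: "\<And>k. k \<in> K \<Longrightarrow> stay_or R k (w k)" "\<And>x. \<mu> x = (\<Sum>k\<in>K. up \<nu> k * w k x)" by blast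
  \<comment> \<open>The initial measure was redirected at \<open>Y\<close> as well. This is undone
    by changing the continuation of \<open>Y\<close> alone: it follows \<open>w Y\<close> with
    probability \<open>1 - q\<close>, and otherwise takes \<open>\<sigma>\<close> first and
    continues with \<open>w\<close>.\<close>
  define \<tau> where "\<tau> x = (\<Sum>k\<in>K. \<sigma> k * w k x)" for x
  have "R Y \<tau>" unfolding \<tau>_def using R_subst[OF R\<sigma>] w(1) by blast
  define w' where "w' = w(Y := (\<lambda>x. (1 - q) * w Y x + q * \<tau> x))"
  have "stay_or R k (w' k)" if "k \<in> K" for k
    using w(1) that stay_or_conv[OF w(1)[OF YK] \<open>R Y \<tau>\<close> q] by (auto simp: w'_def)
  moreover have "\<mu> x = (\<Sum>k\<in>K. \<nu> k * w' k x)" for x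
  proof -
    have "(\<Sum>k\<in>K. \<nu> k * w' k x) = (\<Sum>k\<in>K. \<nu> k * w k x + (if k = Y then q * \<nu> Y * (\<tau> x - w Y x) else 0))"
      by (intro sum.cong refl) (auto simp: w'_def algebra_simps)
    also have "\<dots> = (\<Sum>k\<in>K. \<nu> k * w k x) + q * \<nu> Y * (\<tau> x - w Y x)"
      unfolding sum.distrib using finite_K YK by simp
    finally have 1: "(\<Sum>k\<in>K. \<nu> k * w' k x) = (\<Sum>k\<in>K. \<nu> k * w k x) + q * \<nu> Y * (\<tau> x - w Y x)" .
    have "(\<Sum>k\<in>K. dirac Y k * w k x) = (\<Sum>k\<in>K. if k = Y then w Y x else 0)"
      by (intro sum.cong refl) (auto simp: dirac_def)
    then have 2: "(\<Sum>k\<in>K. dirac Y k * w k x) = w Y x" using finite_K YK by simp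
    have "\<mu> x = (\<Sum>k\<in>K. \<nu> k * w k x + q * \<nu> Y * (\<sigma> k * w k x - dirac Y k * w k x))"
      unfolding w(2) up_def by (intro sum.cong refl) (simp add: algebra_simps)
    also have "\<dots> = (\<Sum>k\<in>K. \<nu> k * w k x) + q * \<nu> Y * (\<tau> x - w Y x)"
      unfolding sum.distrib sum_distrib_left[symmetric] sum_subtractf 2 \<tau>_def ..
    finally show ?thesis using 1 by simp
  qed
  ultimately show ?case by blast
qed

text \<open>Elimination expects one distribution per active state, so the used transitions of a
  state are merged into their average weighted by \<open>f\<close>, which convexity of
  \<open>R\<close> permits.\<close>

lemma flow_absorbed:
  assumes G: "transitions K G" and cf: "circulation_free G"
    and RG: "\<And>t. t \<in> G \<Longrightarrow> R (fst t) (snd t)"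
    and \<nu>: "\<And>x. x \<notin> K \<Longrightarrow> \<nu> x = 0" and \<mu>: "\<And>x. 0 \<le> \<mu> x" and fl: "flow G \<nu> \<mu>"
  shows "\<exists>w. (\<forall>k\<in>K. stay_or R k (w k)) \<and> (\<forall>x. \<mu> x = (\<Sum>k\<in>K. \<nu> k * w k x))"
proof -
  interpret transitions K G by (rule G)
  obtain f where f: "\<And>t. t \<in> G \<Longrightarrow> 0 \<le> f t" "\<And>x. \<mu> x = \<nu> x - net G f x" using fl by (auto simp: flow_def)
  define out where "out Y = {t \<in> G. fst t = Y \<and> 0 < f t}" for Y
  define A where "A = {Y. out Y \<noteq> {}}"
  define F where "F Y = sum f (out Y)" for Y
  define \<rho> where "\<rho> Y = (\<lambda>x. (\<Sum>t\<in>out Y. f t * snd t x) / F Y)" for Y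
  have fin: "finite (out Y)" for Y using finG by (simp add: out_def)
  have AK: "A \<subseteq> K" using src by (auto simp: A_def out_def)
  then have fA: "finite A" using finK finite_subset by blast
  have F: "0 < F Y" if "Y \<in> A" for Y
    using that fin unfolding F_def A_def by (intro sum_pos) (auto simp: out_def)
  have agg: "(\<Sum>Y\<in>A. g Y * F Y * (\<rho> Y x - dirac Y x)) = - net G (\<lambda>t. g (fst t) * f t) x" for g x
  proof -
    have "F Y * (\<rho> Y x - dirac Y x) = (\<Sum>t\<in>out Y. f t * (snd t x - dirac (fst t) x))" if "Y \<in> A" for Y
    proof -
      have "F Y * (\<rho> Y x - dirac Y x) = (\<Sum>t\<in>out Y. f t * snd t x) - (\<Sum>t\<in>out Y. f t * dirac Y x)"
        using F[OF that] by (simp add: \<rho>_def right_diff_distrib) (simp add: F_def sum_distrib_right)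
      also have "(\<Sum>t\<in>out Y. f t * dirac Y x) = (\<Sum>t\<in>out Y. f t * dirac (fst t) x)"
        by (intro sum.cong) (auto simp: out_def)
      finally show ?thesis by (simp add: right_diff_distrib sum_subtractf)
    qed
    then have "(\<Sum>Y\<in>A. g Y * F Y * (\<rho> Y x - dirac Y x)) =
        (\<Sum>Y\<in>A. \<Sum>t\<in>out Y. g (fst t) * f t * (snd t x - dirac (fst t) x))"
      by (intro sum.cong refl) (simp add: mult.assoc sum_distrib_left, auto simp: out_def)
    also have "\<dots> = (\<Sum>t\<in>(\<Union>Y\<in>A. out Y). g (fst t) * f t * (snd t x - dirac (fst t) x))"
      using fA fin by (intro sum.UNION_disjoint[symmetric]) (auto simp: out_def)
    also have "\<dots> = (\<Sum>t\<in>G. g (fst t) * f t * (snd t x - dirac (fst t) x))"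
      using finG f(1) by (intro sum.mono_neutral_left) (auto simp: A_def out_def less_le)
    finally show ?thesis by (simp add: net_def srcm_def tgtm_def right_diff_distrib sum_subtractf)
  qed
  show ?thesis
  proof (rule eliminate[OF fA AK])
    show "R Y (\<rho> Y)" if "Y \<in> A" for Y
    proof -
      have "R Y (snd t)" if "t \<in> out Y" for t using RG that by (auto simp: out_def)
      then show ?thesis unfolding \<rho>_def F_def
        using fin that by (intro convex_sum[where R = "R Y", OF R_conv]) (auto simp: A_def out_def)
    qed
    show "0 \<le> F Y" if "Y \<in> A" for Y using F that by (simp add: less_imp_le)
    show "\<forall>Y\<in>A. g Y = 0" if g: "\<And>Y. Y \<in> A \<Longrightarrow> 0 \<le> g Y" "\<And>x. (\<Sum>Y\<in>A. g Y * (\<rho> Y x - dirac Y x)) = 0" for g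
    proof
      fix Y assume Y: "Y \<in> A"
      \<comment> \<open>\<open>g\<close> counts uses of the normalised average, whereas
        \<open>agg\<close> works with multiples of the original counts; dividing by the total
        \<open>F Z\<close> converts one into the other.\<close>
      define h where "h Z = (if Z \<in> A then g Z / F Z else 0)" for Z
      have h0: "0 \<le> h Z" for Z using g(1) F by (auto simp: h_def less_imp_le)
      have "(\<Sum>Y\<in>A. h Y * F Y * (\<rho> Y x - dirac Y x)) = (\<Sum>Y\<in>A. g Y * (\<rho> Y x - dirac Y x))" for x
        using F by (intro sum.cong refl) (auto simp: h_def less_imp_neq[symmetric])
      then have "net G (\<lambda>t. h (fst t) * f t) x = 0" for x using agg[of h x] g(2)[of x] by simp
      moreover have "\<forall>t\<in>G. 0 \<le> h (fst t) * f t" using h0 f(1) by simp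
      ultimately have z: "\<forall>t\<in>G. h (fst t) * f t = 0" 
        using cf[unfolded circulation_free_def, THEN spec, of "\<lambda>t. h (fst t) * f t"] by blast
      obtain t where "t \<in> out Y" using Y by (auto simp: A_def)
      then have "t \<in> G" "fst t = Y" "0 < f t" by (auto simp: out_def)
      then have "h Y = 0" using z by force
      then show "g Y = 0" using Y F[OF Y] by (simp add: h_def)
    qed
    show "\<mu> x = \<nu> x + (\<Sum>Y\<in>A. F Y * (\<rho> Y x - dirac Y x))" for x
      using agg[of "\<lambda>_. 1" x] f(2)[of x] by simp
  qed (use \<nu> \<mu> in auto)
qed

end

section \<open>Probabilistic choice up to provable equality\<close>

text \<open>Unlike \<open>wfP\<close>, this inspects only the choices above the leaves; the leaves
  are opaque.\<close>

fun tree :: "('a, 'v) expP \<Rightarrow> bool" where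
  "tree (PDirac E) = True"
| "tree (PCh P p Q) = (0 < p \<and> p < 1 \<and> tree P \<and> tree Q)"

lemma expP_tree_induct [case_names PDirac PCh]:
  "(\<And>E. R (PDirac E)) \<Longrightarrow> (\<And>P p Q. R P \<Longrightarrow> R Q \<Longrightarrow> R (PCh P p Q)) \<Longrightarrow> R P"
  by (rule tree.induct) auto

fun den :: "('a, 'v) expP \<Rightarrow> ('a, 'v) expE \<Rightarrow> real" where
  "den (PDirac E) = dirac E"
| "den (PCh P p Q) = (\<lambda>x. p * den P x + (1 - p) * den Q x)"

lemma pstep_iff_den: "pstep P \<mu> \<longleftrightarrow> \<mu> = den P"
proof
  show "pstep P \<mu> \<Longrightarrow> \<mu> = den P" by (induction rule: pstep.induct) auto
  have "pstep P (den P)" by (induction P rule: expP_tree_induct) (auto intro: pstep.intros)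
  then show "\<mu> = den P \<Longrightarrow> pstep P \<mu>" by simp
qed

fun leaves :: "('a, 'v) expP \<Rightarrow> ('a, 'v) expE set" where
  "leaves (PDirac E) = {E}"
| "leaves (PCh P p Q) = leaves P \<union> leaves Q"

lemma finite_leaves: "finite (leaves P)"
  by (induction P rule: expP_tree_induct) auto

lemma leaves_nonempty: "leaves P \<noteq> {}"
  by (induction P rule: expP_tree_induct) auto

lemma den_nonneg: "tree P \<Longrightarrow> 0 \<le> den P x"
  by (induction P rule: expP_tree_induct) auto

lemma den_pos_iff: "tree P \<Longrightarrow> 0 < den P x \<longleftrightarrow> x \<in> leaves P"
proof (induction P rule: expP_tree_induct)
  case (PDirac E) then show ?case by (cases "x = E") (auto simp: dirac_def)
next
  case (PCh P p Q)
  have "0 \<le> den P x" "0 \<le> den Q x" using PCh den_nonneg by auto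
  then have "0 < p * den P x + (1 - p) * den Q x \<longleftrightarrow> 0 < den P x \<or> 0 < den Q x"
    using PCh.prems by (cases "den P x = 0"; cases "den Q x = 0") (auto simp: zero_less_mult_iff intro!: add_pos_pos)
  then show ?case using PCh by auto
qed

lemma den_zero_iff: "tree P \<Longrightarrow> den P x = 0 \<longleftrightarrow> x \<notin> leaves P"
  using den_pos_iff[of P x] den_nonneg[of P x] by linarith

lemma den_sum: "tree P \<Longrightarrow> finite A \<Longrightarrow> leaves P \<subseteq> A \<Longrightarrow> sum (den P) A = 1"
proof (induction P rule: expP_tree_induct)
  case (PDirac E) then show ?case by (simp add: dirac_def)
next
  case (PCh P p Q)
  then show ?case by (simp add: sum.distrib flip: sum_distrib_left)
qed

lemma den_le_1: "tree P \<Longrightarrow> den P x \<le> 1"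
proof (induction P rule: expP_tree_induct)
  case (PDirac E) then show ?case by (simp add: dirac_def)
next
  case (PCh P p Q)
  then have "p * den P x \<le> p" "(1 - p) * den Q x \<le> 1 - p" by (auto simp: mult_left_le)
  then show ?case by simp
qed


definition pch :: "('a, 'v) expP \<Rightarrow> real \<Rightarrow> ('a, 'v) expP \<Rightarrow> ('a, 'v) expP" where
  "pch P p Q = (if p = 0 then Q else if p = 1 then P else PCh P p Q)"

lemma tree_pch: "0 \<le> p \<Longrightarrow> p \<le> 1 \<Longrightarrow> tree P \<Longrightarrow> tree Q \<Longrightarrow> tree (pch P p Q)"
  by (auto simp: pch_def)

lemma den_pch: "den (pch P p Q) x = p * den P x + (1 - p) * den Q x"
  by (auto simp: pch_def)

lemma leaves_pch: "leaves (pch P p Q) \<subseteq> leaves P \<union> leaves Q"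
  by (auto simp: pch_def)

lemma pch_cong:
  "0 \<le> p \<Longrightarrow> p \<le> 1 \<Longrightarrow> eqP P P' \<Longrightarrow> eqP Q Q' \<Longrightarrow> eqP (pch P p Q) (pch P' p Q')"
  by (auto simp: pch_def intro: congCh)

lemma pch_comm: "0 \<le> p \<Longrightarrow> p \<le> 1 \<Longrightarrow> eqP (pch P p Q) (pch Q (1 - p) P)"
  by (auto simp: pch_def intro: ax_pcomm reflP)

lemma pch_idem: "0 \<le> p \<Longrightarrow> p \<le> 1 \<Longrightarrow> eqP (pch P p P) P"
  by (auto simp: pch_def intro: ax_pidem reflP)

text \<open>In the nondegenerate case this is \<open>ax_passoc\<close>, read from right to left at
  the weights \<open>p * q\<close> and \<open>(1 - p) * q\<close>.\<close>

lemma pch_assoc: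
  assumes "0 \<le> p" "p \<le> 1" "0 \<le> q" "q \<le> 1"
  shows "eqP (pch (pch P p Q) q R) (pch P (p * q) (pch Q ((1 - p) * q / (1 - p * q)) R))"
proof -
  consider "p = 0" | "p = 1" | "q = 0" | "p \<noteq> 1" "q = 1" | "0 < p" "p < 1" "0 < q" "q < 1"
    using assms by fastforce
  then show ?thesis
  proof cases
    case 5
    have "p * q + (1 - p) * q = q" by (simp add: algebra_simps)
    moreover have pq: "0 < p * q" "0 < (1 - p) * q" using 5 by auto
    moreover have "p * q / q = p" using 5 by auto
    ultimately have "eqP (PCh (PCh P p Q) q R) (PCh P (p * q) (PCh Q ((1 - p) * q / (1 - p * q)) R))"
      using ax_passoc[of "p * q" "(1 - p) * q" P Q R] 5 symP by simp
    moreover have "p * q < 1" using 5 mult_strict_mono[of p 1 q 1] by simp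
    moreover have "(1 - p) * q < 1 - p * q" using 5 by (simp add: algebra_simps)
    then have "(1 - p) * q / (1 - p * q) \<noteq> 1" by auto
    ultimately show ?thesis using 5 by (auto simp: pch_def)
  qed (auto simp: pch_def intro: reflP)
qed

lemma ratio_bounds:
  fixes p q :: real
  assumes "0 \<le> p" "p \<le> 1" "0 \<le> q" "q \<le> 1"
  shows "0 \<le> (1 - p) * q / (1 - p * q)" "(1 - p) * q / (1 - p * q) \<le> 1"
proof -
  have "p * q \<le> 1" using assms by (simp add: mult_le_one)
  moreover have "(1 - p) * q \<le> 1 - p * q" using assms by (simp add: algebra_simps)
  ultimately show "0 \<le> (1 - p) * q / (1 - p * q)" "(1 - p) * q / (1 - p * q) \<le> 1"
    using assms by (auto simp: divide_le_eq_1)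
qed

text \<open>Commute, reassociate, commute the rest. The inner weight is characterised by a product
  instead of a quotient, so that the equation survives when \<open>Q\<close> has weight 1.\<close>

lemma pch_swap:
  assumes "0 \<le> p" "p \<le> 1" "0 \<le> q" "q \<le> 1"
  shows "\<exists>s. 0 \<le> s \<and> s \<le> 1 \<and> (1 - q * (1 - p)) * s = p \<and> eqP (pch P p (pch Q q R)) (pch Q (q * (1 - p)) (pch P s R))"
proof -
  define s where "s = (1 - q) * (1 - p) / (1 - q * (1 - p))"
  have s: "0 \<le> s" "s \<le> 1" unfolding s_def using assms by (intro ratio_bounds; simp)+
  have q1: "0 \<le> q * (1 - p)" "q * (1 - p) \<le> 1" using assms by (auto simp: mult_le_one)
  have "eqP (pch P p (pch Q q R)) (pch (pch Q q R) (1 - p) P)"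
    using assms by (intro pch_comm)
  moreover have "eqP (pch (pch Q q R) (1 - p) P) (pch Q (q * (1 - p)) (pch R s P))"
    unfolding s_def using assms by (intro pch_assoc) auto
  moreover have "eqP (pch Q (q * (1 - p)) (pch R s P)) (pch Q (q * (1 - p)) (pch P (1 - s) R))"
    using q1 s by (intro pch_cong pch_comm reflP)
  ultimately have "eqP (pch P p (pch Q q R)) (pch Q (q * (1 - p)) (pch P (1 - s) R))"
    using transP by blast
  moreover have "(1 - q * (1 - p)) * (1 - s) = p"
  proof (cases "q * (1 - p) = 1")
    case True
    then have "q = 1 \<and> p = 0"
      using assms mult_left_le[of "1 - p" q] mult_left_le_one_le[of "1 - p" q] by linarith
    then show ?thesis by simp
  next
    case False
    then have "(1 - q * (1 - p)) * s = (1 - q) * (1 - p)" by (simp add: s_def)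
    then show ?thesis by (simp add: algebra_simps)
  qed
  ultimately show ?thesis using s by (intro exI[of _ "1 - s"]) auto
qed

text \<open>Reassociating backwards puts both copies of \<open>P\<close> into one choice of inner
  weight \<open>p / c\<close>, which idempotence removes.\<close>

lemma pch_merge:
  assumes "0 \<le> p" "p \<le> 1" "0 \<le> q" "q \<le> 1"
  shows "eqP (pch P p (pch P q R)) (pch P (p + (1 - p) * q) R)"
proof -
  define c where "c = p + (1 - p) * q"
  have c: "0 \<le> c" "c \<le> 1" "p \<le> c"
    using assms mult_left_le[of q "1 - p"] mult_nonneg_nonneg[of "1 - p" q] unfolding c_def by linarith+
  show ?thesis
  proof (cases "c = 0 \<or> p = 1")
    case True
    then have "p = 0 \<and> q = 0 \<or> p = 1"
      using assms mult_nonneg_nonneg[of "1 - p" q] by (auto simp: c_def add_nonneg_eq_0_iff)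
    then show ?thesis by (auto simp: pch_def intro: reflP)
  next
    case False
    then have cp: "0 < c" "p < 1" using c assms by auto
    have "p / c * c = p" using cp by simp
    moreover have "(1 - p / c) * c / (1 - p / c * c) = q"
      using cp by (simp add: left_diff_distrib) (simp add: c_def)
    ultimately have "eqP (pch (pch P (p / c) P) c R) (pch P p (pch P q R))"
      using pch_assoc[of "p / c" c P P R] c cp assms by simp
    moreover have "eqP (pch (pch P (p / c) P) c R) (pch P c R)"
      using c cp assms by (intro pch_cong pch_idem reflP) auto
    ultimately show ?thesis unfolding c_def by (meson symP transP)
  qed
qed

text \<open>Extract \<open>k\<close> from both branches, move the second copy past the remainder of
  the first by \<open>pch_swap\<close>, and merge the copies. The last clause is multiplicative
  because the remainder is arbitrary when \<open>k\<close> has probability 1.\<close>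

lemma extract_leaf:
  assumes "tree P"
  shows "\<exists>P'. tree P' \<and> k \<notin> leaves P' \<and> eqP P (pch (PDirac k) (den P k) P') \<and>
     (\<forall>x. x \<noteq> k \<longrightarrow> den P x = (1 - den P k) * den P' x)"
  using assms
proof (induction P rule: expP_tree_induct)
  case (PDirac E)
  show ?case
  proof (cases "E = k")
    case True
    \<comment> \<open>The remainder has weight 0 and only has to avoid the leaf \<open>k\<close>;
      \<open>ESum k k\<close> differs from \<open>k\<close> by its size.\<close>
    then show ?thesis by (intro exI[of _ "PDirac (ESum k k)"]) (auto simp: dirac_def pch_def intro: reflP)
  next
    case False
    then show ?thesis by (intro exI[of _ "PDirac E"]) (auto simp: dirac_def pch_def intro: reflP)
  qed
next
  case (PCh P p Q)
  let ?a = "den P k" and ?b = "den Q k" and ?K = "PDirac k"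
  have p: "0 < p" "p < 1" and tr: "tree P" "tree Q" using PCh.prems by auto
  note rng = den_nonneg[OF tr(1), of k] den_nonneg[OF tr(2), of k]
    den_le_1[OF tr(1), of k] den_le_1[OF tr(2), of k]
  obtain P' where P': "tree P'" "k \<notin> leaves P'" "eqP P (pch ?K ?a P')"
      "\<And>x. x \<noteq> k \<Longrightarrow> den P x = (1 - ?a) * den P' x" using PCh.IH(1)[OF tr(1)] by blast
  obtain Q' where Q': "tree Q'" "k \<notin> leaves Q'" "eqP Q (pch ?K ?b Q')"
      "\<And>x. x \<noteq> k \<Longrightarrow> den Q x = (1 - ?b) * den Q' x" using PCh.IH(2)[OF tr(2)] by blast
  define c where "c = p * ?a + (1 - p) * ?b"
  define r where "r = (1 - ?a) * p / (1 - ?a * p)"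
  have ap: "0 \<le> ?a * p" "?a * p < 1" using rng p mult_right_mono[of ?a 1 p] mult_nonneg_nonneg[of ?a p] by linarith+
  have r: "0 \<le> r" "r \<le> 1" using ratio_bounds[of ?a p] rng p by (auto simp: r_def)
  obtain s where s: "0 \<le> s" "s \<le> 1"
      and sr: "(1 - ?b * (1 - r)) * s = r"
      and sw: "eqP (pch P' r (pch ?K ?b Q')) (pch ?K (?b * (1 - r)) (pch P' s Q'))"
    using pch_swap[of r ?b P' ?K Q'] r rng by blast
  define X where "X = pch P' s Q'"
  have br: "0 \<le> ?b * (1 - r)" "?b * (1 - r) \<le> 1" using rng r by (auto simp: mult_le_one)
  have ceq: "?a * p + (1 - ?a * p) * (?b * (1 - r)) = c"
  proof -
    have "(1 - ?a * p) * r = (1 - ?a) * p" using ap by (simp add: r_def)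
    moreover have "(1 - ?a * p) * (?b * (1 - r)) = ?b * ((1 - ?a * p) - (1 - ?a * p) * r)" by algebra
    ultimately show ?thesis unfolding c_def by (simp add: algebra_simps)
  qed
  have "eqP (PCh P p Q) (pch (pch ?K ?a P') p (pch ?K ?b Q'))"
    using pch_cong[of p P "pch ?K ?a P'" Q "pch ?K ?b Q'"] p P'(3) Q'(3) by (simp add: pch_def)
  moreover have "eqP (pch (pch ?K ?a P') p (pch ?K ?b Q')) (pch ?K (?a * p) (pch P' r (pch ?K ?b Q')))"
    unfolding r_def using rng p by (intro pch_assoc) auto
  moreover have "eqP (pch ?K (?a * p) (pch P' r (pch ?K ?b Q'))) (pch ?K (?a * p) (pch ?K (?b * (1 - r)) X))"
    unfolding X_def using sw ap by (intro pch_cong reflP) auto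
  moreover have "eqP (pch ?K (?a * p) (pch ?K (?b * (1 - r)) X)) (pch ?K c X)"
    using pch_merge[of "?a * p" "?b * (1 - r)" ?K X] ap br ceq by simp
  ultimately have eq: "eqP (PCh P p Q) (pch ?K c X)" using transP by blast
  have cs: "(1 - c) * s = (1 - ?a) * p"
  proof -
    have "1 - c = (1 - ?a * p) * (1 - ?b * (1 - r))" using ceq by (simp add: algebra_simps)
    then have "(1 - c) * s = (1 - ?a * p) * r" using sr by (simp add: mult.assoc)
    then show ?thesis using ap by (simp add: r_def)
  qed
  then have cs': "(1 - c) * (1 - s) = (1 - p) * (1 - ?b)" by (simp add: c_def algebra_simps)
  have "p * den P x + (1 - p) * den Q x = (1 - c) * den X x" if "x \<noteq> k" for x
  proof -
    have "(1 - c) * den X x = ((1 - c) * s) * den P' x + ((1 - c) * (1 - s)) * den Q' x"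
      by (simp add: X_def den_pch algebra_simps)
    then show ?thesis unfolding cs cs' using P'(4)[OF that] Q'(4)[OF that] by simp
  qed
  moreover have "tree X" "k \<notin> leaves X"
    using P' Q' s leaves_pch[of P' s Q'] by (auto simp: X_def intro: tree_pch)
  ultimately show ?case using eq by (auto simp: c_def)
qed

text \<open>Completeness of the three choice axioms for the denoted distributions. Drawing one leaf
  to the front of both sides leaves remainders with equal denotation and fewer distinct
  leaves.\<close>

theorem tree_eqI:
  assumes "tree P" "tree Q" "den P = den Q"
  shows "eqP P Q"
  using assms
proof (induction "card (leaves P)" arbitrary: P Q rule: less_induct)
  case less
  obtain k where k: "k \<in> leaves P" using leaves_nonempty by blast
  let ?c = "den P k"
  obtain P' where P': "tree P'" "k \<notin> leaves P'" "eqP P (pch (PDirac k) ?c P')"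
      "\<And>x. x \<noteq> k \<Longrightarrow> den P x = (1 - ?c) * den P' x" using extract_leaf less.prems by blast
  obtain Q' where Q': "tree Q'" "k \<notin> leaves Q'" "eqP Q (pch (PDirac k) ?c Q')"
      "\<And>x. x \<noteq> k \<Longrightarrow> den P x = (1 - ?c) * den Q' x" using extract_leaf less.prems by metis
  have c: "0 \<le> ?c" "?c \<le> 1" using den_nonneg den_le_1 less.prems by auto
  have "eqP (pch (PDirac k) ?c P') (pch (PDirac k) ?c Q')"
  proof (cases "?c = 1")
    case True then show ?thesis by (simp add: pch_def reflP)
  next
    case False
    have d: "den P' = den Q'"
    proof
      fix x show "den P' x = den Q' x"
        using P' Q' False den_zero_iff[of P' x] den_zero_iff[of Q' x] by (cases "x = k") auto
    qed
    have "leaves P' \<subseteq> leaves P - {k}"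
    proof
      fix x assume x: "x \<in> leaves P'"
      then have "x \<noteq> k" using P' by auto
      then have "den P x \<noteq> 0" using P'(4) x False den_zero_iff[OF P'(1), of x] by auto
      then show "x \<in> leaves P - {k}" using \<open>x \<noteq> k\<close> den_zero_iff less.prems by blast
    qed
    then have "card (leaves P') < card (leaves P)"
      using k by (intro psubset_card_mono finite_leaves) auto
    then show ?thesis using less.hyps P'(1) Q'(1) d c by (intro pch_cong reflP) auto
  qed
  then show ?case using P'(3) Q'(3) symP transP by blast
qed

section \<open>Absorbed transitions\<close>

lemma sum_list_divide: "(\<Sum>r\<leftarrow>xs. r / c) = sum_list xs / (c::real)"
  by (induction xs) (auto simp: add_divide_distrib)

lemma weights_Cons2:
  assumes "weights (p # q # ps)"
  shows "0 < p" "p < 1" "weights (map (\<lambda>r. r / (1 - p)) (q # ps))"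
proof -
  have pos: "\<forall>r \<in> set (q # ps). 0 < r" and s: "p + sum_list (q # ps) = 1" and p: "0 < p"
    using assms by (auto simp: weights_def)
  have "0 \<le> sum_list ps" using pos by (intro sum_list_nonneg) (auto intro: less_imp_le)
  then have "0 < sum_list (q # ps)" using pos by (simp add: add_pos_nonneg)
  then show p1: "p < 1" using s by linarith
  show "0 < p" by (rule p)
  have "sum_list (map (\<lambda>r. r / (1 - p)) (q # ps)) = 1"
    unfolding sum_list_divide using s p1 by simp
  then show "weights (map (\<lambda>r. r / (1 - p)) (q # ps))"
    unfolding weights_def using p1 pos by auto
qed

lemma bigoplusP_map_Cons2:
  "bigoplusP (map (\<lambda>z. (w z, A z)) (y # z # zs)) =
     PCh (A y) (w y) (bigoplusP (map (\<lambda>z. (w z / (1 - w y), A z)) (z # zs)))"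
  by (simp add: o_def)

lemma weights_map_Cons2:
  assumes "weights (map w (y # z # zs))"
  shows "0 < w y" "w y < 1" "weights (map (\<lambda>z. w z / (1 - w y)) (z # zs))"
  using weights_Cons2[of "w y" "w z" "map w zs"] assms by (auto simp: o_def)

lemma tree_bigoplusP:
  "weights (map w zs) \<Longrightarrow> (\<And>z. z \<in> set zs \<Longrightarrow> tree (A z)) \<Longrightarrow> tree (bigoplusP (map (\<lambda>z. (w z, A z)) zs))"
proof (induction zs arbitrary: w rule: induct_list012)
  case (3 y z zs)
  note w = weights_map_Cons2[OF 3(3)]
  show ?case unfolding bigoplusP_map_Cons2 using w 3(2)[OF w(3)] 3(4) by simp
qed auto

lemma den_bigoplusP:
  "weights (map w zs) \<Longrightarrow> den (bigoplusP (map (\<lambda>z. (w z, A z)) zs)) x = (\<Sum>z\<leftarrow>zs. w z * den (A z) x)"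
proof (induction zs arbitrary: w rule: induct_list012)
  case (3 y z zs)
  note w = weights_map_Cons2[OF 3(3)]
  have "(1 - w y) * (\<Sum>z\<leftarrow>z # zs. w z / (1 - w y) * den (A z) x) = (\<Sum>z\<leftarrow>z # zs. w z * den (A z) x)"
    unfolding sum_list_const_mult[symmetric] using w(2) by simp
  then show ?case unfolding bigoplusP_map_Cons2 using 3(2)[OF w(3)] by simp
qed (auto simp: weights_def)

text \<open>The laws for iterated choice demand strictly positive weights, so only the support is
  listed; the last clause returns from the list to sums over \<open>K\<close>.\<close>

lemma support_list:
  assumes "finite K" "pdist K \<mu>"
  obtains zs where "set zs = {k \<in> K. 0 < \<mu> k}" "weights (map \<mu> zs)"
    "\<And>g :: 'k \<Rightarrow> real. (\<Sum>z\<leftarrow>zs. \<mu> z * g z) = (\<Sum>k\<in>K. \<mu> k * g k)"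
proof -
  obtain zs where zs: "set zs = {k \<in> K. 0 < \<mu> k}" "distinct zs"
    using finite_distinct_list[of "{k \<in> K. 0 < \<mu> k}"] assms(1) by auto
  have sm: "(\<Sum>z\<leftarrow>zs. \<mu> z * g z) = (\<Sum>k\<in>K. \<mu> k * g k)" for g
  proof -
    have "(\<Sum>z\<leftarrow>zs. \<mu> z * g z) = (\<Sum>k\<in>{k \<in> K. 0 < \<mu> k}. \<mu> k * g k)"
      using zs by (simp add: sum_list_distinct_conv_sum_set)
    also have "\<dots> = (\<Sum>k\<in>K. \<mu> k * g k)"
      using assms by (intro sum.mono_neutral_left) (auto simp: less_le pdistD)
    finally show ?thesis .
  qed
  have "sum_list (map \<mu> zs) = 1" using sm[of "\<lambda>_. 1"] assms(2) by (simp add: pdistD)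
  then have "weights (map \<mu> zs)" using zs(1) by (auto simp: weights_def)
  then show ?thesis using that zs sm by blast
qed

section \<open>The summand order, and \<open>\<tau>\<close>-leaves below a prefix\<close>

lemma eqE_nil_left: "eqE (ESum ENil E) E"
  using ax_comm ax_nil transE by blast

text \<open>The natural order of the semilattice given by \<open>ESum\<close> modulo provable
  equality.\<close>

definition below :: "('a, 'v) expE \<Rightarrow> ('a, 'v) expE \<Rightarrow> bool" where
  "below F E \<longleftrightarrow> eqE (ESum E F) E"

lemma below_cong: "below F E \<Longrightarrow> eqE F F' \<Longrightarrow> eqE E E' \<Longrightarrow> below F' E'"
  unfolding below_def by (meson congSum symE transE)

lemma below_refl: "below E E"
  by (simp add: below_def ax_idem)

lemma below_trans:
  assumes "below F G" "below G E"
  shows "below F E"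
proof -
  have "eqE (ESum E F) (ESum (ESum E G) F)" using assms(2) unfolding below_def by (meson congSum reflE symE)
  moreover have "eqE (ESum (ESum E G) F) (ESum E (ESum G F))" by (rule symE[OF ax_assoc])
  moreover have "eqE (ESum E (ESum G F)) (ESum E G)" using assms(1) unfolding below_def by (intro congSum reflE)
  ultimately show ?thesis using assms(2) unfolding below_def by (meson transE)
qed

lemma below_sumI:
  assumes "below F E" "below G E"
  shows "below (ESum F G) E"
proof -
  have "eqE (ESum E (ESum F G)) (ESum (ESum E F) G)" by (rule ax_assoc)
  moreover have "eqE (ESum (ESum E F) G) (ESum E G)" using assms(1) unfolding below_def by (intro congSum reflE)
  ultimately show ?thesis using assms(2) unfolding below_def by (meson transE)
qed

lemma below_sum_right: "below G (ESum F G)"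
proof -
  have "eqE (ESum (ESum F G) G) (ESum F (ESum G G))" by (rule symE[OF ax_assoc])
  moreover have "eqE (ESum F (ESum G G)) (ESum F G)" by (intro congSum reflE ax_idem)
  ultimately show ?thesis unfolding below_def by (rule transE)
qed

lemma below_sum_left: "below F (ESum F G)"
  using below_cong[OF below_sum_right reflE ax_comm] .

lemma below_conv: "0 < p \<Longrightarrow> p < 1 \<Longrightarrow> below (EPre a (PCh P p Q)) (ESum (EPre a P) (EPre a Q))"
proof -
  assume p: "0 < p" "p < 1"
  have "below (EPre a (PCh P p Q)) (ESum (ESum (EPre a P) (EPre a (PCh P p Q))) (EPre a Q))"
    using below_trans[OF below_sum_right below_sum_left] .
  then show ?thesis using below_cong reflE symE[OF ax_cc[OF p]] by blast
qed

text \<open>Removal of a \<open>\<tau>\<close> at any set of leaves at once. Such trees are in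
  general not related by \<open>eqP\<close>; the law behind \<open>tau\<close> applies only below a
  prefix.\<close>

inductive tau_leaves :: "('a, 'v) expP \<Rightarrow> ('a, 'v) expP \<Rightarrow> bool" where
  same: "eqE E F \<Longrightarrow> tau_leaves (PDirac E) (PDirac F)"
| tau: "eqE E (EPre Tau (PDirac F)) \<Longrightarrow> tau_leaves (PDirac E) (PDirac F)"
| choice: "0 < p \<Longrightarrow> p < 1 \<Longrightarrow> tau_leaves P P' \<Longrightarrow> tau_leaves Q Q' \<Longrightarrow> tau_leaves (PCh P p Q) (PCh P' p Q')"

lemma tau_leaves_tree: "tau_leaves P P' \<Longrightarrow> tree P \<and> tree P'"
  by (induction rule: tau_leaves.induct) auto

lemma frac_bounds: "0 < u \<Longrightarrow> 0 < v \<Longrightarrow> u + v < 1 \<Longrightarrow> 0 < v / (1 - u) \<and> v / (1 - u) < (1::real)"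
  by (simp add: pos_divide_less_eq)

text \<open>\<open>ax_tau1\<close> rewrites only a leaf on the left of the topmost choice. Each
  subtree is therefore rotated to this position, the rest being collected in the context
  \<open>R\<close>.\<close>

lemma tau_leaves_choice_eq:
  "tau_leaves P P' \<Longrightarrow> tree R \<Longrightarrow> 0 < c \<Longrightarrow> c < 1 \<Longrightarrow> eqE (EPre a (PCh P c R)) (EPre a (PCh P' c R))"
proof (induction arbitrary: R c rule: tau_leaves.induct)
  case (same E F)
  then show ?case by (intro congPre congCh congDirac reflP)
next
  case (tau E F)
  then have "eqE (EPre a (PCh (PDirac E) c R)) (EPre a (PCh (PDirac (EPre Tau (PDirac F))) c R))"
    by (intro congPre congCh congDirac reflP)
  then show ?case using ax_tau1 transE tau by blast
next
  case (choice p P P' Q Q')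
  note tr = tau_leaves_tree[OF choice(3)] tau_leaves_tree[OF choice(4)] choice.prems(1)
  note pc = choice(1,2) choice.prems(2,3)
  have pc1: "p * c < 1" "(1 - p) * c < 1" "0 < p * c" "0 < (1 - p) * c"
    using pc mult_strict_mono[of p 1 c 1] mult_strict_mono[of "1 - p" 1 c 1] by auto
  \<comment> \<open>\<open>s\<close> is the conditional weight of \<open>Q\<close> once
    \<open>P\<close> is split off, and \<open>r\<close> that of \<open>P\<close> once
    \<open>Q\<close> is split off.\<close>
  define s where "s = (1 - p) * c / (1 - p * c)"
  define r where "r = p * c / (1 - (1 - p) * c)"
  have "p * c + (1 - p) * c = c" by (simp add: algebra_simps)
  then have s: "0 < s" "s < 1" and r: "0 < r" "r < 1"
    using frac_bounds[OF pc1(3,4)] frac_bounds[OF pc1(4,3)] pc(4) by (simp_all add: s_def r_def add.commute)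
  have ss: "(1 - p * c) * s = (1 - p) * c" and rr: "(1 - (1 - p) * c) * r = p * c"
    using pc1 by (simp_all add: s_def r_def)
  have assoc: "eqP (PCh (PCh X p Y) c R) (PCh X (p * c) (PCh Y s R))" if "tree X" "tree Y" for X Y
  proof (rule tree_eqI)
    have "c * (p * x + (1 - p) * y) + (1 - c) * z = p * c * x + (1 - p * c) * (s * y + (1 - s) * z)" for x y z
      using arg_cong[OF ss, of "\<lambda>t. t * y"] arg_cong[OF ss, of "\<lambda>t. t * z"] by (simp add: algebra_simps)
    then show "den (PCh (PCh X p Y) c R) = den (PCh X (p * c) (PCh Y s R))" by auto
  qed (use that tr s pc pc1 in auto)
  have swap: "eqP (PCh X (p * c) (PCh Y s R)) (PCh Y ((1 - p) * c) (PCh X r R))" if "tree X" "tree Y" for X Y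
  proof (rule tree_eqI)
    have "p * c * x + (1 - p * c) * (s * y + (1 - s) * z) = (1 - p) * c * y + (1 - (1 - p) * c) * (r * x + (1 - r) * z)" for x y z
      using arg_cong[OF ss, of "\<lambda>t. t * y"] arg_cong[OF ss, of "\<lambda>t. t * z"]
        arg_cong[OF rr, of "\<lambda>t. t * x"] arg_cong[OF rr, of "\<lambda>t. t * z"] by (simp add: algebra_simps)
    then show "den (PCh X (p * c) (PCh Y s R)) = den (PCh Y ((1 - p) * c) (PCh X r R))" by auto
  qed (use that tr s r pc pc1 in auto)
  have 1: "eqE (EPre a (PCh P (p * c) (PCh Q s R))) (EPre a (PCh P' (p * c) (PCh Q s R)))"
    using tr s pc1 by (intro choice.IH) auto
  have 2: "eqE (EPre a (PCh Q ((1 - p) * c) (PCh P' r R))) (EPre a (PCh Q' ((1 - p) * c) (PCh P' r R)))"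
    using tr r pc1 by (intro choice.IH) auto
  show ?case
    using congPre[OF assoc[of P Q]] 1 congPre[OF swap[of P' Q]] 2 congPre[OF symP[OF swap[of P' Q']]]
      congPre[OF symP[OF assoc[of P' Q']]] tr by (meson transE)
qed

text \<open>A single leaf has no choice around it, as \<open>ax_tau1\<close> would require.
  Idempotence doubles the tree, so that each copy serves as context while the other one is
  rewritten.\<close>

lemma tau_leaves_eq:
  assumes "tau_leaves P P'"
  shows "eqE (EPre a P) (EPre a P')"
proof -
  have tr: "tree P" "tree P'" using tau_leaves_tree assms by auto
  have idem: "eqE (EPre a Q) (EPre a (PCh Q (1/2) Q))" for Q
    by (intro congPre symP[OF ax_pidem]) auto
  have comm: "eqE (EPre a (PCh P' (1/2) P)) (EPre a (PCh P (1/2) P'))"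
    using congPre[OF ax_pcomm[of "1/2" P' P]] by simp
  have "eqE (EPre a (PCh P (1/2) P)) (EPre a (PCh P' (1/2) P))"
    "eqE (EPre a (PCh P (1/2) P')) (EPre a (PCh P' (1/2) P'))"
    using assms tr by (auto intro: tau_leaves_choice_eq)
  then show ?thesis using idem[of P] symE[OF idem[of P']] comm by (meson transE)
qed

lemma tau_leaves_bigoplusP:
  "weights (map w zs) \<Longrightarrow> (\<And>z. z \<in> set zs \<Longrightarrow> tau_leaves (A z) (B z)) \<Longrightarrow>
    tau_leaves (bigoplusP (map (\<lambda>z. (w z, A z)) zs)) (bigoplusP (map (\<lambda>z. (w z, B z)) zs))"
proof (induction zs arbitrary: w rule: induct_list012)
  case (3 y z zs)
  note w = weights_map_Cons2[OF 3(3)]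
  show ?case unfolding bigoplusP_map_Cons2 using w 3(2)[OF w(3)] 3(4) by (intro tau_leaves.choice) auto
qed (auto simp: weights_def)

section \<open>Removal of a loop by unique solutions\<close>

lemma subst_id:
  fixes E :: "('a, 'v) expE" and P :: "('a, 'v) expP"
  shows "(\<And>x. x \<in> fvE E \<Longrightarrow> \<sigma> x = EVar x) \<Longrightarrow> substE \<sigma> E = E"
    "(\<And>x. x \<in> fvP P \<Longrightarrow> \<sigma> x = EVar x) \<Longrightarrow> substP \<sigma> P = P"
proof (induct E and P arbitrary: \<sigma> and \<sigma> rule: expE.induct expP.induct)
  case (ERec y E)
  have "y \<notin> (\<Union>x \<in> fvE E - {y}. fvE (\<sigma> x))" using ERec(2) by auto
  moreover have "substE (\<sigma>(y := EVar y)) E = E" using ERec(2) by (intro ERec(1)) auto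
  ultimately show ?case by (simp add: Let_def)
qed auto

text \<open>Nonemptiness survives recursion because its rule excludes \<open>V = {Y}\<close>; it is
  what makes a variable guarded inside a choice with another branch free of it.\<close>

lemma unguarded_free:
  fixes E :: "('a, 'v) expE" and P :: "('a, 'v) expP"
  shows "ungE E V \<Longrightarrow> V \<noteq> {} \<and> V \<subseteq> fvE E" "ungP P W \<Longrightarrow> W \<noteq> {} \<and> W \<subseteq> fvP P"
  by (induction rule: ungE_ungP.inducts) auto

inductive_cases ungE_SumE: "ungE (ESum E F) V"
inductive_cases ungE_PreE: "ungE (EPre a P) V"
inductive_cases ungP_ChE: "ungP (PCh P p Q) V"

text \<open>By unique solutions \<open>E = rec Z. (\<tau>.(\<partial>(Z + 0) \<oplus>\<^sub>p N) + E)\<close> for fresh \<open>Z\<close>; the variable \<open>Z\<close> is guarded here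
  because \<open>N\<close> contributes a nonempty set of variables other than \<open>Z\<close>.\<close>
lemma below_loop:
  fixes E :: "('a, 'v::infinite) expE"
  assumes p: "0 < p" "p < 1" and b: "below (EPre Tau (PCh (PDirac E) p N)) E"
  shows "below (EPre Tau N) E"
proof -
  obtain Z where Z: "Z \<notin> fvE E \<union> fvP N"
    using ex_new_if_finite[of "fvE E \<union> fvP N"] finite_fv infinite_UNIV by blast
  have sub: "substE (EVar(Z := F)) E = E" "substP (EVar(Z := F)) N = N" for F
    using Z by (auto intro: subst_id)
  \<comment> \<open>The summand \<open>ENil\<close> gives the loop the shape \<open>X + E\<close>
    that \<open>ax_rec1\<close> expects.\<close>
  define T where "T F = EPre Tau (PCh (PDirac (ESum F ENil)) p N)" for F
  define G1 where "G1 = ESum (T (EVar Z)) E"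
  define G2 where "G2 = ESum (ESum (T (EVar Z)) (EPre Tau N)) E"
  have s1: "subst1 G1 F Z = ESum (T F) E" for F by (simp add: subst1_def G1_def T_def sub)
  have s2: "subst1 G2 F Z = ESum (ESum (T F) (EPre Tau N)) E" for F by (simp add: subst1_def G2_def T_def sub)
  have "eqE (T E) (EPre Tau (PCh (PDirac E) p N))"
    unfolding T_def using p by (intro congPre congCh congDirac reflP ax_nil)
  then have "below (T E) E" using b below_cong reflE symE by blast
  then have "eqE E (ESum (T E) E)" unfolding below_def by (meson ax_comm symE transE)
  moreover have "\<not> ungE G1 {Z}"
  proof
    assume "ungE G1 {Z}"
    then show False unfolding G1_def
    proof (rule ungE_SumE)
      assume "ungE E {Z}" then show False using unguarded_free(1) Z by blast
    next
      assume "ungE (T (EVar Z)) {Z}"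
      then have "ungP (PCh (PDirac (ESum (EVar Z) ENil)) p N) {Z}" unfolding T_def by (auto elim: ungE_PreE)
      then obtain V W where "V \<union> W = {Z}" "ungP N W" by (auto elim!: ungP_ChE)
      then show False using unguarded_free(2)[of N W] Z by (auto simp: subset_singleton_iff dest!: equalityD1)
    qed
  qed
  ultimately have "eqE E (ERec Z G1)" using ufi[of E G1 Z] by (simp add: s1)
  moreover have "eqE (ERec Z G1) (ERec Z G2)" unfolding G1_def G2_def T_def by (rule ax_rec1[OF p])
  moreover have "eqE (ERec Z G2) (ESum (ESum (T (ERec Z G2)) (EPre Tau N)) E)"
    using ax_unfold[of Z G2] by (simp add: s2)
  ultimately have "eqE (ESum (ESum (T (ERec Z G2)) (EPre Tau N)) E) E" by (meson symE transE)
  then show ?thesis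
    using below_cong[OF below_trans[OF below_sum_right below_sum_left] reflE] by blast
qed

text \<open>The image measure under \<open>e\<close>. Distinct states may have the same expression,
  and then their masses add up.\<close>

definition lift :: "'k set \<Rightarrow> ('k \<Rightarrow> ('a, 'v) expE) \<Rightarrow> ('k \<Rightarrow> real) \<Rightarrow> ('a, 'v) expE \<Rightarrow> real" where
  "lift K e \<mu> x = (\<Sum>k\<in>K. \<mu> k * dirac (e k) x)"

lemma lift_lin: "lift K e (\<lambda>x. a * \<mu> x + b * \<nu> x) x = a * lift K e \<mu> x + b * lift K e \<nu> x"
  by (simp add: lift_def algebra_simps sum.distrib sum_distrib_left)

lemma lift_sum: "lift K e (\<lambda>x. \<Sum>t\<in>A. c t * \<mu> t x) x = (\<Sum>t\<in>A. c t * lift K e (\<mu> t) x)"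
  unfolding lift_def sum_distrib_left sum_distrib_right mult.assoc by (rule sum.swap)

lemma lift_dirac: "finite K \<Longrightarrow> k \<in> K \<Longrightarrow> lift K e (dirac k) x = dirac (e k) x"
proof -
  assume K: "finite K" "k \<in> K"
  have "lift K e (dirac k) x = (\<Sum>j\<in>K. if j = k then dirac (e k) x else 0)"
    unfolding lift_def by (intro sum.cong refl) (auto simp: dirac_def)
  then show ?thesis using K by simp
qed

text \<open>By \<open>tree_eqI\<close> the choice of the representing tree is immaterial, so one
  tree suffices to establish this and any may be used afterwards. \<open>pdist\<close> guarantees
  that there is one.\<close>

definition absorbs :: "'k set \<Rightarrow> ('k \<Rightarrow> ('a, 'v) expE) \<Rightarrow> 'a act \<Rightarrow> 'k \<Rightarrow> ('k \<Rightarrow> real) \<Rightarrow> bool" where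
  "absorbs K e a k \<mu> \<longleftrightarrow> pdist K \<mu> \<and> (\<forall>P. tree P \<and> den P = lift K e \<mu> \<longrightarrow> below (EPre a P) (e k))"

lemma absorbsI:
  assumes "pdist K \<mu>" "tree P" "den P = lift K e \<mu>" "below (EPre a P) (e k)"
  shows "absorbs K e a k \<mu>"
  unfolding absorbs_def
proof (intro conjI allI impI assms(1))
  fix Q assume "tree Q \<and> den Q = lift K e \<mu>"
  then have "eqP P Q" using tree_eqI assms by metis
  then show "below (EPre a Q) (e k)" using below_cong[OF assms(4) _ reflE] congPre by blast
qed

lemma absorbsD: "absorbs K e a k \<mu> \<Longrightarrow> tree P \<Longrightarrow> den P = lift K e \<mu> \<Longrightarrow> below (EPre a P) (e k)"
  by (simp add: absorbs_def)

lemma pdist_conv: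
  assumes "pdist K \<rho>" "pdist K \<sigma>" "0 \<le> p" "p \<le> 1"
  shows "pdist K (\<lambda>x. p * \<rho> x + (1 - p) * \<sigma> x)"
  using assms by (auto simp: pdist_def sum.distrib simp flip: sum_distrib_left)

lemma pdist_sum:
  assumes "finite K" "pdist K \<nu>" "\<And>k. k \<in> K \<Longrightarrow> 0 < \<nu> k \<Longrightarrow> pdist K (w k)"
  shows "pdist K (\<lambda>x. \<Sum>k\<in>K. \<nu> k * w k x)"
proof -
  have "\<nu> k * w k x = 0" if "x \<notin> K" "k \<in> K" for k x
    using assms(2,3) that pdistD by (metis less_le mult_eq_0_iff)
  moreover have "0 \<le> \<nu> k * w k x" if "k \<in> K" for k x
    using assms(2,3) that pdistD(1) by (metis less_le mult_eq_0_iff mult_nonneg_nonneg order_refl)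
  moreover have "(\<Sum>x\<in>K. \<Sum>k\<in>K. \<nu> k * w k x) = (\<Sum>k\<in>K. \<nu> k * sum (w k) K)"
    unfolding sum_distrib_left by (rule sum.swap)
  moreover have "\<nu> k * sum (w k) K = \<nu> k" if "k \<in> K" for k
    using assms(2,3) that pdistD(1,3) by (metis less_le mult.right_neutral mult_zero_left)
  ultimately show ?thesis using assms(2) by (auto simp: pdist_def intro!: sum.neutral sum_nonneg)
qed

lemma ex_tree:
  assumes "finite K" "pdist K \<mu>"
  shows "\<exists>P. tree P \<and> den P = lift K e \<mu>"
proof -
  obtain zs where zs: "set zs = {k \<in> K. 0 < \<mu> k}" "weights (map \<mu> zs)"
    "\<And>g :: _ \<Rightarrow> real. (\<Sum>z\<leftarrow>zs. \<mu> z * g z) = (\<Sum>k\<in>K. \<mu> k * g k)"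
    using support_list[OF assms] by metis
  show ?thesis
    using tree_bigoplusP[OF zs(2), of "\<lambda>k. PDirac (e k)"] den_bigoplusP[OF zs(2), of "\<lambda>k. PDirac (e k)"] zs(3)
    by (intro exI[of _ "bigoplusP (map (\<lambda>k. (\<mu> k, PDirac (e k))) zs)"]) (auto simp: lift_def)
qed

context
  fixes K :: "'k set" and e :: "'k \<Rightarrow> ('a, 'v::infinite) expE"
  assumes fK: "finite K"
begin

lemma absorbs_conv:
  assumes "absorbs K e a k \<rho>" "absorbs K e a k \<sigma>" "0 < p" "p < 1"
  shows "absorbs K e a k (\<lambda>x. p * \<rho> x + (1 - p) * \<sigma> x)"
proof -
  have d: "pdist K \<rho>" "pdist K \<sigma>" using assms by (auto simp: absorbs_def)
  obtain P Q where PQ: "tree P" "den P = lift K e \<rho>" "tree Q" "den Q = lift K e \<sigma>"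
    using ex_tree[OF fK] d by metis
  have "below (ESum (EPre a P) (EPre a Q)) (e k)" using assms PQ by (intro below_sumI absorbsD)
  then have "below (EPre a (PCh P p Q)) (e k)" using below_conv below_trans assms by blast
  moreover have "den (PCh P p Q) = lift K e (\<lambda>x. p * \<rho> x + (1 - p) * \<sigma> x)" using PQ by (auto simp: lift_lin)
  ultimately show ?thesis using PQ assms d by (intro absorbsI[where P = "PCh P p Q"] pdist_conv) auto
qed

text \<open>Each \<open>e j\<close> in the support may be rewritten to \<open>e j + a.P j\<close>;
  then \<open>ax_tau3\<close> yields the combined \<open>a\<close>-summand.\<close>

lemma absorbs_tau3:
  assumes \<nu>: "absorbs K e Tau k \<nu>" and w: "\<And>j. j \<in> K \<Longrightarrow> 0 < \<nu> j \<Longrightarrow> absorbs K e a j (w j)"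
  shows "absorbs K e a k (\<lambda>x. \<Sum>j\<in>K. \<nu> j * w j x)"
proof -
  have d: "pdist K \<nu>" using \<nu> by (simp add: absorbs_def)
  obtain zs where zs: "set zs = {k \<in> K. 0 < \<nu> k}" "weights (map \<nu> zs)"
    "\<And>g :: _ \<Rightarrow> real. (\<Sum>z\<leftarrow>zs. \<nu> z * g z) = (\<Sum>k\<in>K. \<nu> k * g k)"
    using support_list[OF fK d] by metis
  have "\<forall>j\<in>set zs. \<exists>P. tree P \<and> den P = lift K e (w j)" using w zs(1) by (auto simp: absorbs_def intro: ex_tree[OF fK])
  then obtain P where P: "\<And>j. j \<in> set zs \<Longrightarrow> tree (P j)" "\<And>j. j \<in> set zs \<Longrightarrow> den (P j) = lift K e (w j)" by metis
  define B where "B = bigoplusP (map (\<lambda>j. (\<nu> j, PDirac (ESum (e j) (EPre a (P j))))) zs)"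
  define N where "N = bigoplusP (map (\<lambda>j. (\<nu> j, PDirac (e j))) zs)"
  define Q where "Q = bigoplusP (map (\<lambda>j. (\<nu> j, P j)) zs)"
  have "tree N" "den N = lift K e \<nu>"
    unfolding N_def by (auto simp: den_bigoplusP[OF zs(2)] zs(3) lift_def fun_eq_iff intro!: tree_bigoplusP[OF zs(2)])
  then have "below (EPre Tau N) (e k)" by (rule absorbsD[OF \<nu>])
  moreover have "eqE (EPre Tau B) (EPre Tau N)" unfolding B_def N_def
  proof (intro tau_leaves_eq tau_leaves_bigoplusP zs(2) tau_leaves.same)
    fix j assume "j \<in> set zs"
    then show "eqE (ESum (e j) (EPre a (P j))) (e j)"
      using absorbsD[OF w] P zs(1) by (simp add: below_def)
  qed
  moreover have "below (EPre a Q) (EPre Tau B)"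
    using ax_tau3[of "map (\<lambda>j. (\<nu> j, e j, P j)) zs" a] zs(2)
    by (simp add: below_def B_def Q_def bigoplus_def o_def)
  ultimately have "below (EPre a Q) (e k)" using below_trans below_cong reflE by metis
  moreover have "tree Q" unfolding Q_def using P by (intro tree_bigoplusP[OF zs(2)])
  moreover have "den Q = lift K e (\<lambda>x. \<Sum>j\<in>K. \<nu> j * w j x)"
  proof
    fix x
    have "den Q x = (\<Sum>j\<leftarrow>zs. \<nu> j * lift K e (w j) x)"
      unfolding Q_def den_bigoplusP[OF zs(2)] using P by (intro arg_cong[where f = sum_list] map_cong) auto
    then show "den Q x = lift K e (\<lambda>x. \<Sum>j\<in>K. \<nu> j * w j x) x" by (simp add: zs(3) lift_sum)
  qed
  moreover have "pdist K (\<lambda>x. \<Sum>j\<in>K. \<nu> j * w j x)"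
    using w by (intro pdist_sum fK d) (auto simp: absorbs_def)
  ultimately show ?thesis by (intro absorbsI)
qed

lemma absorbs_tau2:
  assumes \<nu>: "absorbs K e Tau k \<nu>" and F: "\<And>j. j \<in> K \<Longrightarrow> 0 < \<nu> j \<Longrightarrow> below F (e j)"
  shows "below F (e k)"
proof -
  have d: "pdist K \<nu>" using \<nu> by (simp add: absorbs_def)
  obtain zs where zs: "set zs = {k \<in> K. 0 < \<nu> k}" "weights (map \<nu> zs)"
    "\<And>g :: _ \<Rightarrow> real. (\<Sum>z\<leftarrow>zs. \<nu> z * g z) = (\<Sum>k\<in>K. \<nu> k * g k)"
    using support_list[OF fK d] by metis
  define B where "B = bigoplusP (map (\<lambda>j. (\<nu> j, PDirac (ESum (e j) F))) zs)"
  define N where "N = bigoplusP (map (\<lambda>j. (\<nu> j, PDirac (e j))) zs)"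
  have "tree N" "den N = lift K e \<nu>"
    unfolding N_def by (auto simp: den_bigoplusP[OF zs(2)] zs(3) lift_def fun_eq_iff intro!: tree_bigoplusP[OF zs(2)])
  then have "below (EPre Tau N) (e k)" by (rule absorbsD[OF \<nu>])
  moreover have "eqE (EPre Tau B) (EPre Tau N)" unfolding B_def N_def
    using F zs(1) by (intro tau_leaves_eq tau_leaves_bigoplusP zs(2) tau_leaves.same) (auto simp: below_def)
  moreover have "below F (EPre Tau B)"
    using ax_tau2[of "map (\<lambda>j. (\<nu> j, e j)) zs" F] zs(2)
    by (simp add: below_def B_def bigoplus_def o_def)
  ultimately show ?thesis using below_trans below_cong reflE by metis
qed

text \<open>The mass at the state \<open>k\<close> is split off as one leaf \<open>e k\<close>, even
  if other states carry the same expression, and \<open>below_loop\<close> discards it. What remains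
  is \<open>\<rho>\<close> conditioned on leaving \<open>k\<close>.\<close>

lemma absorbs_loop:
  assumes \<rho>: "absorbs K e Tau k \<rho>" and l: "\<rho> k < 1"
  shows "absorbs K e Tau k (\<lambda>x. if x = k then 0 else \<rho> x / (1 - \<rho> k))"
proof (cases "\<rho> k = 0")
  case True
  then have "(\<lambda>x. if x = k then 0 else \<rho> x / (1 - \<rho> k)) = \<rho>" by auto
  then show ?thesis using \<rho> by simp
next
  case False
  have d: "pdist K \<rho>" using \<rho> by (simp add: absorbs_def)
  then have k: "k \<in> K" and pos: "0 < \<rho> k" using False pdistD[OF d] by (auto simp: less_le)
  define \<sigma> where "\<sigma> = (\<lambda>x. if x = k then 0 else \<rho> x / (1 - \<rho> k))"
  have \<sigma>: "\<rho> = (\<lambda>x. \<rho> k * dirac k x + (1 - \<rho> k) * \<sigma> x)" using l by (auto simp: \<sigma>_def dirac_def)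
  have "sum \<rho> K = \<rho> k * sum (dirac k) K + (1 - \<rho> k) * sum \<sigma> K"
    by (subst \<sigma>) (simp add: sum.distrib sum_distrib_left)
  then have "(1 - \<rho> k) * sum \<sigma> K = 1 - \<rho> k"
    unfolding pdistD(3)[OF d] pdistD(3)[OF pdist_dirac[OF fK k]] by linarith
  then have d\<sigma>: "pdist K \<sigma>" using l pdistD(1,2)[OF d] by (auto simp: pdist_def \<sigma>_def)
  obtain N where N: "tree N" "den N = lift K e \<sigma>" using ex_tree[OF fK d\<sigma>] by metis
  have "den (PCh (PDirac (e k)) (\<rho> k) N) = lift K e \<rho>"
  proof
    fix x
    have "lift K e \<rho> x = \<rho> k * lift K e (dirac k) x + (1 - \<rho> k) * lift K e \<sigma> x"
      by (subst \<sigma>) (rule lift_lin)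
    then show "den (PCh (PDirac (e k)) (\<rho> k) N) x = lift K e \<rho> x" using N by (simp add: lift_dirac[OF fK k])
  qed
  then have "below (EPre Tau (PCh (PDirac (e k)) (\<rho> k) N)) (e k)" using \<rho> N pos l by (intro absorbsD) auto
  then have "below (EPre Tau N) (e k)" using below_loop pos l by blast
  then show ?thesis using absorbsI[OF d\<sigma> N] by (simp add: \<sigma>_def)
qed

text \<open>Every state is split into a copy that moves and a copy that stays. A moving leaf is
  rewritten to \<open>e j + \<tau>.P j\<close> by absorption, a staying one to
  \<open>0 + \<tau>.e j\<close> by \<open>ax_tau1\<close>; then all leaves have the shape required
  by \<open>ax_tau4\<close>.\<close>

lemma absorbs_tau4:
  assumes \<nu>: "absorbs K e a k \<nu>" and w: "\<And>j. j \<in> K \<Longrightarrow> stay_or (absorbs K e Tau) j (w j)"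
  shows "absorbs K e a k (\<lambda>x. \<Sum>j\<in>K. \<nu> j * w j x)"
proof -
  have d: "pdist K \<nu>" using \<nu> by (simp add: absorbs_def)
  have "\<forall>j\<in>K. \<exists>h. 0 \<le> fst h \<and> fst h \<le> 1 \<and> (fst h = 0 \<or> absorbs K e Tau j (snd h)) \<and>
      w j = (\<lambda>x. (1 - fst h) * dirac j x + fst h * snd h x)"
    using w by (auto simp: stay_or_def)
  from bchoice[OF this] obtain h where h: "\<forall>j\<in>K. 0 \<le> fst (h j) \<and> fst (h j) \<le> 1 \<and>
      (fst (h j) = 0 \<or> absorbs K e Tau j (snd (h j))) \<and>
      w j = (\<lambda>x. (1 - fst (h j)) * dirac j x + fst (h j) * snd (h j) x)" by blast
  define q where "q j = fst (h j)" for j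
  define \<sigma> where "\<sigma> j = snd (h j)" for j
  have q: "\<And>j. j \<in> K \<Longrightarrow> 0 \<le> q j" "\<And>j. j \<in> K \<Longrightarrow> q j \<le> 1" "\<And>j. j \<in> K \<Longrightarrow> q j = 0 \<or> absorbs K e Tau j (\<sigma> j)"
      "\<And>j. j \<in> K \<Longrightarrow> w j = (\<lambda>x. (1 - q j) * dirac j x + q j * \<sigma> j x)"
    using h by (auto simp: q_def \<sigma>_def)
  \<comment> \<open>The second component of \<open>u\<close> is \<open>True\<close> for the moving
    copy.\<close>
  define wt where "wt u = (if fst u \<in> K then \<nu> (fst u) * (if snd u then q (fst u) else 1 - q (fst u)) else 0)" for u
  have sumb: "(\<Sum>u\<in>K \<times> UNIV. wt u * g u) = (\<Sum>j\<in>K. \<nu> j * ((1 - q j) * g (j, False) + q j * g (j, True)))" for g :: "_ \<Rightarrow> real"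
  proof -
    have "(\<Sum>u\<in>K \<times> UNIV. wt u * g u) = (\<Sum>j\<in>K. \<Sum>b\<in>UNIV. wt (j, b) * g (j, b))"
      by (simp add: sum.cartesian_product)
    then show ?thesis by (simp add: UNIV_bool wt_def algebra_simps cong: sum.cong)
  qed
  have "pdist (K \<times> UNIV) wt"
    using sumb[of "\<lambda>_. 1"] q(1,2) pdistD[OF d] by (auto simp: pdist_def wt_def)
  then obtain us where us: "set us = {u \<in> K \<times> UNIV. 0 < wt u}" "weights (map wt us)"
    "\<And>g :: _ \<Rightarrow> real. (\<Sum>z\<leftarrow>us. wt z * g z) = (\<Sum>k\<in>K \<times> UNIV. wt k * g k)"
    using support_list[of "K \<times> UNIV" wt] fK by auto
  have "\<forall>j. \<exists>P. absorbs K e Tau j (\<sigma> j) \<longrightarrow> tree P \<and> den P = lift K e (\<sigma> j)"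
    using ex_tree[OF fK] by (metis absorbs_def)
  then obtain P where P: "\<And>j. absorbs K e Tau j (\<sigma> j) \<Longrightarrow> tree (P j)" "\<And>j. absorbs K e Tau j (\<sigma> j) \<Longrightarrow> den (P j) = lift K e (\<sigma> j)" by metis
  have usD: "fst u \<in> K" "snd u \<Longrightarrow> absorbs K e Tau (fst u) (\<sigma> (fst u))" if "u \<in> set us" for u
    using that us(1) q(3)[of "fst u"] by (auto simp: wt_def split: if_splits)
  define L where "L u = (if snd u then e (fst u) else ENil)" for u
  define M where "M u = (if snd u then P (fst u) else PDirac (e (fst u)))" for u
  define B where "B = bigoplusP (map (\<lambda>u. (wt u, PDirac (ESum (L u) (EPre Tau (M u))))) us)"
  define N where "N = bigoplusP (map (\<lambda>u. (wt u, PDirac (e (fst u)))) us)"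
  define Q where "Q = bigoplusP (map (\<lambda>u. (wt u, M u)) us)"
  have "tree N" "den N = lift K e \<nu>"
    unfolding N_def
    by (auto simp: den_bigoplusP[OF us(2)] lift_def us(3) sumb algebra_simps fun_eq_iff intro!: tree_bigoplusP[OF us(2)])
  then have "below (EPre a N) (e k)" by (rule absorbsD[OF \<nu>])
  moreover have "eqE (EPre a B) (EPre a N)" unfolding B_def N_def
  proof (intro tau_leaves_eq tau_leaves_bigoplusP us(2))
    fix u assume u: "u \<in> set us"
    show "tau_leaves (PDirac (ESum (L u) (EPre Tau (M u)))) (PDirac (e (fst u)))"
    proof (cases "snd u")
      case True
      then have "below (EPre Tau (P (fst u))) (e (fst u))" by (intro absorbsD[OF usD(2)[OF u]] P usD(2)[OF u])
      then show ?thesis using True by (intro tau_leaves.same) (simp add: L_def M_def below_def)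
    next
      case False
      then show ?thesis using eqE_nil_left by (intro tau_leaves.tau) (simp add: L_def M_def)
    qed
  qed
  moreover have "below (EPre a Q) (EPre a B)"
    using ax_tau4[of "map (\<lambda>u. (wt u, L u, M u)) us" a] us(2)
    by (simp add: below_def B_def Q_def bigoplus_def o_def)
  ultimately have "below (EPre a Q) (e k)" using below_trans below_cong reflE by metis
  moreover have "tree Q" unfolding Q_def using P usD by (intro tree_bigoplusP[OF us(2)]) (auto simp: M_def)
  moreover have "den Q = lift K e (\<lambda>x. \<Sum>j\<in>K. \<nu> j * w j x)"
  proof
    fix x
    have "den Q x = (\<Sum>u\<leftarrow>us. wt u * (if snd u then lift K e (\<sigma> (fst u)) x else dirac (e (fst u)) x))"
      unfolding Q_def den_bigoplusP[OF us(2)] using P usD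
      by (intro arg_cong[where f = sum_list] map_cong) (auto simp: M_def)
    also have "\<dots> = (\<Sum>j\<in>K. \<nu> j * ((1 - q j) * dirac (e j) x + q j * lift K e (\<sigma> j) x))"
      by (simp add: us(3) sumb)
    also have "\<dots> = (\<Sum>j\<in>K. \<nu> j * lift K e (w j) x)"
      by (intro sum.cong refl) (simp add: q(4) lift_lin lift_dirac[OF fK])
    finally show "den Q x = lift K e (\<lambda>x. \<Sum>j\<in>K. \<nu> j * w j x) x" by (simp add: lift_sum)
  qed
  moreover have "pdist K (\<lambda>x. \<Sum>j\<in>K. \<nu> j * w j x)"
  proof (intro pdist_sum fK d)
    fix j assume j: "j \<in> K"
    show "pdist K (w j)"
    proof (cases "q j = 0")
      case True then show ?thesis using q(4)[OF j] pdist_dirac[OF fK j] by simp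
    next
      case False
      then have "pdist K (\<sigma> j)" using q(3)[OF j] by (simp add: absorbs_def)
      then show ?thesis using pdist_conv[OF pdist_dirac[OF fK j], of "\<sigma> j" "1 - q j"] q(1,2,4)[OF j] by simp
    qed
  qed
  ultimately show ?thesis by (intro absorbsI)
qed

lemma absorption_absorbs: "absorption K (absorbs K e Tau)"
  using absorbs_conv absorbs_tau4 absorbs_loop fK
  by unfold_locales (auto simp: absorbs_def[of K e Tau, THEN iffD1])

context
  fixes G :: "('k \<times> ('k \<Rightarrow> real)) set"
  assumes G: "transitions K G" "circulation_free G"
    and absG: "\<And>t. t \<in> G \<Longrightarrow> absorbs K e Tau (fst t) (snd t)"
begin

lemma flow_stay_or:
  assumes k: "k \<in> K" and \<mu>: "flow G (dirac k) \<mu>" "\<And>x. 0 \<le> \<mu> x"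
  shows "stay_or (absorbs K e Tau) k \<mu>"
proof -
  have "dirac k x = 0" if "x \<notin> K" for x using that k by (auto simp: dirac_def)
  then obtain w where w: "\<And>j. j \<in> K \<Longrightarrow> stay_or (absorbs K e Tau) j (w j)" "\<And>x. \<mu> x = (\<Sum>j\<in>K. dirac k j * w j x)"
    using absorption.flow_absorbed[OF absorption_absorbs G absG _ \<mu>(2,1)] by blast
  have "\<mu> x = w k x" for x
  proof -
    have "\<mu> x = (\<Sum>j\<in>K. if j = k then w k x else 0)"
      unfolding w(2) by (intro sum.cong refl) (auto simp: dirac_def)
    then show ?thesis using fK k by simp
  qed
  then have "\<mu> = w k" by auto
  then show ?thesis using w(1)[OF k] by simp
qed

text \<open>If all mass moves, \<open>ax_tau2\<close> applies. Otherwise some mass remains at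
  \<open>k\<close>, and \<open>k\<close> is itself one of the states for which \<open>F\<close> is
  assumed to be a summand.\<close>

lemma flow_below:
  assumes k: "k \<in> K" and \<mu>: "flow G (dirac k) \<mu>" "\<And>x. 0 \<le> \<mu> x"
    and F: "\<And>j. j \<in> K \<Longrightarrow> 0 < \<mu> j \<Longrightarrow> below F (e j)"
  shows "below F (e k)"
proof -
  obtain q \<sigma> where q: "0 \<le> q" "q \<le> 1" "q = 0 \<or> absorbs K e Tau k \<sigma>" "\<mu> = (\<lambda>x. (1 - q) * dirac k x + q * \<sigma> x)"
    using flow_stay_or[OF k \<mu>] by (auto simp: stay_or_def)
  show ?thesis
  proof (cases "q = 1")
    case True
    then have "absorbs K e Tau k \<mu>" using q by simp
    then show ?thesis using absorbs_tau2 F by blast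
  next
    case False
    have "0 \<le> q * \<sigma> k" using q(1,3) by (auto simp: absorbs_def pdistD)
    then have "0 < \<mu> k" using False q(1,2,4) by simp
    then show ?thesis using F k by blast
  qed
qed

text \<open>The mass that moves before the step is handled by \<open>absorbs_tau3\<close>, the mass
  that stays by the transitions of \<open>k\<close> itself. Convexity joins both parts, and
  \<open>absorbs_tau4\<close> appends the final flow.\<close>

lemma weak_absorbs:
  assumes H: "transitions K H" and absH: "\<And>t. t \<in> H \<Longrightarrow> absorbs K e a (fst t) (snd t)"
    and k: "k \<in> K" and weak: "weak G H (dirac k) \<mu>"
  shows "absorbs K e a k \<mu>"
proof -
  interpret H: transitions K H by (rule H)
  obtain g where g: "\<And>t. t \<in> H \<Longrightarrow> 0 \<le> g t" "flow G (dirac k) (srcm H g)" "flow G (tgtm H g) \<mu>" "\<And>x. 0 \<le> \<mu> x"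
    using weak unfolding weak_def move_def by blast
  define N where "N j = {t \<in> H. fst t = j}" for j
  have fN: "finite (N j)" for j using H.finG by (simp add: N_def)
  \<comment> \<open>The average step taken at \<open>j\<close>. Where none is taken, the quotient is
    0, and it is always multiplied by the mass 0.\<close>
  define v where "v j = (\<lambda>x. (\<Sum>t\<in>N j. g t * snd t x) / sum g (N j))" for j
  have src: "srcm H g j = sum g (N j)" for j
  proof -
    have "srcm H g j = (\<Sum>t\<in>H. if fst t = j then g t else 0)"
      unfolding srcm_def by (intro sum.cong refl) (auto simp: dirac_def)
    then show ?thesis using H.finG by (simp add: N_def sum.inter_filter)
  qed
  have absv: "absorbs K e a j (v j)" if pos: "0 < sum g (N j)" for j
  proof -
    \<comment> \<open>\<open>convex_sum\<close> needs positive weights, so transitions that are not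
      taken are dropped.\<close>
    define M where "M = {t \<in> N j. 0 < g t}"
    have drop: "(\<Sum>t\<in>M. g t * h t) = (\<Sum>t\<in>N j. g t * h t)" for h :: "_ \<Rightarrow> real"
      using fN g(1) by (intro sum.mono_neutral_left) (auto simp: M_def N_def less_le)
    have M: "sum g M = sum g (N j)" using drop[of "\<lambda>_. 1"] by simp
    have "absorbs K e a j (\<lambda>x. (\<Sum>t\<in>M. g t * snd t x) / sum g M)"
    proof (rule convex_sum[where R = "absorbs K e a j"])
      show "finite M" using fN by (simp add: M_def)
      show "M \<noteq> {}" using pos M by auto
      show "absorbs K e a j (snd t)" if "t \<in> M" for t using that absH by (auto simp: M_def N_def)
    qed (auto simp: M_def intro: absorbs_conv)
    then show ?thesis by (simp add: v_def M drop)
  qed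
  have tgt: "tgtm H g x = (\<Sum>j\<in>K. srcm H g j * v j x)" for x
  proof -
    have "tgtm H g x = (\<Sum>j\<in>K. \<Sum>t\<in>N j. g t * snd t x)"
      unfolding tgtm_def N_def using H.finG fK H.src by (intro sum.group[symmetric]) auto
    also have "\<dots> = (\<Sum>j\<in>K. srcm H g j * v j x)"
    proof (intro sum.cong refl)
      fix j
      show "(\<Sum>t\<in>N j. g t * snd t x) = srcm H g j * v j x"
      proof (cases "sum g (N j) = 0")
        case True
        then have "\<forall>t\<in>N j. g t = 0" using g(1) fN by (subst (asm) sum_nonneg_eq_0_iff) (auto simp: N_def)
        then show ?thesis by (simp add: src)
      next
        case False
        then show ?thesis by (simp add: src v_def)
      qed
    qed
    finally show ?thesis .
  qed
  have "stay_or (absorbs K e Tau) k (srcm H g)"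
    using g(1,2) H.srcm_nonneg by (intro flow_stay_or[OF k]) auto
  then obtain q \<sigma> where q: "0 \<le> q" "q \<le> 1" "q = 0 \<or> absorbs K e Tau k \<sigma>"
      "srcm H g = (\<lambda>x. (1 - q) * dirac k x + q * \<sigma> x)"
    by (auto simp: stay_or_def)
  have \<sigma>0: "0 \<le> q * \<sigma> j" for j using q(1,3) by (auto simp: absorbs_def pdistD)
  have "(\<Sum>j\<in>K. dirac k j * v j x) = (\<Sum>j\<in>K. if j = k then v k x else 0)" for x
    by (intro sum.cong refl) (auto simp: dirac_def)
  then have dv: "(\<Sum>j\<in>K. dirac k j * v j x) = v k x" for x using fK k by simp
  have mix: "tgtm H g = (\<lambda>x. (1 - q) * v k x + q * (\<Sum>j\<in>K. \<sigma> j * v j x))"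
  proof
    fix x
    have "tgtm H g x = (\<Sum>j\<in>K. (1 - q) * (dirac k j * v j x) + q * (\<sigma> j * v j x))"
      unfolding tgt q(4) by (intro sum.cong refl) (simp add: algebra_simps)
    then show "tgtm H g x = (1 - q) * v k x + q * (\<Sum>j\<in>K. \<sigma> j * v j x)"
      unfolding sum.distrib sum_distrib_left[symmetric] dv .
  qed
  have left: "absorbs K e a k (v k)" if "q < 1"
  proof (rule absv)
    have "0 < srcm H g k" unfolding q(4) using that \<sigma>0[of k] by simp
    then show "0 < sum g (N k)" by (simp add: src)
  qed
  have right: "absorbs K e a k (\<lambda>x. \<Sum>j\<in>K. \<sigma> j * v j x)" if "0 < q"
  proof (rule absorbs_tau3)
    show "absorbs K e Tau k \<sigma>" using q(3) that by auto
    fix j assume "0 < \<sigma> j"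
    then have "0 < q * \<sigma> j" using that by simp
    then have "0 < srcm H g j" unfolding q(4) using q(2) by (intro add_nonneg_pos) auto
    then show "absorbs K e a j (v j)" by (intro absv) (simp add: src)
  qed
  have \<nu>: "absorbs K e a k (tgtm H g)"
  proof -
    consider "q = 0" | "q = 1" | "0 < q" "q < 1" using q(1,2) by linarith
    then show ?thesis
    proof cases
      case 1 then show ?thesis using left mix by simp
    next
      case 2 then show ?thesis using right mix by simp
    next
      case 3
      then show ?thesis using absorbs_conv[OF left right, of "1 - q"] mix by simp
    qed
  qed
  then have "tgtm H g x = 0" if "x \<notin> K" for x using that by (auto simp: absorbs_def pdistD)
  then obtain w where w: "\<And>j. j \<in> K \<Longrightarrow> stay_or (absorbs K e Tau) j (w j)" "\<And>x. \<mu> x = (\<Sum>j\<in>K. tgtm H g j * w j x)"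
    using absorption.flow_absorbed[OF absorption_absorbs G absG _ g(4,3)] by blast
  have "\<mu> = (\<lambda>x. \<Sum>j\<in>K. tgtm H g j * w j x)" using w(2) by auto
  then show ?thesis using absorbs_tau4[OF \<nu> w(1)] by simp
qed

end

end

section \<open>Flows and the semantics of standard systems\<close>

definition trs :: "('a, 'v) eqsys \<Rightarrow> 'a act \<Rightarrow> (('a, 'v) expE \<times> (('a, 'v) expE \<Rightarrow> real)) set" where
  "trs S a = {(EVar (fst S ! i), \<mu>) | i \<mu>. i < length (fst S) \<and> step (snd S ! i) a \<mu>}"

abbreviation states :: "('a, 'v) eqsys \<Rightarrow> ('a, 'v) expE set" where
  "states S \<equiv> EVar ` set (fst S)"

fun prefixes :: "('a, 'v) expE \<Rightarrow> ('a act \<times> ('a, 'v) expP) set" where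
  "prefixes (EPre a P) = {(a, P)}"
| "prefixes (ESum E F) = prefixes E \<union> prefixes F"
| "prefixes _ = {}"

lemma finite_prefixes: "finite (prefixes E)"
  by (induction E rule: prefixes.induct) auto

inductive_cases step_SumE: "step (ESum E F) a \<mu>"
inductive_cases step_PreE: "step (EPre b P) a \<mu>"
inductive_cases step_NilE: "step ENil a \<mu>"
inductive_cases step_VarE: "step (EVar x) a \<mu>"

lemma step_stdsum: "stdsum Fm E \<Longrightarrow> step E a \<mu> \<longleftrightarrow> (\<exists>P. (a, P) \<in> prefixes E \<and> \<mu> = den P)"
  by (induction rule: stdsum.induct)
    (auto simp: pstep_iff_den intro: step.intros elim: step_SumE step_PreE step_NilE step_VarE)

lemma prefixes_fdist: "stdsum Fm E \<Longrightarrow> (a, P) \<in> prefixes E \<Longrightarrow> fdist Fm P"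
  by (induction rule: stdsum.induct) auto

lemma fdist_tree: "fdist Fm P \<Longrightarrow> tree P \<and> leaves P \<subseteq> EVar ` Fm \<and> fvP P \<subseteq> Fm"
  by (induction rule: fdist.induct) auto

lemma fdist_pdist:
  assumes "finite Fm" "fdist Fm P"
  shows "pdist (EVar ` Fm) (den P)"
  using assms fdist_tree[OF assms(2)] den_zero_iff[of P] den_nonneg[of P] den_sum[of P "EVar ` Fm"]
  by (auto simp: pdist_def)

lemma below_prefix:
  "stdsum Fm E \<Longrightarrow> (a, P) \<in> prefixes E \<Longrightarrow> below (EPre a (substP \<sigma> P)) (substE \<sigma> E)"
proof (induction rule: stdsum.induct)
  case (4 E F)
  then show ?case
    using below_trans below_sum_left[of "substE \<sigma> E" "substE \<sigma> F"] below_sum_right[of "substE \<sigma> F" "substE \<sigma> E"]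
    by auto
qed (auto intro: below_refl)

lemma below_var:
  "stdsum Fm E \<Longrightarrow> V \<in> fvE E \<Longrightarrow> V \<notin> Fm \<Longrightarrow> below (\<sigma> V) (substE \<sigma> E)"
proof (induction rule: stdsum.induct)
  case (2 P a)
  then show ?case using fdist_tree[OF 2(1)] by auto
next
  case (4 E F)
  then show ?case
    using below_trans below_sum_left[of "substE \<sigma> E" "substE \<sigma> F"] below_sum_right[of "substE \<sigma> F" "substE \<sigma> E"]
    by auto
qed (auto intro: below_refl)

lemma standardD:
  assumes "standard S"
  shows "distinct (fst S)" "length (snd S) = length (fst S)"
    "i < length (fst S) \<Longrightarrow> stdsum (set (fst S)) (snd S ! i)"
  using assms by (auto simp: standard_def eqsys_def)

lemma transitions_trs:
  assumes "standard S"
  shows "transitions (states S) (trs S a)"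
proof
  show "finite (states S)" by simp
  have "trs S a \<subseteq> (\<Union>i<length (fst S). (\<lambda>(b, P). (EVar (fst S ! i), den P)) ` prefixes (snd S ! i))"
    using standardD(3)[OF assms] by (force simp: trs_def step_stdsum)
  moreover have "finite (\<Union>i<length (fst S). (\<lambda>(b, P). (EVar (fst S ! i), den P)) ` prefixes (snd S ! i))"
    by (auto intro: finite_prefixes)
  ultimately show "finite (trs S a)" by (rule finite_subset)
  fix t assume "t \<in> trs S a"
  then obtain i \<mu> where t: "t = (EVar (fst S ! i), \<mu>)" "i < length (fst S)" "step (snd S ! i) a \<mu>"
    by (auto simp: trs_def)
  then show "fst t \<in> states S" by simp
  obtain P where "(a, P) \<in> prefixes (snd S ! i)" "\<mu> = den P"
    using t(3) step_stdsum[OF standardD(3)[OF assms t(2)]] by blast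
  then show "pdist (states S) (snd t)"
    using prefixes_fdist[OF standardD(3)[OF assms t(2)]] fdist_pdist t(1) by auto
qed

section \<open>Combined transitions and derivations as flows\<close>

lemma move_single:
  assumes "finite H" "t \<in> H"
  shows "move H (dirac (fst t)) (snd t)"
proof -
  let ?f = "\<lambda>s. if s = t then 1 else 0 :: real"
  have "srcm H ?f x = (\<Sum>s\<in>H. if s = t then dirac (fst t) x else 0)" "tgtm H ?f x = (\<Sum>s\<in>H. if s = t then snd t x else 0)" for x
    unfolding srcm_def tgtm_def by (intro sum.cong refl; auto)+
  then show ?thesis unfolding move_def using assms by (intro exI[of _ ?f]) auto
qed

lemma ctrans_move:
  assumes "standard S" "ctrans S \<nu> a \<mu>"
  shows "move (trs S a) \<nu> \<mu>"
  using assms(2)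
proof (induction rule: ctrans.induct)
  case (base i a \<mu>)
  have "(EVar (fst S ! i), \<mu>) \<in> trs S a" using base by (auto simp: trs_def)
  then show ?case using move_single[OF transitions.finG[OF transitions_trs[OF assms(1)]]] by fastforce
next
  case (comb I \<nu> a \<mu> p)
  then show ?case by (intro move_sum) auto
qed

lemma move_ctrans:
  assumes "standard S" "\<And>t. t \<in> trs S a \<Longrightarrow> 0 \<le> f t" "sum f (trs S a) \<le> 1"
  shows "ctrans S (srcm (trs S a) f) a (tgtm (trs S a) f)"
proof -
  let ?H = "trs S a"
  have fin: "finite ?H" using transitions.finG[OF transitions_trs[OF assms(1)]] .
  obtain h where h: "bij_betw h {..<card ?H} ?H" using ex_bij_betw_nat_finite[OF fin] by (auto simp: atLeast0LessThan)
  have hH: "h i \<in> ?H" if "i < card ?H" for i using h that bij_betwE by blast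
  have "ctrans S (dirac (fst t)) a (snd t)" if "t \<in> ?H" for t
    using that by (auto simp: trs_def intro: ctrans.base)
  then have "ctrans S (\<lambda>x. \<Sum>i\<in>{..<card ?H}. f (h i) * dirac (fst (h i)) x) a (\<lambda>x. \<Sum>i\<in>{..<card ?H}. f (h i) * snd (h i) x)"
    using hH assms(2,3) sum.reindex_bij_betw[OF h, of f] by (intro ctrans.comb) auto
  moreover have "(\<Sum>i\<in>{..<card ?H}. f (h i) * dirac (fst (h i)) x) = srcm ?H f x"
    "(\<Sum>i\<in>{..<card ?H}. f (h i) * snd (h i) x) = tgtm ?H f x" for x
    unfolding srcm_def tgtm_def by (rule sum.reindex_bij_betw[OF h])+
  ultimately show ?thesis by simp
qed

text \<open>The counts of the first \<open>N\<close> steps form a flow from \<open>\<nu>\<close> to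
  a nonnegative measure, so \<open>flow_bounded\<close> makes them converge. The limit is a flow to
  \<open>\<mu>\<close>, because the mass still moving tends to 0.\<close>

lemma wtrans_flow:
  assumes S: "standard S" and cf: "circulation_free (trs S Tau)" and w: "wtrans S \<nu> \<mu>"
  shows "flow (trs S Tau) \<nu> \<mu>" "0 \<le> \<mu> x"
proof -
  let ?G = "trs S Tau"
  interpret transitions "states S" ?G by (rule transitions_trs[OF S])
  obtain mto mx where der: "derivation S mto mx" and \<nu>: "\<nu> = (\<lambda>x. mto 0 x + mx 0 x)"
      and sm: "\<And>x. (\<lambda>i. mx i x) sums \<mu> x"
    using w unfolding wtrans_def by blast
  have nn: "0 \<le> mto i x" "0 \<le> mx i x" for i x using der by (auto simp: derivation_def subdist_def)
  then show "0 \<le> \<mu> x" using sums_le[OF _ sums_zero sm] by blast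
  have "\<forall>i. \<exists>f. (\<forall>t\<in>?G. 0 \<le> f t) \<and> mto i = srcm ?G f \<and> (\<lambda>x. mto (Suc i) x + mx (Suc i) x) = tgtm ?G f"
    using der ctrans_move[OF S] unfolding derivation_def move_def by blast
  then obtain g where g: "\<And>i t. t \<in> ?G \<Longrightarrow> 0 \<le> g i t" "\<And>i. mto i = srcm ?G (g i)"
      "\<And>i. (\<lambda>x. mto (Suc i) x + mx (Suc i) x) = tgtm ?G (g i)"
    by metis
  define F where "F N t = (\<Sum>i\<in>{..<N}. 1 * g i t)" for N t
  \<comment> \<open>After \<open>N\<close> steps the share \<open>mx N\<close> has already stopped
    while \<open>mto N\<close> is still to move; hence the upper limit \<open>Suc N\<close>.\<close>
  have part: "\<nu> x - net ?G (F N) x = mto N x + (\<Sum>i<Suc N. mx i x)" for N x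
  proof (induction N)
    case 0
    show ?case by (simp add: \<nu> F_def net_def srcm_def tgtm_def)
  next
    case (Suc N)
    have "net ?G (F (Suc N)) x = net ?G (F N) x + net ?G (g N) x"
      unfolding F_def net_sum by simp
    moreover have "net ?G (g N) x = mto N x - (mto (Suc N) x + mx (Suc N) x)"
      unfolding net_def g(2)[symmetric] g(3)[symmetric] ..
    ultimately show ?case using Suc by simp
  qed
  obtain B where B: "\<And>f t. (\<forall>t\<in>?G. 0 \<le> f t) \<Longrightarrow> (\<forall>x. 0 \<le> \<nu> x - net ?G f x) \<Longrightarrow> t \<in> ?G \<Longrightarrow> f t \<le> B"
    using flow_bounded[OF cf, of \<nu>] by blast
  have sum_g: "summable (\<lambda>i. g i t)" if t: "t \<in> ?G" for t
  proof (rule summableI_nonneg_bounded)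
    show "0 \<le> g i t" for i using g(1) t .
    show "(\<Sum>i<N. g i t) \<le> B" for N
    proof -
      have "F N t \<le> B"
      proof (rule B[OF _ _ t])
        show "\<forall>t\<in>?G. 0 \<le> F N t" using g(1) by (auto simp: F_def intro: sum_nonneg)
        show "\<forall>x. 0 \<le> \<nu> x - net ?G (F N) x"
          unfolding part using nn by (intro allI add_nonneg_nonneg sum_nonneg) auto
      qed
      then show ?thesis by (simp add: F_def)
    qed
  qed
  define f where "f t = (\<Sum>i. g i t)" for t
  have limF: "(\<lambda>N. F N t) \<longlonglongrightarrow> f t" if "t \<in> ?G" for t
    unfolding F_def f_def using summable_LIMSEQ[OF sum_g[OF that]] by simp
  have lim1: "(\<lambda>N. \<nu> x - net ?G (F N) x) \<longlonglongrightarrow> \<nu> x - net ?G f x" for x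
    unfolding net_def srcm_def tgtm_def by (intro tendsto_intros limF)
  have "(\<lambda>N. srcm ?G (g N) x) \<longlonglongrightarrow> (\<Sum>t\<in>?G. 0 * dirac (fst t) x)" for x
    unfolding srcm_def by (intro tendsto_intros summable_LIMSEQ_zero sum_g)
  then have "(\<lambda>N. mto N x) \<longlonglongrightarrow> 0" for x by (simp add: g(2))
  moreover have "(\<lambda>N. \<Sum>i<Suc N. mx i x) \<longlonglongrightarrow> \<mu> x" for x
    using sm[of x] unfolding sums_def by (rule LIMSEQ_Suc)
  ultimately have lim2: "(\<lambda>N. mto N x + (\<Sum>i<Suc N. mx i x)) \<longlonglongrightarrow> 0 + \<mu> x" for x
    by (intro tendsto_add)
  have "\<mu> x = \<nu> x - net ?G f x" for x
    using LIMSEQ_unique[OF lim1[of x] lim2[of x, folded part]] by simp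
  moreover have "0 \<le> f t" if "t \<in> ?G" for t unfolding f_def using g(1) that sum_g by (intro suminf_nonneg)
  ultimately show "flow ?G \<nu> \<mu>" unfolding flow_def by blast
qed

lemma subdistI:
  fixes m :: "'e \<Rightarrow> real"
  assumes "finite K" "\<And>x. x \<notin> K \<Longrightarrow> m x = 0" "\<And>x. 0 \<le> m x" "sum m K \<le> 1"
  shows "subdist m"
proof -
  have "(m has_sum sum m K) UNIV"
    using has_sum_finite[OF assms(1), of m] assms(2) by (subst has_sum_cong_neutral[of K UNIV]) auto
  then show ?thesis using assms(3,4) by (auto simp: subdist_def has_sum_imp_summable infsumI)
qed

lemma ctrans_zero: "ctrans S (\<lambda>x. 0) a (\<lambda>x. 0)"
  using ctrans.comb[of "{}" S "\<lambda>_ _. 0" a "\<lambda>_ _. 0" "\<lambda>_. 0"] by simp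

lemma wtrans_dirac: "wtrans S (dirac y) (dirac y)"
proof -
  define mx where "mx i = (if i = 0 then dirac y else (\<lambda>x. 0))" for i :: nat
  have "subdist (dirac y)" by (rule subdistI[of "{y}"]) auto
  moreover have "subdist (\<lambda>x. 0)" by (rule subdistI[of "{}"]) auto
  ultimately have "derivation S (\<lambda>i x. 0) mx" unfolding derivation_def using ctrans_zero[of S Tau] by (auto simp: mx_def)
  moreover have "(\<lambda>i. mx i x) sums dirac y x" for x
    using sums_finite[of "{0}" "\<lambda>i. mx i x"] by (simp add: mx_def)
  moreover have "dirac y = (\<lambda>x. 0 + mx 0 x)" by (simp add: mx_def)
  ultimately show ?thesis unfolding wtrans_def by (intro exI[of _ "\<lambda>i x. 0"] exI[of _ mx]) simp
qed

text \<open>A circulation \<open>f\<close> is a stationary measure \<open>\<pi>\<close> of the Markov chain it induces.  The chain started in \<open>X\<close> and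
  stopped at its first return to \<open>X\<close> has expected occupation times at most \<open>\<pi> / \<pi>(X)\<close>, so it returns with
  probability one.\<close>
lemma guarded_circulation_free:
  assumes S: "standard S" and gd: "guarded S"
  shows "circulation_free (trs S Tau)"
proof (rule ccontr)
  let ?G = "trs S Tau" and ?K = "states S"
  interpret transitions ?K ?G by (rule transitions_trs[OF S])
  assume "\<not> circulation_free ?G"
  then obtain f t0 where f: "\<And>t. t \<in> ?G \<Longrightarrow> 0 \<le> f t" "\<And>x. net ?G f x = 0" "t0 \<in> ?G" "f t0 \<noteq> 0"
    unfolding circulation_free_def by blast
  define \<pi> where "\<pi> = srcm ?G f"
  have \<pi>tgt: "tgtm ?G f x = \<pi> x" for x using f(2)[of x] by (simp add: net_def \<pi>_def)
  have \<pi>0: "0 \<le> \<pi> x" for x unfolding \<pi>_def using f(1) by (rule srcm_nonneg)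
  have f\<pi>: "f t \<le> \<pi> (fst t)" if "t \<in> ?G" for t
    unfolding \<pi>_def srcm_def using member_le_sum[OF that _ finG, of "\<lambda>s. f s * dirac (fst s) (fst t)"] f(1) by simp
  define X where "X = fst t0"
  have XK: "X \<in> ?K" using src f(3) by (simp add: X_def)
  have \<pi>X: "0 < \<pi> X" using f\<pi>[OF f(3)] f(1)[OF f(3)] f(4) by (simp add: X_def)
  \<comment> \<open>The chain leaves \<open>fst t\<close> through \<open>t\<close> with probability
    \<open>f t / \<pi> (fst t)\<close>; \<open>run m t\<close> is the mass of \<open>m\<close> that
    takes \<open>t\<close>.\<close>
  define run where "run m t = m (fst t) * (f t / \<pi> (fst t))" for m t
  define nxt where "nxt m = tgtm ?G (run m)" for m
  define keep where "keep m = (\<lambda>x. if x = X then 0 else m x :: real)" for m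
  \<comment> \<open>The mass that has not yet returned to \<open>X\<close> after \<open>i\<close>
    steps, except that \<open>m 0\<close> is the start in \<open>X\<close> itself.\<close>
  define m where "m i = ((\<lambda>m. keep (nxt m)) ^^ i) (dirac X)" for i
  have m_0: "m 0 = dirac X" and m_Suc: "m (Suc i) = keep (nxt (m i))" for i by (simp_all add: m_def)
  have run0: "0 \<le> run k t" if "\<And>x. 0 \<le> k x" "t \<in> ?G" for k t
    using that f(1) \<pi>0 by (simp add: run_def)
  have nxt0: "0 \<le> nxt k x" if "\<And>x. 0 \<le> k x" for k x
    unfolding nxt_def using run0[OF that] by (rule tgtm_nonneg)
  have m0: "0 \<le> m i x" for i x
  proof (induction i arbitrary: x)
    case 0 then show ?case by (simp add: m_0)
  next
    case (Suc i) then show ?case using nxt0[of "m i"] by (simp add: m_Suc keep_def)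
  qed
  have nxt_sum: "nxt (\<lambda>x. \<Sum>i<N. m i x) x = (\<Sum>i<N. nxt (m i) x)" for N x
  proof -
    have "run (\<lambda>x. \<Sum>i<N. m i x) = (\<lambda>t. \<Sum>i\<in>{..<N}. 1 * run (m i) t)"
      unfolding run_def by (simp only: sum_distrib_right mult_1)
    then show ?thesis unfolding nxt_def using tgtm_sum[of ?G "\<lambda>_. 1" "\<lambda>i. run (m i)" "{..<N}" x] by simp
  qed
  \<comment> \<open>Stationarity makes one step of the chain map \<open>\<pi> / \<pi> X\<close> to
    itself, which carries the induction away from \<open>X\<close>; at \<open>X\<close> only the
    initial unit of mass is counted.\<close>
  have occ: "(\<Sum>i<N. m i x) \<le> \<pi> x / \<pi> X" for N x
  proof (induction N arbitrary: x)
    case 0 then show ?case using \<pi>0 by simp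
  next
    case (Suc N)
    have split: "(\<Sum>i<Suc N. m i x) = dirac X x + keep (nxt (\<lambda>x. \<Sum>i<N. m i x)) x"
      unfolding sum.lessThan_Suc_shift by (simp add: m_0 m_Suc keep_def nxt_sum)
    show ?case
    proof (cases "x = X")
      case True
      then show ?thesis using \<pi>X split by (simp add: keep_def)
    next
      case False
      have "run (\<lambda>x. \<Sum>i<N. m i x) t \<le> f t / \<pi> X" if t: "t \<in> ?G" for t
      proof -
        have "run (\<lambda>x. \<Sum>i<N. m i x) t \<le> \<pi> (fst t) / \<pi> X * (f t / \<pi> (fst t))"
          unfolding run_def using f(1)[OF t] \<pi>0 by (intro mult_right_mono Suc.IH) simp
        also have "\<dots> = f t / \<pi> X"
          using f\<pi>[OF t] f(1)[OF t] by (cases "\<pi> (fst t) = 0") auto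
        finally show ?thesis .
      qed
      then have "nxt (\<lambda>x. \<Sum>i<N. m i x) x \<le> (\<Sum>t\<in>?G. f t / \<pi> X * snd t x)"
        unfolding nxt_def tgtm_def using pdistD(1)[OF tgt] by (intro sum_mono mult_right_mono)
      also have "\<dots> = \<pi> x / \<pi> X" unfolding \<pi>tgt[symmetric] tgtm_def by (simp add: sum_divide_distrib)
      finally show ?thesis using False split by (simp add: keep_def)
    qed
  qed
  \<comment> \<open>States with \<open>\<pi> x = 0\<close> would lose mass in \<open>run\<close>,
    because of the division by zero; the bound shows that they are never occupied.\<close>
  have m_supp: "m i x = 0" if "\<pi> x = 0" for i x
  proof -
    have "(\<Sum>i<Suc i. m i x) = 0" using occ[of x "Suc i"] that m0 by (simp add: order_antisym sum_nonneg)
    then show ?thesis using m0 by (simp add: add_nonneg_eq_0_iff sum_nonneg)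
  qed
  have src_run: "srcm ?G (run (m i)) = m i" for i
  proof
    fix x
    have "srcm ?G (run (m i)) x = (\<Sum>t\<in>?G. m i x / \<pi> x * (f t * dirac (fst t) x))"
      unfolding srcm_def run_def by (intro sum.cong refl) (auto simp: dirac_def)
    also have "\<dots> = m i x / \<pi> x * \<pi> x" by (simp only: sum_distrib_left \<pi>_def srcm_def)
    also have "\<dots> = m i x" using m_supp by (cases "\<pi> x = 0") auto
    finally show "srcm ?G (run (m i)) x = m i x" .
  qed
  have mK: "m i x = 0" if "x \<notin> ?K" for i x using src_run[of i] srcm_outside[OF that] by metis
  have mass_nxt: "sum (nxt (m i)) ?K = sum (m i) ?K" for i
    unfolding nxt_def tgtm_total srcm_total[symmetric] src_run ..
  have mass_split: "sum (nxt (m i)) ?K = nxt (m i) X + sum (m (Suc i)) ?K" for i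
  proof -
    have "sum (m (Suc i)) ?K = sum (nxt (m i)) (?K - {X})"
      unfolding sum.remove[OF finK XK, of "m (Suc i)"] by (auto simp: m_Suc keep_def intro!: sum.cong)
    then show ?thesis using sum.remove[OF finK XK, of "nxt (m i)"] by simp
  qed
  have mass: "(\<Sum>i<N. nxt (m i) X) = 1 - sum (m N) ?K" for N
  proof (induction N)
    case 0 then show ?case using pdistD(3)[OF pdist_dirac[OF finK XK]] by (simp add: m_0)
  next
    case (Suc N) then show ?case using mass_nxt[of N] mass_split[of N] by simp
  qed
  have mass1: "sum (m i) ?K \<le> 1" for i
  proof -
    have "0 \<le> (\<Sum>i<i. nxt (m i) X)" using nxt0 m0 by (intro sum_nonneg) blast
    then show ?thesis using mass[of i] by simp
  qed
  have step: "ctrans S (m i) Tau (nxt (m i))" for i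
    using move_ctrans[OF S, of Tau "run (m i)"] run0[OF m0] mass1[of i] src_run[of i] srcm_total[of "run (m i)"]
    by (simp add: nxt_def)
  define mx where "mx i = (\<lambda>x. nxt (m i) X * dirac X x)" for i
  have nsplit: "nxt (m i) = (\<lambda>x. m (Suc i) x + mx i x)" for i
    by (auto simp: mx_def m_Suc keep_def dirac_def)
  \<comment> \<open>The indices are shifted by one: the first step out of \<open>X\<close> is the
    strong \<open>\<tau>\<close>-step demanded by \<open>wtransa\<close>, and the derivation starts
    after it.\<close>
  have "derivation S (\<lambda>i. m (Suc i)) mx"
    unfolding derivation_def
  proof (intro allI conjI)
    fix i
    show "subdist (m (Suc i))" by (rule subdistI[OF finK mK m0 mass1])
    have "0 \<le> sum (m (Suc i)) ?K" by (intro sum_nonneg m0)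
    then have "nxt (m i) X \<le> 1" using mass_split[of i] mass_nxt[of i] mass1[of i] by linarith
    then show "subdist (mx i)" using nxt0 m0 by (intro subdistI[of "{X}"]) (auto simp: mx_def)
    show "ctrans S (m (Suc i)) Tau (\<lambda>x. m (Suc (Suc i)) x + mx (Suc i) x)"
      using step[of "Suc i"] unfolding nsplit .
  qed
  moreover have "(\<lambda>i. mx i x) sums dirac X x" for x
  proof -
    \<comment> \<open>Bounded occupation sums force the unreturned mass to tend to 0, so the
      returning masses sum to 1.\<close>
    have "summable (\<lambda>i. m i y)" for y by (rule summableI_nonneg_bounded[OF m0 occ])
    then have "(\<lambda>N. sum (m N) ?K) \<longlonglongrightarrow> (\<Sum>y\<in>?K. 0)"
      by (intro tendsto_sum summable_LIMSEQ_zero)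
    then have "(\<lambda>N. 1 - sum (m N) ?K) \<longlonglongrightarrow> 1 - 0" by (intro tendsto_diff tendsto_const) simp
    then have "(\<lambda>i. nxt (m i) X) sums 1" unfolding sums_def mass by simp
    then have "(\<lambda>i. nxt (m i) X * dirac X x) sums (1 * dirac X x)" by (rule sums_mult2)
    then show ?thesis by (simp add: mx_def)
  qed
  ultimately have "wtrans S (nxt (dirac X)) (dirac X)"
    unfolding wtrans_def using nsplit[of 0] by (intro exI[of _ "\<lambda>i. m (Suc i)"] exI[of _ mx]) (simp add: m_0)
  then have "wtransa S (dirac X) Tau (dirac X)"
    unfolding wtransa_def using wtrans_dirac[of S X] step[of 0] by (auto simp: m_0)
  moreover obtain i where "i < length (fst S)" "X = EVar (fst S ! i)"
    using XK by (auto simp: in_set_conv_nth)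
  ultimately show False using gd by (auto simp: guarded_def)
qed

lemma wtransa_weak:
  assumes S: "standard S" and cf: "circulation_free (trs S Tau)" and w: "wtransa S \<nu> a \<mu>"
  shows "weak (trs S Tau) (trs S a) \<nu> \<mu>"
  using w wtrans_flow[OF S cf] ctrans_move[OF S] unfolding wtransa_def weak_def by blast

text \<open>The three stages of a weak \<open>\<tau>\<close>-transition from \<open>X\<close> to
  itself add up to a circulation, and the middle stage has total count 1.\<close>

lemma circulation_free_guarded:
  assumes S: "standard S" and cf: "circulation_free (trs S Tau)"
  shows "guarded S"
  unfolding guarded_def
proof
  let ?G = "trs S Tau" and ?K = "states S"
  interpret transitions ?K ?G by (rule transitions_trs[OF S])
  assume "\<exists>i<length (fst S). wtransa S (dirac (EVar (fst S ! i))) Tau (dirac (EVar (fst S ! i)))"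
  then obtain X where X: "X \<in> ?K" "wtransa S (dirac X) Tau (dirac X)" by (meson imageI nth_mem)
  obtain f1 g f2 where f: "\<forall>t\<in>?G. 0 \<le> f1 t" "\<forall>t\<in>?G. 0 \<le> g t" "\<forall>t\<in>?G. 0 \<le> f2 t"
      "\<And>x. srcm ?G g x = dirac X x - net ?G f1 x" "\<And>x. dirac X x = tgtm ?G g x - net ?G f2 x"
    using wtransa_weak[OF S cf X(2)] unfolding weak_def flow_def move_def by blast
  define h where "h t = 1 * (1 * f1 t + 1 * g t) + 1 * f2 t" for t
  have "net ?G h x = 0" for x
    unfolding h_def net_lin using f(4,5)[of x] net_def[of ?G g x] by simp
  moreover have "\<forall>t\<in>?G. 0 \<le> h t" using f by (simp add: h_def)
  ultimately have "\<forall>t\<in>?G. h t = 0"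
    using cf[unfolded circulation_free_def, THEN spec, of h] by blast
  then have "\<forall>t\<in>?G. g t = 0" using f(1-3) by (force simp: h_def)
  then have "sum g ?G = 0" by simp
  moreover have "sum g ?G = 1"
    using srcm_total[of g] net_total[of f1] pdist_dirac[OF finK X(1)] by (simp add: f(4) sum_subtractf pdistD)
  ultimately show False by simp
qed

section \<open>Saturation\<close>

text \<open>Flows and moves preserve total mass, so the unit of mass must make a step of
  \<open>H\<close>. That \<open>H\<close> is inhabited confines weak transitions to the finitely
  many actions occurring in the system.\<close>

lemma weak_pdist:
  assumes G: "transitions K G" and H: "transitions K H" and x: "x \<in> K" and w: "weak G H (dirac x) \<mu>"
  shows "pdist K \<mu>" "H \<noteq> {}"
proof -
  interpret G: transitions K G by (rule G)
  interpret H: transitions K H by (rule H)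
  obtain g where g: "flow G (dirac x) (srcm H g)" "flow G (tgtm H g) \<mu>" "\<And>x. 0 \<le> \<mu> x"
    using w unfolding weak_def move_def by blast
  have g1: "sum g H = 1"
    using G.flow_total[OF g(1)] pdistD(3)[OF pdist_dirac[OF G.finK x]] by (simp add: H.srcm_total)
  then have "sum \<mu> K = 1" using G.flow_total[OF g(2)] by (simp add: H.tgtm_total)
  moreover have "\<mu> y = 0" if "y \<notin> K" for y using G.flow_outside[OF g(2) that] H.tgtm_outside[OF that] by simp
  ultimately show "pdist K \<mu>" using g(3) by (simp add: pdist_def)
  show "H \<noteq> {}" using g1 by auto
qed

lemma fdist_bigoplusP:
  "weights (map w zs) \<Longrightarrow> (\<And>z. z \<in> set zs \<Longrightarrow> fdist Fm (A z)) \<Longrightarrow> fdist Fm (bigoplusP (map (\<lambda>z. (w z, A z)) zs))"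
proof (induction zs arbitrary: w rule: induct_list012)
  case (3 y z zs)
  note w = weights_map_Cons2[OF 3(3)]
  show ?case unfolding bigoplusP_map_Cons2 using w 3(2)[OF w(3)] 3(4) by (intro fdist.intros) auto
qed (auto simp: weights_def)

lemma ex_fdist:
  assumes "finite Fm" "pdist (EVar ` Fm) \<mu>"
  shows "\<exists>P. fdist Fm P \<and> den P = \<mu>"
proof -
  have fin: "finite (EVar ` Fm)" using assms(1) by simp
  obtain zs where zs: "set zs = {k \<in> EVar ` Fm. 0 < \<mu> k}" "weights (map \<mu> zs)"
    "\<And>g :: _ \<Rightarrow> real. (\<Sum>z\<leftarrow>zs. \<mu> z * g z) = (\<Sum>k\<in>EVar ` Fm. \<mu> k * g k)"
    by (rule support_list[OF fin assms(2)]) (rule that, blast+)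
  let ?P = "bigoplusP (map (\<lambda>k. (\<mu> k, PDirac k)) zs)"
  have "fdist Fm ?P" using zs(1) by (intro fdist_bigoplusP zs(2)) (auto intro: fdist.intros)
  moreover have "den ?P x = \<mu> x" for x
    using sum_dirac[OF fin, of \<mu>] pdistD(2)[OF assms(2)] by (simp add: den_bigoplusP[OF zs(2)] zs(3))
  ultimately show ?thesis by blast
qed

lemma den_subst:
  assumes "finite Fm" "fdist Fm P"
  shows "tree (substP \<sigma> P) \<and> den (substP \<sigma> P) = lift (EVar ` Fm) (substE \<sigma>) (den P)"
  using assms(2)
proof (induction rule: fdist.induct)
  case (1 X)
  have "lift (EVar ` Fm) (substE \<sigma>) (dirac (EVar X)) x = dirac (\<sigma> X) x" for x
    using lift_dirac[of "EVar ` Fm" "EVar X" "substE \<sigma>" x] 1 assms(1) by simp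
  then show ?case by auto
next
  case (2 P Q p)
  then show ?case by (simp add: lift_lin)
qed

lemma stdsum_foldr: "stdsum Fm E \<Longrightarrow> (\<And>F. F \<in> set Fs \<Longrightarrow> stdsum Fm F) \<Longrightarrow> stdsum Fm (foldr ESum Fs E)"
  by (induction Fs) (auto intro: stdsum.intros)

lemma prefixes_foldr: "prefixes (foldr ESum Fs E) = prefixes E \<union> (\<Union>F\<in>set Fs. prefixes F)"
  by (induction Fs) auto

lemma fvE_foldr: "fvE (foldr ESum Fs E) = fvE E \<union> (\<Union>F\<in>set Fs. fvE F)"
  by (induction Fs) auto

lemma subst_foldr_eq:
  assumes "eqE E' (substE \<sigma> E)" "\<And>F. F \<in> set Fs \<Longrightarrow> below (substE \<sigma> F) E'"
  shows "eqE E' (substE \<sigma> (foldr ESum Fs E))"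
  using assms(2)
proof (induction Fs)
  case Nil
  then show ?case using assms(1) by simp
next
  case (Cons F Fs)
  have "eqE (ESum E' (substE \<sigma> F)) E'" using Cons.prems by (simp add: below_def)
  moreover have "eqE (ESum (substE \<sigma> F) E') (ESum (substE \<sigma> F) (substE \<sigma> (foldr ESum Fs E)))"
    using Cons by (intro congSum reflE) auto
  ultimately show ?case using ax_comm symE transE by simp blast
qed

theorem mainTheorem19:
  fixes S :: "('a, 'v::infinite) eqsys" and E :: "('a, 'v) expE"
  assumes "standard S" and "guarded S" and "satisfies S E"
  shows "\<exists>T :: ('a, 'v) eqsys. standard T \<and> guarded T \<and> saturated T \<and> satisfies T E"
proof -
  note S = assms(1)
  define Xs where "Xs = fst S"
  define n where "n = length Xs"
  define R where "R i = snd S ! i" for i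
  define K where "K = states S"
  define G where "G = trs S"
  have fK: "finite K" by (simp add: K_def)
  have KX: "K = EVar ` set Xs" by (simp add: K_def Xs_def)
  have std: "stdsum (set Xs) (R i)" if "i < n" for i
    using standardD(3)[OF S] that by (simp add: Xs_def n_def R_def)
  have tr: "transitions K (G a)" for a using transitions_trs[OF S] by (simp add: K_def G_def)
  interpret \<tau>: transitions K "G Tau" by (rule tr)
  have cf: "circulation_free (G Tau)" using guarded_circulation_free[OF S assms(2)] by (simp add: G_def)
  have K_ex: "\<exists>i<n. k = EVar (Xs ! i)" if "k \<in> K" for k using that by (auto simp: KX n_def in_set_conv_nth)
  have XK: "EVar (Xs ! i) \<in> K" if "i < n" for i using that by (simp add: KX n_def)

  \<comment> \<open>The finite sets whose convex hull is the set of weak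
    \<open>a\<close>-transitions of \<open>x\<close>.\<close>
  define generates where "generates x a F \<longleftrightarrow> finite F \<and> (\<forall>v\<in>F. weak (G Tau) (G a) (dirac x) v) \<and>
    (\<forall>\<mu>. weak (G Tau) (G a) (dirac x) \<mu> \<longrightarrow> (\<exists>c. (\<forall>v\<in>F. 0 \<le> c v) \<and> sum c F = 1 \<and> \<mu> = (\<lambda>x. \<Sum>v\<in>F. c v * v x)))"
    for x a F
  define gen where "gen x a = (SOME F. generates x a F)" for x a
  have "generates x a (gen x a)" if "x \<in> K" for x a
  proof -
    have "dirac x y = 0" if "y \<notin> K" for y using \<open>x \<in> K\<close> that by (auto simp: dirac_def)
    then have "\<exists>F. generates x a F" unfolding generates_def by (rule \<tau>.weak_finitely_generated[OF cf tr])
    then show ?thesis unfolding gen_def by (rule someI_ex)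
  qed
  note gen = this[unfolded generates_def]
  note gen_fin = gen[THEN conjunct1] and gen_weak = gen[THEN conjunct2, THEN conjunct1, rule_format]
    and gen_all = gen[THEN conjunct2, THEN conjunct2, rule_format]

  \<comment> \<open>The type of actions may be infinite, but a right-hand side can receive only
    finitely many summands.\<close>
  define acts where "acts = (\<Union>i<n. fst ` prefixes (R i))"
  have fin_acts: "finite acts" by (auto simp: acts_def finite_prefixes)
  have acts: "a \<in> acts" if w: "weak (G Tau) (G a) (dirac x) \<mu>" and x: "x \<in> K" for a x \<mu>
  proof -
    obtain i \<nu> where "i < n" "step (R i) a \<nu>"
      using weak_pdist(2)[OF tr tr x w] by (auto simp: G_def trs_def n_def Xs_def R_def)
    then show ?thesis using step_stdsum[OF std] by (force simp: acts_def)
  qed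

  define tree_of :: "(('a, 'v) expE \<Rightarrow> real) \<Rightarrow> ('a, 'v) expP" where
    "tree_of v = (SOME P. fdist (set Xs) P \<and> den P = v)" for v
  have tree_of: "fdist (set Xs) (tree_of v)" "den (tree_of v) = v" if "pdist K v" for v
    using someI_ex[OF ex_fdist[of "set Xs" v]] that by (auto simp: tree_of_def KX)

  \<comment> \<open>Stated with flows of \<open>S\<close> instead of \<open>wtrans\<close>, so that
    flows can be composed for the second saturation condition.\<close>
  define reach where "reach x V \<longleftrightarrow> (\<exists>\<mu>. flow (G Tau) (dirac x) \<mu> \<and> (\<forall>y. 0 \<le> \<mu> y) \<and>
    (\<forall>j<n. 0 < \<mu> (EVar (Xs ! j)) \<longrightarrow> V \<in> fvE (R j)))" for x V
  define new where "new x = (\<Union>a\<in>acts. (\<lambda>v. EPre a (tree_of v)) ` gen x a) \<union> EVar ` {V \<in> nvars S. reach x V}" for x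
  have "nvars S \<subseteq> (\<Union>i<n. fvE (R i))"
    using standardD(2)[OF S] by (force simp: nvars_def n_def Xs_def R_def in_set_conv_nth)
  then have "finite (nvars S)" by (rule finite_subset) (auto simp: finite_fv)
  then have "finite (new x)" if "x \<in> K" for x using fin_acts gen_fin[OF that] by (simp add: new_def)
  then have "\<exists>L. set L = new x" if "x \<in> K" for x using that finite_list by blast
  then obtain L where L: "\<And>x. x \<in> K \<Longrightarrow> set (L x) = new x" by metis
  \<comment> \<open>\<open>R i\<close> is kept as the last summand, so no transition or variable of
    \<open>S\<close> is lost.\<close>
  define T' where "T' i = foldr ESum (L (EVar (Xs ! i))) (R i)" for i
  define T where "T = (Xs, map T' [0..<n])"
  have T [simp]: "fst T = Xs" "i < n \<Longrightarrow> snd T ! i = T' i" for i by (simp_all add: T_def)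
  have new: "F \<in> new x \<longleftrightarrow> (\<exists>a\<in>acts. \<exists>v\<in>gen x a. F = EPre a (tree_of v)) \<or> (\<exists>V\<in>nvars S. reach x V \<and> F = EVar V)" for F x
    by (auto simp: new_def)
  have gen_pdist: "pdist K v" if "x \<in> K" "v \<in> gen x a" for x v a
    using weak_pdist(1)[OF tr tr that(1) gen_weak[OF that]] .

  have stdT': "stdsum (set Xs) (T' i)" if i: "i < n" for i
    unfolding T'_def
  proof (rule stdsum_foldr[OF std[OF i]])
    fix F assume "F \<in> set (L (EVar (Xs ! i)))"
    then have "F \<in> new (EVar (Xs ! i))" using L[OF XK[OF i]] by simp
    then show "stdsum (set Xs) F"
      using tree_of(1)[OF gen_pdist[OF XK[OF i]]] by (auto simp: new nvars_def Xs_def intro: stdsum.intros)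
  qed
  have standardT: "standard T"
    using stdT' standardD(1)[OF S] by (auto simp: standard_def eqsys_def T_def Xs_def n_def)
  have statesT: "states T = K" by (simp add: KX)

  have stepT: "step (T' i) a \<mu> \<longleftrightarrow> step (R i) a \<mu> \<or> (a \<in> acts \<and> \<mu> \<in> gen (EVar (Xs ! i)) a)" if i: "i < n" for i a \<mu>
  proof -
    let ?x = "EVar (Xs ! i)"
    note den_gen = tree_of(2)[OF gen_pdist[OF XK[OF i]]]
    have "(\<exists>P. (a, P) \<in> (\<Union>F\<in>new ?x. prefixes F) \<and> \<mu> = den P) \<longleftrightarrow> a \<in> acts \<and> \<mu> \<in> gen ?x a"
    proof
      assume "\<exists>P. (a, P) \<in> (\<Union>F\<in>new ?x. prefixes F) \<and> \<mu> = den P"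
      then obtain F P where F: "F \<in> new ?x" "(a, P) \<in> prefixes F" "\<mu> = den P" by blast
      from F(1) show "a \<in> acts \<and> \<mu> \<in> gen ?x a" unfolding new using F(2,3) by (auto simp: den_gen)
    next
      assume a: "a \<in> acts \<and> \<mu> \<in> gen ?x a"
      then have "EPre a (tree_of \<mu>) \<in> new ?x" unfolding new by blast
      moreover have "(a, tree_of \<mu>) \<in> prefixes (EPre a (tree_of \<mu>))" by simp
      ultimately show "\<exists>P. (a, P) \<in> (\<Union>F\<in>new ?x. prefixes F) \<and> \<mu> = den P"
        using den_gen[of \<mu> a] a by (metis UN_iff)
    qed
    moreover have "prefixes (T' i) = prefixes (R i) \<union> (\<Union>F\<in>new ?x. prefixes F)"
      unfolding T'_def prefixes_foldr L[OF XK[OF i]] ..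
    ultimately show ?thesis
      unfolding step_stdsum[OF stdT'[OF i]] step_stdsum[OF std[OF i]]
      by (simp only: Un_iff conj_disj_distribR ex_disj_distrib)
  qed
  \<comment> \<open>This is the hypothesis of the refinement lemmas, which transfer freedom from
    circulations to \<open>T\<close> and expand flows of \<open>T\<close> into flows of
    \<open>S\<close>.\<close>
  have trsT: "weak (G Tau) (G a) (dirac (fst t)) (snd t)" if t': "t \<in> trs T a" for t a
  proof -
    obtain i \<mu> where t: "t = (EVar (Xs ! i), \<mu>)" "i < n" "step (T' i) a \<mu>"
      using t' by (auto simp: trs_def n_def)
    show ?thesis
    proof (cases "step (R i) a \<mu>")
      case True
      then have "t \<in> G a" using t by (auto simp: G_def trs_def Xs_def R_def n_def)
      then show ?thesis
        using move_weak[OF move_single[OF transitions.finG[OF tr]]] transitions.tgt[OF tr] pdistD(1) by metis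
    next
      case False
      then show ?thesis using gen_weak[OF XK[OF t(2)]] t stepT by auto
    qed
  qed
  have trT: "transitions K (trs T a)" for a using transitions_trs[OF standardT, of a] unfolding statesT .
  note refine = transitions.finG[OF trT] transitions.src[OF trT] trsT
  have cfT: "circulation_free (trs T Tau)"
    by (rule \<tau>.circulation_free_refine[OF refine cf])

  have saturatedT: "saturated T"
    unfolding saturated_def
  proof (intro conjI allI impI)
    fix i a \<mu>
    assume i: "i < length (fst T)" and w: "wtransa T (dirac (EVar (fst T ! i))) a \<mu>"
    define x where "x = (EVar (Xs ! i) :: ('a, 'v) expE)"
    have i: "i < n" and x: "x \<in> K" using i XK by (auto simp: n_def x_def)
    \<comment> \<open>Once the weak transition is expanded in \<open>S\<close>, it is a convex
      combination of generators, each of which is a single transition of \<open>T\<close>.\<close>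
    have wk: "weak (G Tau) (G a) (dirac x) \<mu>"
      using \<tau>.weak_refine[OF refine trsT wtransa_weak[OF standardT cfT w]] by (simp add: x_def)
    obtain c where c: "\<forall>v\<in>gen x a. 0 \<le> c v" "sum c (gen x a) = 1" "\<mu> = (\<lambda>y. \<Sum>v\<in>gen x a. c v * v y)"
      using gen_all[OF x wk] by blast
    obtain h where h: "bij_betw h {..<card (gen x a)} (gen x a)"
      using ex_bij_betw_nat_finite[OF gen_fin[OF x]] by (auto simp: atLeast0LessThan)
    have h': "h j \<in> gen x a" if "j < card (gen x a)" for j using h that bij_betwE by blast
    have "ctrans T (dirac x) a v" if "v \<in> gen x a" for v
      using that ctrans.base[of i T a v] stepT[OF i] acts[OF wk x] i by (simp add: x_def n_def)
    then have "ctrans T (\<lambda>y. \<Sum>j\<in>{..<card (gen x a)}. c (h j) * dirac x y) a (\<lambda>y. \<Sum>j\<in>{..<card (gen x a)}. c (h j) * h j y)"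
      using h' c(1,2) sum.reindex_bij_betw[OF h, of c] by (intro ctrans.comb) auto
    moreover have "(\<Sum>j\<in>{..<card (gen x a)}. c (h j) * dirac x y) = dirac x y" for y
      using sum.reindex_bij_betw[OF h, of c] c(2) by (simp flip: sum_distrib_right)
    moreover have "(\<Sum>j\<in>{..<card (gen x a)}. c (h j) * h j y) = \<mu> y" for y
      unfolding c(3) by (rule sum.reindex_bij_betw[OF h])
    ultimately show "ctrans T (dirac (EVar (fst T ! i))) a \<mu>" by (simp add: x_def)
  next
    fix i \<mu> V
    assume i: "i < length (fst T)" and as: "wtrans T (dirac (EVar (fst T ! i))) \<mu> \<and> V \<in> nvars T \<and>
      (\<forall>j<length (fst T). 0 < \<mu> (EVar (fst T ! j)) \<longrightarrow> V \<in> fvE (snd T ! j))"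
    define x where "x = (EVar (Xs ! i) :: ('a, 'v) expE)"
    have i: "i < n" and x: "x \<in> K" using i XK by (auto simp: n_def x_def)
    have w: "wtrans T (dirac x) \<mu>" and VT: "V \<in> nvars T"
      and VT': "\<And>j. j < n \<Longrightarrow> 0 < \<mu> (EVar (Xs ! j)) \<Longrightarrow> V \<in> fvE (T' j)" using as by (auto simp: x_def n_def)
    have fl: "flow (G Tau) (dirac x) \<mu>" and \<mu>0: "\<And>y. 0 \<le> \<mu> y"
      using \<tau>.flow_refine[OF refine wtrans_flow(1)[OF standardT cfT w]] wtrans_flow(2)[OF standardT cfT w] by auto
    have VX: "V \<notin> set Xs" using VT by (simp add: nvars_def)
    have refl: "reach (EVar (Xs ! j)) V" if "j < n" "V \<in> fvE (R j)" for j
      unfolding reach_def using that flow_refl[of "G Tau" "dirac (EVar (Xs ! j))"] standardD(1)[OF S]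
      by (intro exI[of _ "dirac (EVar (Xs ! j))"]) (auto simp: dirac_def Xs_def n_def nth_eq_iff_index_eq split: if_splits)
    have fvT': "V \<in> nvars S \<and> reach (EVar (Xs ! j)) V" if j: "j < n" and V: "V \<in> fvE (T' j)" for j
    proof (cases "V \<in> fvE (R j)")
      case True
      then show ?thesis using refl j VX standardD(2)[OF S] by (auto simp: nvars_def R_def Xs_def n_def)
    next
      case False
      then obtain F where F: "F \<in> new (EVar (Xs ! j))" "V \<in> fvE F"
        using V L[OF XK[OF j]] by (auto simp: T'_def fvE_foldr)
      moreover have "V \<notin> fvP (tree_of v)" if "v \<in> gen (EVar (Xs ! j)) a" for v a
        using VX fdist_tree[OF tree_of(1)[OF gen_pdist[OF XK[OF j] that]]] by blast
      ultimately show ?thesis by (auto simp: new)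
    qed
    obtain j where "j < n" "V \<in> fvE (T' j)" using VT by (auto simp: nvars_def T_def)
    then have VS: "V \<in> nvars S" using fvT' by blast
    \<comment> \<open>Each state in the support of \<open>\<mu>\<close> has its own flow in
      \<open>S\<close> to states containing \<open>V\<close>. Appending these flows to the one
      reaching \<open>\<mu>\<close> shows that \<open>x\<close> reaches \<open>V\<close>; Dirac
      measures fill in for the other states.\<close>
    have "\<forall>k\<in>K. \<exists>m. flow (G Tau) (dirac k) m \<and> (\<forall>y. 0 \<le> m y) \<and>
        (0 < \<mu> k \<longrightarrow> (\<forall>j<n. 0 < m (EVar (Xs ! j)) \<longrightarrow> V \<in> fvE (R j)))"
    proof
      fix k assume "k \<in> K"
      then obtain j where j: "j < n" "k = EVar (Xs ! j)" using K_ex by blast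
      show "\<exists>m. flow (G Tau) (dirac k) m \<and> (\<forall>y. 0 \<le> m y) \<and>
        (0 < \<mu> k \<longrightarrow> (\<forall>j<n. 0 < m (EVar (Xs ! j)) \<longrightarrow> V \<in> fvE (R j)))"
      proof (cases "0 < \<mu> k")
        case True
        then show ?thesis using fvT'[OF j(1)] VT'[OF j(1)] j(2) by (auto simp: reach_def)
      next
        case False
        then show ?thesis using flow_refl[of "G Tau" "dirac k"] by (intro exI[of _ "dirac k"]) auto
      qed
    qed
    from bchoice[OF this] obtain m where m: "\<And>k. k \<in> K \<Longrightarrow> flow (G Tau) (dirac k) (m k)" "\<And>k y. k \<in> K \<Longrightarrow> 0 \<le> m k y"
        "\<And>k j. k \<in> K \<Longrightarrow> 0 < \<mu> k \<Longrightarrow> j < n \<Longrightarrow> 0 < m k (EVar (Xs ! j)) \<Longrightarrow> V \<in> fvE (R j)"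
      by blast
    define \<kappa> where "\<kappa> = (\<lambda>y. \<Sum>k\<in>K. \<mu> k * m k y)"
    have "\<mu> y = 0" if "y \<notin> K" for y using \<tau>.flow_outside[OF fl that] that x by (auto simp: dirac_def)
    then have "\<mu> = (\<lambda>y. \<Sum>k\<in>K. \<mu> k * dirac k y)" by (simp add: sum_dirac[OF fK])
    then have "flow (G Tau) \<mu> \<kappa>" using flow_sum[of K \<mu> "G Tau" dirac m] \<mu>0 m(1) by (simp add: \<kappa>_def)
    then have "flow (G Tau) (dirac x) \<kappa>" using fl flow_trans by blast
    moreover have "0 \<le> \<kappa> y" for y unfolding \<kappa>_def using \<mu>0 m(2) by (intro sum_nonneg mult_nonneg_nonneg)
    moreover have "V \<in> fvE (R j)" if j: "j < n" "0 < \<kappa> (EVar (Xs ! j))" for j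
    proof -
      have "(\<Sum>k\<in>K. \<mu> k * m k (EVar (Xs ! j))) \<noteq> 0" using j(2) by (simp add: \<kappa>_def)
      then obtain k where k: "k \<in> K" "\<mu> k * m k (EVar (Xs ! j)) \<noteq> 0"
        by (rule sum.not_neutral_contains_not_neutral)
      then have "0 < \<mu> k" "0 < m k (EVar (Xs ! j))" using \<mu>0[of k] m(2)[of k] by (auto simp: less_le)
      then show ?thesis using m(3) k(1) j(1) by blast
    qed
    ultimately have "reach x V" unfolding reach_def by blast
    then have "EVar V \<in> new x" using VS by (auto simp: new)
    then show "V \<in> fvE (snd T ! i)" using L[OF x] i by (force simp: T'_def fvE_foldr x_def)
  qed

  have "satisfies T E"
  proof -
    obtain Es where Es: "length Es = n" "Es \<noteq> []" "E = Es ! 0" "\<forall>F\<in>set Es. wfE F"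
        "\<And>i. i < n \<Longrightarrow> eqE (Es ! i) (substE (simsub Xs Es) (R i))"
      using assms(3) by (auto simp: satisfies_def n_def Xs_def R_def)
    define \<sigma> where "\<sigma> = simsub Xs Es"
    define e where "e = substE \<sigma>"
    have eX: "e (EVar (Xs ! i)) = Es ! i" if "i < n" for i
      using that map_of_zip_nth[of Xs Es i] standardD(1)[OF S] Es(1)
      by (simp add: e_def \<sigma>_def simsub_def Xs_def n_def)
    have eR: "eqE (substE \<sigma> (R i)) (e (EVar (Xs ! i)))" if "i < n" for i
      using symE[OF Es(5)[OF that]] eX[OF that] by (simp add: \<sigma>_def)
    have \<sigma>V: "\<sigma> V = EVar V" if "V \<notin> set Xs" for V
      using that Es(1) by (auto simp: \<sigma>_def simsub_def n_def split: option.split dest: map_of_SomeD set_zip_leftD)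
    have abs: "absorbs K e a (fst t) (snd t)" if t: "t \<in> G a" for t a
    proof -
      obtain i P where i: "i < n" "fst t = EVar (Xs ! i)" "snd t = den P" "(a, P) \<in> prefixes (R i)"
        using t step_stdsum[OF std] by (auto simp: G_def trs_def Xs_def R_def n_def)
      have P: "fdist (set Xs) P" using prefixes_fdist[OF std[OF i(1)] i(4)] .
      have "below (EPre a (substP \<sigma> P)) (e (fst t))"
        using below_cong[OF below_prefix[OF std[OF i(1)] i(4)] reflE eR[OF i(1)]] i(2) by simp
      then show ?thesis
        using absorbsI[of K "snd t" "substP \<sigma> P" e a "fst t"] den_subst[OF _ P, of \<sigma>] transitions.tgt[OF tr t] i(3)
        by (simp add: KX e_def)
    qed
    \<comment> \<open>The same \<open>Es\<close> solves \<open>T\<close>: only the new summands have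
      to be shown absorbed, the generators by \<open>weak_absorbs\<close> and the variables by
      \<open>flow_below\<close>.\<close>
    have "eqE (Es ! i) (substE \<sigma> (T' i))" if i: "i < n" for i
      unfolding T'_def
    proof (rule subst_foldr_eq)
      show "eqE (Es ! i) (substE \<sigma> (R i))" using Es(5)[OF i] by (simp add: \<sigma>_def)
      define x where "x = (EVar (Xs ! i) :: ('a, 'v) expE)"
      have x: "x \<in> K" using XK[OF i] by (simp add: x_def)
      fix F assume "F \<in> set (L (EVar (Xs ! i)))"
      then have "F \<in> new x" using L[OF x] by (simp add: x_def)
      then consider (pre) a v where "v \<in> gen x a" "F = EPre a (tree_of v)"
        | (var) V where "V \<in> nvars S" "reach x V" "F = EVar V"
        unfolding new by blast
      then have "below (substE \<sigma> F) (e x)"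
      proof cases
        case pre
        have v: "pdist K v" using gen_pdist[OF x pre(1)] .
        have "absorbs K e a x v"
          by (rule weak_absorbs[OF fK tr cf abs tr abs x gen_weak[OF x pre(1)]])
        then show ?thesis
          using absorbsD[of K e a x v "substP \<sigma> (tree_of v)"] den_subst[OF _ tree_of(1)[OF v], of \<sigma>] tree_of(2)[OF v] pre(2)
          by (simp add: KX e_def)
      next
        case var
        have VX: "V \<notin> set Xs" using var(1) by (simp add: nvars_def Xs_def)
        obtain \<mu> where \<mu>: "flow (G Tau) (dirac x) \<mu>" "\<And>y. 0 \<le> \<mu> y"
          "\<And>j. j < n \<Longrightarrow> 0 < \<mu> (EVar (Xs ! j)) \<Longrightarrow> V \<in> fvE (R j)"
          using var(2) by (auto simp: reach_def)
        have "below (EVar V) (e x)"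
        proof (rule flow_below[OF fK tr cf abs x \<mu>(1,2)])
          fix k assume "k \<in> K" "0 < \<mu> k"
          then obtain j where j: "j < n" "k = EVar (Xs ! j)" "V \<in> fvE (R j)" using K_ex \<mu>(3) by blast
          show "below (EVar V) (e k)"
            using below_cong[OF below_var[OF std[OF j(1)] j(3) VX, of \<sigma>] reflE eR[OF j(1)]] \<sigma>V[OF VX] j(2) by simp
        qed
        then show ?thesis using var(3) \<sigma>V[OF VX] by simp
      qed
      then show "below (substE \<sigma> F) (Es ! i)" using eX[OF i] by (simp add: x_def)
    qed
    then show ?thesis
      unfolding satisfies_def using Es(1-4) by (intro exI[of _ Es]) (simp add: n_def \<sigma>_def)
  qed
  then show ?thesis using standardT circulation_free_guarded[OF standardT cfT] saturatedT by blast
qed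

end
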